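(* Let $M$ be an $n$-dimensional ($n\ge 2$) smooth compact connected manifold with smooth boundary $\partial M$, equipped with a Riemannian metric $g$ with measurable bounded coefficients satisfying the uniform ellipticity condition. Let $\Gamma$ be any fixed non-empty open subset of $\partial M$. Assume that $c$ is a smooth positive function on $M$ such that $c=1$ on $\Gamma$ and such that $$\int_M\langle d(c^{n-2}),dw\rangle_g\,dVol_g=0\quad\text{for all } w\in H^1(M)\text{ such that }\operatorname{supp}\,(w|_{\partial M})\subset\Gamma .$$ Then $$\Lambda_{c^4 g,\Gamma}=\Lambda_{g,\Gamma}.$$
   Context: Metrics. The Riemannian metric $g=(g_{ij})$ has merely measurable bounded coefficients and is uniformly elliptic: in local coordinates there is a constant $\kappa>0$ with $\sum_{i,j}g^{ij}(x)\xi_i\xi_j\ge \kappa|\xi|^2$ for a.e. $x\in M$ and all $\xi\in\mathbb{R}^n$, where $(g^{ij})$ is the inverse of $(g_{ij})$. Write $\langle du,dw\rangle_g=g^{ij}\partial_i u\,\partial_j w$ and let $dVol_g$ be the Riemannian volume element. The restriction $w|_{\partial M}$ of $w\in H^1(M)$ is understood in the sense of traces. Dirichlet problem. Let $\Delta_g=\frac{1}{\sqrt{|g|}}\partial_i\left(\sqrt{|g|}\,g^{ij}\partial_j\right)$, with $|g|=\det(g_{ij})$. For $\psi\in H^{1/2}(\partial M)$ there is a unique weak solution $u\in H^1(M)$ of $-\Delta_g u=0$ on $M$, $u=\psi$ on $\partial M$; that is, $\int_M\langle du,dw\rangle_g\,dVol_g=0$ for all $w\in H^1_0(M)$ and the trace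 of $u$ on $\partial M$ is $\psi$. Partial Dirichlet-to-Neumann map. Let $H^{1/2}_{co}(\Gamma)=\{f\in H^{1/2}(\partial M) : \operatorname{supp} f\subset\Gamma\}$. The partial Dirichlet-to-Neumann map $\Lambda_{g,\Gamma}$ is defined by $$\langle\Lambda_{g,\Gamma}(\psi)\,|\,\phi\rangle=\int_M\langle du,dv\rangle_g\,dVol_g\quad\text{for all }\psi,\phi\in H^{1/2}_{co}(\Gamma),$$ where $u$ is the unique weak solution in $H^1(M)$ of the Dirichlet problem $-\Delta_g u=0$ on $M$, $u=\psi$ on $\partial M$, $v$ is any element of $H^1(M)$ with $v|_{\partial M}=\phi$, and $\langle\cdot|\cdot\rangle$ is the $L^2$ duality pairing between $H^{1/2}(\partial M)$ and its dual. The map $\Lambda_{c^4g,\Gamma}$ is defined in the same way with the metric $c^4g$ in place of $g$. *)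

theory Defs
  imports "HOL-Analysis.Analysis"
begin

section \<open>Smooth maps\<close>

text \<open>Meaningful for open \<open>S\<close>: \<open>f\<close> is \<open>k\<close> times continuously differentiable on \<open>S\<close>.\<close>

primrec Ck_on :: "nat \<Rightarrow> 'a::real_normed_vector set \<Rightarrow> ('a \<Rightarrow> 'b::real_normed_vector) \<Rightarrow> bool" where
  "Ck_on 0 S f \<longleftrightarrow> continuous_on S f"
| "Ck_on (Suc k) S f \<longleftrightarrow> (\<forall>x\<in>S. f differentiable (at x)) \<and>
     (\<forall>v. Ck_on k S (\<lambda>x. frechet_derivative f (at x) v))"

definition smooth_on :: "'a::real_normed_vector set \<Rightarrow> ('a \<Rightarrow> 'b::real_normed_vector) \<Rightarrow> bool" where
  "smooth_on S f \<longleftrightarrow> (\<forall>k. Ck_on k S f)"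

text \<open>Smoothness on a set that need not be open (here: a relatively open subset of a closed
  half-space) means local extendability to smooth maps on open sets.\<close>

definition smooth_rel :: "'a::real_normed_vector set \<Rightarrow> ('a \<Rightarrow> 'b::real_normed_vector) \<Rightarrow> bool" where
  "smooth_rel S f \<longleftrightarrow>
     (\<forall>x\<in>S. \<exists>V F. open V \<and> x \<in> V \<and> smooth_on V F \<and> (\<forall>y\<in>V \<inter> S. F y = f y))"

definition test_functions :: "'a::real_normed_vector set \<Rightarrow> ('a \<Rightarrow> real) set" where
  "test_functions V = {\<eta>. smooth_on UNIV \<eta> \<and> compact (closure {x. \<eta> x \<noteq> 0}) \<and>
     closure {x. \<eta> x \<noteq> 0} \<subseteq> V}"

section \<open>Compact manifolds with boundary\<close>

text \<open>The model space is the half-space on which one fixed coordinate (which one is immaterial)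
  is nonnegative.\<close>

definition bd_ix :: "'n::finite" where
  "bd_ix = (SOME i. True)"

definition half_space :: "(real^'n) set" where
  "half_space = {x. 0 \<le> x $ bd_ix}"

definition bd_hyperplane :: "(real^'n) set" where
  "bd_hyperplane = {x. x $ bd_ix = 0}"

text \<open>A chart \<open>(U, \<phi>)\<close> consists of its domain and the coordinate map.  The values of \<open>\<phi>\<close> outside
  of \<open>U\<close> are irrelevant.\<close>

type_synonym ('a, 'n) chart = "'a set \<times> ('a \<Rightarrow> real^'n)"

abbreviation chart_dom :: "('a, 'n::finite) chart \<Rightarrow> 'a set" where
  "chart_dom C \<equiv> fst C"

abbreviation chart_map :: "('a, 'n::finite) chart \<Rightarrow> 'a \<Rightarrow> real^'n" where
  "chart_map C \<equiv> snd C"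

definition chart_img :: "('a, 'n::finite) chart \<Rightarrow> (real^'n) set" where
  "chart_img C = chart_map C ` chart_dom C"

definition chart_inv :: "('a, 'n::finite) chart \<Rightarrow> real^'n \<Rightarrow> 'a" where
  "chart_inv C = inv_into (chart_dom C) (chart_map C)"

definition in_chart :: "('a, 'n::finite) chart \<Rightarrow> ('a \<Rightarrow> 'b) \<Rightarrow> real^'n \<Rightarrow> 'b" where
  "in_chart C u = (\<lambda>x. u (chart_inv C x))"

definition transition :: "('a, 'n::finite) chart \<Rightarrow> ('a, 'n) chart \<Rightarrow> real^'n \<Rightarrow> real^'n" where
  "transition C C' = in_chart C (chart_map C')"

definition is_chart :: "'a::t2_space set \<Rightarrow> ('a, 'n::finite) chart \<Rightarrow> bool" where
  "is_chart M C \<longleftrightarrow> openin (top_of_set M) (chart_dom C) \<and>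
     openin (top_of_set half_space) (chart_img C) \<and>
     homeomorphism (chart_dom C) (chart_img C) (chart_map C) (chart_inv C)"

definition smooth_atlas :: "'a::t2_space set \<Rightarrow> ('a, 'n::finite) chart set \<Rightarrow> bool" where
  "smooth_atlas M A \<longleftrightarrow> (\<forall>C\<in>A. is_chart M C) \<and> (\<Union>C\<in>A. chart_dom C) = M \<and>
     (\<forall>C\<in>A. \<forall>C'\<in>A. smooth_rel (chart_map C ` (chart_dom C \<inter> chart_dom C')) (transition C C'))"

text \<open>The atlas \<open>A\<close>, which need not be maximal, fixes the smooth structure.  The space is Hausdorff
  by the type class, and a compact space that is locally homeomorphic to the half-space
  is automatically second countable.\<close>

definition compact_connected_manifold :: "'a::t2_space set \<Rightarrow> ('a, 'n::finite) chart set \<Rightarrow> bool" where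
  "compact_connected_manifold M A \<longleftrightarrow> compact M \<and> connected M \<and> smooth_atlas M A"

definition mfd_boundary :: "('a, 'n::finite) chart set \<Rightarrow> 'a set" where
  "mfd_boundary A = {p. \<exists>C\<in>A. p \<in> chart_dom C \<and> chart_map C p \<in> bd_hyperplane}"

definition smooth_fun :: "('a, 'n::finite) chart set \<Rightarrow> ('a \<Rightarrow> real) \<Rightarrow> bool" where
  "smooth_fun A u \<longleftrightarrow> (\<forall>C\<in>A. smooth_rel (chart_img C) (in_chart C u))"

text \<open>Smooth functions with compact support in the interior of \<open>M\<close>.\<close>

definition Cc_interior :: "'a::t2_space set \<Rightarrow> ('a, 'n::finite) chart set \<Rightarrow> ('a \<Rightarrow> real) set" where
  "Cc_interior M A = {w. smooth_fun A w \<and>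
     (\<exists>K. compact K \<and> K \<subseteq> M - mfd_boundary A \<and> (\<forall>p\<in>M - K. w p = 0))}"

section \<open>Riemannian metrics with measurable coefficients\<close>

text \<open>A metric is given by its coefficient matrices \<open>g C x = (g\<^sub>i\<^sub>j(x))\<close>, where \<open>x\<close> ranges over the
  image of the chart \<open>C\<close>.  Since charts may degenerate towards the edge of their
  domain, the bounds are required on compact subsets of the chart images; as \<open>M\<close> is compact, this
  amounts to uniform bounds on finitely many coordinate patches that cover \<open>M\<close>.  Boundedness of the
  coefficients is required both of \<open>g\<^sub>i\<^sub>j\<close> and of \<open>g\<^sup>i\<^sup>j\<close>, i.e. \<open>g\<close> is comparable to the Euclidean
  metric from both sides.\<close>

type_synonym ('a, 'n) metric = "('a, 'n) chart \<Rightarrow> real^'n \<Rightarrow> real^'n^'n"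

definition riemannian_metric :: "('a, 'n::finite) chart set \<Rightarrow> ('a, 'n) metric \<Rightarrow> bool" where
  "riemannian_metric A g \<longleftrightarrow>
     (\<forall>C\<in>A. \<forall>i j. set_borel_measurable lebesgue (chart_img C) (\<lambda>x. g C x $ i $ j)) \<and>
     (\<forall>C\<in>A. AE x in lebesgue. x \<in> chart_img C \<longrightarrow>
        transpose (g C x) = g C x \<and> (\<forall>\<xi>. \<xi> \<noteq> 0 \<longrightarrow> 0 < \<xi> \<bullet> (g C x *v \<xi>))) \<and>
     (\<forall>C\<in>A. \<forall>C'\<in>A. AE x in lebesgue.
        x \<in> interior (chart_map C ` (chart_dom C \<inter> chart_dom C')) \<longrightarrow>
        (let T = transition C C'; J = matrix (frechet_derivative T (at x))
         in g C x = transpose J ** g C' (T x) ** J))"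

definition bounded_elliptic :: "('a, 'n::finite) chart set \<Rightarrow> ('a, 'n) metric \<Rightarrow> bool" where
  "bounded_elliptic A g \<longleftrightarrow>
     (\<forall>C\<in>A. \<forall>K. compact K \<and> K \<subseteq> chart_img C \<longrightarrow>
        (\<exists>B \<kappa>. 0 < \<kappa> \<and> (AE x in lebesgue. x \<in> K \<longrightarrow>
           (\<forall>i j. \<bar>g C x $ i $ j\<bar> \<le> B \<and> \<bar>matrix_inv (g C x) $ i $ j\<bar> \<le> B) \<and>
           (\<forall>\<xi>. (\<Sum>i\<in>UNIV. \<Sum>j\<in>UNIV. matrix_inv (g C x) $ i $ j * \<xi> $ i * \<xi> $ j) \<ge> \<kappa> * (norm \<xi>)\<^sup>2))))"

definition conformal :: "('a \<Rightarrow> real) \<Rightarrow> ('a, 'n::finite) metric \<Rightarrow> ('a, 'n) metric" where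
  "conformal f g = (\<lambda>C x. in_chart C f x *\<^sub>R g C x)"

section \<open>Integration over the manifold\<close>

text \<open>To integrate, \<open>M\<close> is cut into finitely many disjoint Borel pieces, each of which is
  contained in a compact subset of a chart domain.  By the change of variables formula the integral
  does not depend on the choice of the pieces.\<close>

definition is_patch_cover ::
    "'a::t2_space set \<Rightarrow> ('a, 'n::finite) chart set \<Rightarrow> (('a, 'n) chart \<times> 'a set) list \<Rightarrow> bool" where
  "is_patch_cover M A P \<longleftrightarrow> (\<forall>(C, K)\<in>set P. C \<in> A \<and> compact K \<and> K \<subseteq> chart_dom C) \<and>
     (\<Union>(C, K)\<in>set P. K) = M"

definition patches :: "'a::t2_space set \<Rightarrow> ('a, 'n::finite) chart set \<Rightarrow> (('a, 'n) chart \<times> 'a set) list" where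
  "patches M A = (SOME P. is_patch_cover M A P)"

lemma patch_cover_exists:
  fixes A :: "('a::t2_space, 'b::finite) chart set"
  assumes "compact_connected_manifold M A"
  shows "is_patch_cover M A (patches M A)"
proof -
  have cM: "compact M" and cov: "(\<Union>C\<in>A. chart_dom C) = M" and ch: "\<And>C. C \<in> A \<Longrightarrow> is_chart M C"
    using assms by (auto simp: compact_connected_manifold_def smooth_atlas_def)
  have loc: "\<exists>C K V. C \<in> A \<and> compact K \<and> K \<subseteq> chart_dom C \<and> openin (top_of_set M) V \<and> p \<in> V \<and> V \<subseteq> K"
    if pM: "p \<in> M" for p
  proof -
    obtain C where C: "C \<in> A" "p \<in> chart_dom C" using cov pM by blast
    have o1: "openin (top_of_set M) (chart_dom C)"
      and o2: "openin (top_of_set half_space) (chart_img C)"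
      and h: "homeomorphism (chart_dom C) (chart_img C) (chart_map C) (chart_inv C)"
      using ch[OF C(1)] by (auto simp: is_chart_def)
    have "chart_map C p \<in> chart_img C" using C(2) by (simp add: chart_img_def)
    then obtain e where e: "e > 0" "cball (chart_map C p) e \<inter> half_space \<subseteq> chart_img C"
      using o2 by (metis openin_contains_cball)
    define K where "K = chart_inv C ` (cball (chart_map C p) e \<inter> half_space)"
    define V where "V = chart_dom C \<inter> chart_map C -` ball (chart_map C p) e"
    have "closed (half_space :: (real^'b) set)"
      unfolding half_space_def by (intro closed_Collect_le continuous_intros)
    then have "compact (cball (chart_map C p) e \<inter> half_space)" by (simp add: compact_Int_closed)
    moreover have "continuous_on (cball (chart_map C p) e \<inter> half_space) (chart_inv C)"
      using h e(2) by (meson continuous_on_subset homeomorphism_def)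
    ultimately have "compact K" unfolding K_def by (rule compact_continuous_image[rotated])
    moreover have "K \<subseteq> chart_dom C"
      using h e(2) unfolding K_def homeomorphism_def by blast
    moreover have "openin (top_of_set (chart_dom C)) V"
      using h unfolding V_def homeomorphism_def by (meson continuous_openin_preimage_gen open_ball)
    then have "openin (top_of_set M) V" using o1 by (rule openin_trans)
    moreover have "p \<in> V" using C(2) e(1) by (simp add: V_def)
    moreover have "V \<subseteq> K"
    proof
      fix q assume q: "q \<in> V"
      then have "chart_map C q \<in> cball (chart_map C p) e \<inter> half_space"
        using openin_imp_subset[OF o2] by (auto simp: V_def chart_img_def)
      moreover have "chart_inv C (chart_map C q) = q"
        using q h by (auto simp: V_def homeomorphism_def)
      ultimately show "q \<in> K" unfolding K_def by (metis imageI)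
    qed
    ultimately show ?thesis using C(1) by blast
  qed
  then obtain c k v where ckv: "\<And>p. p \<in> M \<Longrightarrow> c p \<in> A \<and> compact (k p) \<and> k p \<subseteq> chart_dom (c p) \<and>
      openin (top_of_set M) (v p) \<and> p \<in> v p \<and> v p \<subseteq> k p"
    by metis
  have "\<exists>D\<subseteq>v ` M. finite D \<and> M \<subseteq> \<Union>D"
  proof -
    have "\<forall>V\<in>v ` M. openin (top_of_set M) V" "M \<subseteq> \<Union> (v ` M)" using ckv by blast+
    then show ?thesis using cM unfolding compact_eq_openin_cover by meson
  qed
  then obtain F where F: "F \<subseteq> M" "finite F" "M \<subseteq> (\<Union>p\<in>F. v p)"
    using finite_subset_image by (metis (no_types, lifting))
  obtain ps where ps: "set ps = F" using F(2) finite_list by blast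
  have sub: "k p \<subseteq> M" if "p \<in> F" for p using ckv[of p] cov F(1) that by blast
  have "M \<subseteq> (\<Union>p\<in>F. k p)" using F ckv by blast
  then have "(\<Union>p\<in>F. k p) = M" using sub by blast
  moreover have "\<forall>p\<in>F. c p \<in> A \<and> compact (k p) \<and> k p \<subseteq> chart_dom (c p)"
    using ckv F(1) by (metis subsetD)
  ultimately have "is_patch_cover M A (map (\<lambda>p. (c p, k p)) ps)"
    by (simp add: is_patch_cover_def ps)
  then show ?thesis unfolding patches_def by (rule someI)
qed

definition piece :: "(('a, 'n::finite) chart \<times> 'a set) list \<Rightarrow> nat \<Rightarrow> 'a set" where
  "piece P k = snd (P ! k) - (\<Union>j<k. snd (P ! j))"

text \<open>\<open>vol_integral M A g F\<close> is the integral of a scalar function against the volume element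
  of \<open>g\<close>; the function is given by its expressions \<open>F C\<close> in the coordinates of the charts \<open>C\<close>.\<close>

definition vol_integral :: "'a::t2_space set \<Rightarrow> ('a, 'n::finite) chart set \<Rightarrow> ('a, 'n) metric \<Rightarrow>
    (('a, 'n) chart \<Rightarrow> real^'n \<Rightarrow> real) \<Rightarrow> real" where
  "vol_integral M A g F = (let P = patches M A in
     \<Sum>k<length P. let C = fst (P ! k) in
       (LINT x : chart_map C ` piece P k | lebesgue. F C x * sqrt (det (g C x))))"

text \<open>Lebesgue measure on the boundary hyperplane of the half-space.\<close>

definition lebesgue_bd :: "(real^'n::finite) measure" where
  "lebesgue_bd = completion (distr (\<Pi>\<^sub>M i\<in>UNIV - {bd_ix}. lborel) borel
     (\<lambda>f. \<chi> i. if i = bd_ix then 0 else f i))"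

definition bd_null :: "('a, 'n::finite) chart set \<Rightarrow> 'a set \<Rightarrow> bool" where
  "bd_null A N \<longleftrightarrow> (\<forall>C\<in>A. chart_map C ` (N \<inter> mfd_boundary A \<inter> chart_dom C) \<in> null_sets lebesgue_bd)"

section \<open>Sobolev spaces and traces\<close>

text \<open>Elements of the function spaces are represented by functions on \<open>M\<close> (resp. on its boundary);
  functions that agree almost everywhere represent the same element.  As \<open>M\<close> is compact,
  all integrability and convergence conditions may be imposed on compact subsets of the
  chart images, which are allowed to touch the boundary hyperplane.\<close>

definition L2_on :: "'a measure \<Rightarrow> 'a set \<Rightarrow> ('a \<Rightarrow> 'b::euclidean_space) \<Rightarrow> bool" where
  "L2_on \<mu> K f \<longleftrightarrow> set_borel_measurable \<mu> K f \<and> set_integrable \<mu> K (\<lambda>x. (norm (f x))\<^sup>2)"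

definition L2_tendsto_on ::
    "'a measure \<Rightarrow> 'a set \<Rightarrow> (nat \<Rightarrow> 'a \<Rightarrow> 'b::euclidean_space) \<Rightarrow> ('a \<Rightarrow> 'b) \<Rightarrow> bool" where
  "L2_tendsto_on \<mu> K fs f \<longleftrightarrow> (\<forall>k. L2_on \<mu> K (fs k)) \<and> L2_on \<mu> K f \<and>
     (\<lambda>k. LINT x : K | \<mu>. (norm (fs k x - f x))\<^sup>2) \<longlonglongrightarrow> 0"

definition weak_gradient :: "(real^'n) set \<Rightarrow> (real^'n \<Rightarrow> real) \<Rightarrow> (real^'n \<Rightarrow> real^'n::finite) \<Rightarrow> bool" where
  "weak_gradient V f G \<longleftrightarrow>
     (\<forall>K. compact K \<and> K \<subseteq> V \<longrightarrow> set_integrable lebesgue K f \<and> set_integrable lebesgue K G) \<and>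
     (\<forall>\<eta>\<in>test_functions V. \<forall>i.
        (LINT x : V | lebesgue. f x * frechet_derivative \<eta> (at x) (axis i 1)) =
        - (LINT x : V | lebesgue. G x $ i * \<eta> x))"

text \<open>The coordinate vector of \<open>du\<close> in a chart; it is determined up to null sets.\<close>

definition wgrad :: "('a \<Rightarrow> real) \<Rightarrow> ('a, 'n::finite) chart \<Rightarrow> real^'n \<Rightarrow> real^'n" where
  "wgrad u C = (SOME G. weak_gradient (interior (chart_img C)) (in_chart C u) G)"

definition H1 :: "('a, 'n::finite) chart set \<Rightarrow> ('a \<Rightarrow> real) set" where
  "H1 A = {u. \<forall>C\<in>A.
     (\<exists>G. weak_gradient (interior (chart_img C)) (in_chart C u) G) \<and>
     (\<forall>K. compact K \<and> K \<subseteq> chart_img C \<longrightarrow>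
        L2_on lebesgue K (in_chart C u) \<and> L2_on lebesgue K (wgrad u C))}"

definition H1_tendsto :: "('a, 'n::finite) chart set \<Rightarrow> (nat \<Rightarrow> 'a \<Rightarrow> real) \<Rightarrow> ('a \<Rightarrow> real) \<Rightarrow> bool" where
  "H1_tendsto A us u \<longleftrightarrow> (\<forall>k. us k \<in> H1 A) \<and> u \<in> H1 A \<and>
     (\<forall>C\<in>A. \<forall>K. compact K \<and> K \<subseteq> chart_img C \<longrightarrow>
        L2_tendsto_on lebesgue K (\<lambda>k. in_chart C (us k)) (in_chart C u) \<and>
        L2_tendsto_on lebesgue K (\<lambda>k. wgrad (us k) C) (wgrad u C))"

definition L2_bd_tendsto :: "('a, 'n::finite) chart set \<Rightarrow> (nat \<Rightarrow> 'a \<Rightarrow> real) \<Rightarrow> ('a \<Rightarrow> real) \<Rightarrow> bool" where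
  "L2_bd_tendsto A fs f \<longleftrightarrow>
     (\<forall>C\<in>A. \<forall>K. compact K \<and> K \<subseteq> chart_img C \<inter> bd_hyperplane \<longrightarrow>
        L2_tendsto_on lebesgue_bd K (\<lambda>k. in_chart C (fs k)) (in_chart C f))"

definition H10 :: "'a::t2_space set \<Rightarrow> ('a, 'n::finite) chart set \<Rightarrow> ('a \<Rightarrow> real) set" where
  "H10 M A = {w. \<exists>ws. (\<forall>k. ws k \<in> Cc_interior M A) \<and> H1_tendsto A ws w}"

text \<open>The trace is the continuous extension to the space \<open>H1\<close>, with values in \<open>L\<^sup>2\<close> of the boundary, of
  the restriction of smooth functions to the boundary.  \<open>has_trace A w f\<close> says that \<open>f\<close> represents
  the trace of \<open>w\<close>.\<close>

definition has_trace :: "('a, 'n::finite) chart set \<Rightarrow> ('a \<Rightarrow> real) \<Rightarrow> ('a \<Rightarrow> real) \<Rightarrow> bool" where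
  "has_trace A w f \<longleftrightarrow> (\<exists>ws. (\<forall>k. smooth_fun A (ws k)) \<and> H1_tendsto A ws w \<and> L2_bd_tendsto A ws f)"

text \<open>The Sobolev--Slobodeckij space of order \<open>1/2\<close> on the \<open>(n-1)\<close>-dimensional boundary; the exponent
  of the denominator is \<open>(n - 1) + 2 \<cdot> 1/2 = n\<close>.\<close>

definition H12_bd :: "('a, 'n::finite) chart set \<Rightarrow> ('a \<Rightarrow> real) set" where
  "H12_bd A = {f. \<forall>C\<in>A. \<forall>K. compact K \<and> K \<subseteq> chart_img C \<inter> bd_hyperplane \<longrightarrow>
     L2_on lebesgue_bd K (in_chart C f) \<and>
     set_integrable (lebesgue_bd \<Otimes>\<^sub>M lebesgue_bd) (K \<times> K)
       (\<lambda>(x, y). (in_chart C f x - in_chart C f y)\<^sup>2 / norm (x - y) ^ CARD('n))}"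

definition bd_support :: "('a::t2_space, 'n::finite) chart set \<Rightarrow> ('a \<Rightarrow> real) \<Rightarrow> 'a set" where
  "bd_support A f = {p \<in> mfd_boundary A.
     \<forall>W. openin (top_of_set (mfd_boundary A)) W \<and> p \<in> W \<longrightarrow> \<not> bd_null A {q\<in>W. f q \<noteq> 0}}"

definition H12_co :: "('a::t2_space, 'n::finite) chart set \<Rightarrow> 'a set \<Rightarrow> ('a \<Rightarrow> real) set" where
  "H12_co A \<Gamma> = {f \<in> H12_bd A. bd_support A f \<subseteq> \<Gamma>}"

section \<open>Dirichlet problem and Dirichlet-to-Neumann map\<close>

definition pairing :: "('a, 'n::finite) metric \<Rightarrow> ('a \<Rightarrow> real) \<Rightarrow> ('a \<Rightarrow> real) \<Rightarrow>
    ('a, 'n) chart \<Rightarrow> real^'n \<Rightarrow> real" where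
  "pairing g u w C x =
     (\<Sum>i\<in>UNIV. \<Sum>j\<in>UNIV. matrix_inv (g C x) $ i $ j * wgrad u C x $ i * wgrad w C x $ j)"

definition weak_solution :: "'a::t2_space set \<Rightarrow> ('a, 'n::finite) chart set \<Rightarrow> ('a, 'n) metric \<Rightarrow>
    ('a \<Rightarrow> real) \<Rightarrow> ('a \<Rightarrow> real) \<Rightarrow> bool" where
  "weak_solution M A g \<psi> u \<longleftrightarrow> u \<in> H1 A \<and> has_trace A u \<psi> \<and>
     (\<forall>w\<in>H10 M A. vol_integral M A g (pairing g u w) = 0)"

text \<open>The functional \<open>DN_map M A g \<Gamma> \<psi>\<close> on \<open>H12_co A \<Gamma>\<close> sends \<open>\<phi>\<close> to the pairing of the image
  of \<open>\<psi>\<close> under the partial Dirichlet-to-Neumann map with \<open>\<phi>\<close>.  The number described by \<open>THE\<close> is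
  unique because the weak solution \<open>u\<close> is unique up to null sets, and because two extensions \<open>v\<close> of
  \<open>\<phi>\<close> differ by an element of \<open>H10 M A\<close>.\<close>

definition DN_map :: "'a::t2_space set \<Rightarrow> ('a, 'n::finite) chart set \<Rightarrow> ('a, 'n) metric \<Rightarrow> 'a set \<Rightarrow>
    ('a \<Rightarrow> real) \<Rightarrow> ('a \<Rightarrow> real) \<Rightarrow> real" where
  "DN_map M A g \<Gamma> = (\<lambda>\<psi>\<in>H12_co A \<Gamma>. \<lambda>\<phi>\<in>H12_co A \<Gamma>. THE r. \<exists>u v.
     weak_solution M A g \<psi> u \<and> v \<in> H1 A \<and> has_trace A v \<phi> \<and>
     r = vol_integral M A g (pairing g u v))"

end

theory Submission
  imports Defs
begin

text \<open>
  Write \<open>q = c\<^sup>n\<^sup>-\<^sup>2\<close>. In terms of \<open>g\<close>, the Dirichlet form of \<open>c\<^sup>4g\<close> has the density \<open>q\<^sup>2\<langle>du,dv\<rangle>\<close>,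
  and \<open>q\<^sup>2\<langle>du,dv\<rangle> = \<langle>d(qu),d(qv)\<rangle> - \<langle>dq,d(quv)\<rangle>\<close>. If \<open>u\<close> has a trace supported in \<open>\<Gamma>\<close> and \<open>v\<close> is
  smooth, then \<open>quv\<close> is in \<open>H\<^sup>1\<close> with trace supported in \<open>\<Gamma>\<close>, so by assumption the last term
  integrates to \<open>0\<close>; for general \<open>v\<close> (where \<open>quv\<close> is only in \<open>W\<^sup>1\<^sup>,\<^sup>1\<close>) one passes to the limit
  along smooth approximants of \<open>v\<close>. Since \<open>q = 1\<close> on \<open>\<Gamma>\<close>, the map \<open>u \<mapsto> qu\<close> preserves traces
  supported in \<open>\<Gamma>\<close>. It is therefore a bijection from the weak solutions for \<open>c\<^sup>4g\<close> to those for
  \<open>g\<close>, and it carries one Dirichlet form to the other.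

  The gradients of \<open>H\<^sup>1\<close> functions are selected by \<open>SOME\<close>, so the product rule for them needs the
  uniqueness of weak gradients, for which smooth bump functions are built from \<open>exp (- 1/x)\<close>.
\<close>

section \<open>Smooth functions and bump functions\<close>

text \<open>The power n - 2 is forced by scaling. Passing to \<open>c^4 g\<close> multiplies the
  volume density by c^(2n) and the inverse matrix by c^(-4), so the Dirichlet density gains the
  factor c^(2n-4), the square of \<open>q\<close>. A square is what the substitution of qu and qv
  for u and v can absorb: one factor \<open>q\<close> goes to each argument.

  The hypothesis on \<open>c\<close> tests only against functions in \<open>H1\<close> with trace
  supported in \<Gamma>. A product of two such functions need not be in \<open>H1\<close>, so one
  argument is smoothed, while the trace of the other localises the product in \<Gamma>. The passage
  to the limit is possible because, for fixed \<open>u\<close>, both forms are continuous in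
  \<open>v\<close> with respect to \<open>H1\<close> convergence: the coefficients are bounded on
  compact patches.

  The identity of the forms is used in two roles. With \<open>v\<close> in \<open>H10\<close> it
  transports the weak equation; with \<open>v\<close> an extension of a boundary datum it transports
  the value of the map. In the end the numbers described under \<open>THE\<close> are the same for
  both metrics.\<close>

lemma frechet_derivative_cong_open:
  assumes "open S" "x \<in> S" "\<And>y. y \<in> S \<Longrightarrow> f y = g y"
  shows "frechet_derivative f (at x) = frechet_derivative g (at x)"
    and "f differentiable (at x) \<longleftrightarrow> g differentiable (at x)"
proof -
  have "(f has_derivative D) (at x) \<longleftrightarrow> (g has_derivative D) (at x)" for D
    using has_derivative_transform_within_open[of f D x UNIV S g]
      has_derivative_transform_within_open[of g D x UNIV S f] assms by auto
  then show "frechet_derivative f (at x) = frechet_derivative g (at x)"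
    "f differentiable (at x) \<longleftrightarrow> g differentiable (at x)"
    by (simp_all add: frechet_derivative_def differentiable_def)
qed

lemma has_frechet_derivative:
  "f differentiable (at x) \<Longrightarrow> (f has_derivative frechet_derivative f (at x)) (at x)"
  by (simp add: frechet_derivative_works)

text \<open>\<open>frechet_derivative\<close> at a point sees the values in a whole neighbourhood;
  openness of \<open>S\<close> makes agreement on \<open>S\<close> enough at every order of the
  induction.\<close>

lemma Ck_on_cong:
  assumes "open S" "\<And>x. x \<in> S \<Longrightarrow> f x = g x" "Ck_on k S f"
  shows "Ck_on k S g"
  using assms(2,3)
proof (induction k arbitrary: f g)
  case 0
  then show ?case using continuous_on_cong by (metis Ck_on.simps(1))
next
  case (Suc k)
  have *: "frechet_derivative f (at x) v = frechet_derivative g (at x) v" if "x \<in> S" for x v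
    using frechet_derivative_cong_open(1)[OF assms(1) that, of f g] Suc.prems(1) by simp
  have "Ck_on k S (\<lambda>x. frechet_derivative g (at x) v)" for v
    using Suc.IH[of "\<lambda>x. frechet_derivative f (at x) v"] * Suc.prems(2) by simp
  moreover have "g differentiable (at x)" if "x \<in> S" for x
    using frechet_derivative_cong_open(2)[OF assms(1) that, of f g] Suc.prems that by simp
  ultimately show ?case by simp
qed

lemma Ck_on_subset: "Ck_on k S f \<Longrightarrow> T \<subseteq> S \<Longrightarrow> Ck_on k T f"
  by (induction k arbitrary: f) (auto intro: continuous_on_subset)

text \<open>Derivatives of products and reciprocals still contain the undifferentiated functions, so
  the inductions for them must be able to give up one order. At the lowest order this is continuity
  of differentiable functions.\<close>

lemma Ck_on_Suc_imp: "Ck_on (Suc k) S f \<Longrightarrow> Ck_on k S f"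
proof (induction k arbitrary: f)
  case 0
  then show ?case
    by (auto intro!: continuous_at_imp_continuous_on differentiable_imp_continuous_within)
next
  case (Suc k)
  from Suc.prems have "\<forall>v. Ck_on (Suc k) S (\<lambda>x. frechet_derivative f (at x) v)"
    by (subst (asm) Ck_on.simps(2)) blast
  then have "Ck_on k S (\<lambda>x. frechet_derivative f (at x) v)" for v by (intro Suc.IH) blast
  then show ?case using Suc.prems by simp
qed

lemma Ck_on_local:
  assumes "\<And>x. x \<in> S \<Longrightarrow> \<exists>V. open V \<and> x \<in> V \<and> Ck_on k V f"
  shows "Ck_on k S f"
  using assms
proof (induction k arbitrary: f)
  case 0
  show ?case
    unfolding Ck_on.simps
  proof (rule continuous_at_imp_continuous_on, rule ballI)
    fix x assume "x \<in> S"
    then obtain V where "open V" "x \<in> V" "continuous_on V f" using 0 by auto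
    then show "isCont f x" by (simp add: continuous_on_eq_continuous_at)
  qed
next
  case (Suc k)
  have "Ck_on k S (\<lambda>x. frechet_derivative f (at x) v)" for v
  proof (rule Suc.IH)
    fix x assume "x \<in> S"
    then obtain V where "open V" "x \<in> V" "Ck_on (Suc k) V f" using Suc.prems by blast
    then show "\<exists>V. open V \<and> x \<in> V \<and> Ck_on k V (\<lambda>x. frechet_derivative f (at x) v)" by auto
  qed
  moreover have "f differentiable (at x)" if "x \<in> S" for x
    using Suc.prems[OF that] by auto
  ultimately show ?case by simp
qed

lemma Ck_on_const [simp]: "Ck_on k S (\<lambda>x. b)"
  by (induction k arbitrary: b) auto

lemma Ck_on_add:
  assumes "open S" "Ck_on k S f" "Ck_on k S g"
  shows "Ck_on k S (\<lambda>x. f x + g x)"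
  using assms(2,3)
proof (induction k arbitrary: f g)
  case 0
  then show ?case by (auto intro: continuous_on_add)
next
  case (Suc k)
  have *: "frechet_derivative f (at x) v + frechet_derivative g (at x) v
      = frechet_derivative (\<lambda>x. f x + g x) (at x) v" if "x \<in> S" for x v
    using Suc.prems that
    by (simp add: frechet_derivative_at[OF has_derivative_add[OF has_frechet_derivative
        has_frechet_derivative], symmetric])
  have "Ck_on k S (\<lambda>x. frechet_derivative f (at x) v + frechet_derivative g (at x) v)" for v
    using Suc by simp
  then have "Ck_on k S (\<lambda>x. frechet_derivative (\<lambda>x. f x + g x) (at x) v)" for v
    by (rule Ck_on_cong[OF assms(1), rotated]) (use * in auto)
  then show ?case using Suc.prems by simp
qed

lemma frechet_derivative_mult_real:
  fixes f g :: "'a::real_normed_vector \<Rightarrow> real"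
  assumes "f differentiable (at x)" "g differentiable (at x)"
  shows "frechet_derivative (\<lambda>x. f x * g x) (at x) v =
    f x * frechet_derivative g (at x) v + frechet_derivative f (at x) v * g x"
  using frechet_derivative_at[OF has_derivative_mult[OF assms[THEN has_frechet_derivative]],
      symmetric]
  by simp

lemma Ck_on_mult:
  fixes f g :: "'a::real_normed_vector \<Rightarrow> real"
  assumes "open S" "Ck_on k S f" "Ck_on k S g"
  shows "Ck_on k S (\<lambda>x. f x * g x)"
  using assms(2,3)
proof (induction k arbitrary: f g)
  case 0
  then show ?case by (auto intro: continuous_on_mult)
next
  case (Suc k)
  have "Ck_on k S (\<lambda>x. f x * frechet_derivative g (at x) v + frechet_derivative f (at x) v * g x)"
      for v
    using Suc.prems Suc.prems[THEN Ck_on_Suc_imp] by (intro Ck_on_add[OF assms(1)] Suc.IH) simp_all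
  then have "Ck_on k S (\<lambda>x. frechet_derivative (\<lambda>x. f x * g x) (at x) v)" for v
    by (rule Ck_on_cong[OF assms(1), rotated]) (use Suc.prems in \<open>simp add:
        frechet_derivative_mult_real\<close>)
  then show ?case using Suc.prems by simp
qed

text \<open>The derivative of 1/f is - (1/f) f' (1/f), so the product rule turns order
  \<open>k\<close> of 1/f into order \<open>k\<close> of its derivative. The sign is written as a
  constant factor to fit that rule.\<close>

lemma Ck_on_inverse:
  fixes f :: "'a::real_normed_vector \<Rightarrow> real"
  assumes "open S" "\<And>x. x \<in> S \<Longrightarrow> f x \<noteq> 0" "Ck_on k S f"
  shows "Ck_on k S (\<lambda>x. inverse (f x))"
  using assms(3)
proof (induction k)
  case 0
  then show ?case using assms(2) by (auto intro: continuous_on_inverse)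
next
  case (Suc k)
  have D: "((\<lambda>x. inverse (f x)) has_derivative
      (\<lambda>v. - (inverse (f x) * frechet_derivative f (at x) v * inverse (f x)))) (at x)" if "x \<in> S"
          for x
    using Suc.prems that by (intro Deriv.has_derivative_inverse assms(2) has_frechet_derivative)
        auto
  have *: "Ck_on k S (\<lambda>x. inverse (f x))" using Suc Ck_on_Suc_imp by blast
  have "Ck_on k S (\<lambda>x. (- 1) * (inverse (f x) * frechet_derivative f (at x) v * inverse (f x)))"
    (is "Ck_on k S (?D v)") for v
    using Suc.prems * by (intro Ck_on_mult assms(1) Ck_on_const) auto
  then have "Ck_on k S (\<lambda>x. frechet_derivative (\<lambda>x. inverse (f x)) (at x) v)" for v
    by (rule Ck_on_cong[OF assms(1), where f = "?D v", rotated]) (simp add: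
        frechet_derivative_at[OF D, symmetric])
  then show ?case using differentiableI[OF D] by simp
qed

text \<open>With an affine inner map the derivative in direction \<open>v\<close> is again a
  function of \<open>l x + b\<close>, namely the derivative of \<open>h\<close> in direction
  \<open>l v\<close>. An induction over all \<open>h\<close> therefore closes.\<close>

lemma Ck_on_compose_affine:
  fixes h :: "real \<Rightarrow> real" and l :: "'a::real_normed_vector \<Rightarrow> real"
  assumes "bounded_linear l" "Ck_on k UNIV h"
  shows "Ck_on k UNIV (\<lambda>x. h (l x + b))"
  using assms(2)
proof (induction k arbitrary: h)
  case 0
  have "continuous_on UNIV (\<lambda>x. l x + b)"
    by (rule continuous_on_add[OF linear_continuous_on[OF assms(1)] continuous_on_const])
  then show ?case using continuous_on_compose2[of UNIV h UNIV "\<lambda>x. l x + b"] 0 by simp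
next
  case (Suc k)
  have "(h has_derivative frechet_derivative h (at (l x + b))) (at (l x + b))" for x
    using Suc.prems has_frechet_derivative by auto
  then have D: "((\<lambda>x. h (l x + b)) has_derivative (\<lambda>v. frechet_derivative h (at (l x + b)) (l v)))
      (at x)" for x
    by (rule has_derivative_compose[rotated, where f = "\<lambda>x. l x + b"])
      (rule has_derivative_add_const[OF bounded_linear_imp_has_derivative[OF assms(1)]])
  have "Ck_on k UNIV (\<lambda>x. frechet_derivative h (at (l x + b)) (l v))" for v
    using Suc.prems by (intro Suc.IH) auto
  then have "Ck_on k UNIV (\<lambda>x. frechet_derivative (\<lambda>x. h (l x + b)) (at x) v)" for v
    by (simp add: frechet_derivative_at[OF D, symmetric])
  then show ?case using differentiableI[OF D] by simp
qed

lemma Ck_on_prod: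
  fixes f :: "'i \<Rightarrow> 'a::real_normed_vector \<Rightarrow> real"
  assumes "open S" "\<And>i. i \<in> I \<Longrightarrow> Ck_on k S (f i)"
  shows "Ck_on k S (\<lambda>x. \<Prod>i\<in>I. f i x)"
  using assms(2)
  by (induction I rule: infinite_finite_induct) (auto intro: Ck_on_mult[OF assms(1)] Ck_on_const)

text \<open>The family \<open>p(1/x) exp (- 1/x)\<close>, extended by \<open>0\<close> to \<open>x \<le> 0\<close>, contains the flat function \<open>exp
  (- 1/x)\<close> (for \<open>p = 1\<close>) and is closed under differentiation.\<close>

definition flat_exp :: "real poly \<Rightarrow> real \<Rightarrow> real" where
  "flat_exp p x = (if x \<le> 0 then 0 else poly p (1 / x) * exp (- (1 / x)))"

lemma poly_exp_minus_tendsto_0: "((\<lambda>y. poly p y * exp (- y)) \<longlongrightarrow> (0::real)) at_top"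
proof -
  have "((\<lambda>y. \<Sum>i\<le>degree p. coeff p i * (y ^ i / exp y)) \<longlongrightarrow> (\<Sum>i\<le>degree p. coeff p i * 0)) at_top"
    by (intro tendsto_sum tendsto_mult tendsto_const tendsto_power_div_exp_0)
  then show ?thesis
    by (simp add: poly_altdef sum_distrib_right exp_minus divide_inverse mult.assoc)
qed

text \<open>With y = 1/x, differentiating p(y) exp(-y) in x gives y^2 (p(y) - p'(y)) exp(-y), and
  \<open>[:0, 0, 1:]\<close> is y^2. Only x = 0 needs a limit.\<close>

lemma flat_exp_has_derivative:
  "(flat_exp p has_derivative (\<lambda>v. v * flat_exp ([:0, 0, 1:] * (p - pderiv p)) x)) (at x)"
proof -
  let ?q = "[:0, 0, 1:] * (p - pderiv p)"
  have "(flat_exp p has_real_derivative flat_exp ?q x) (at x)"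
  proof (cases "x = 0")
    case False
    show ?thesis
    proof (cases "x < 0")
      case True
      have "((\<lambda>x. 0) has_real_derivative flat_exp ?q x) (at x)" using True by (simp add:
          flat_exp_def)
      then show ?thesis
        by (rule has_field_derivative_transform_within_open[of _ _ _ "{..<0}"])
          (use True in \<open>auto simp: flat_exp_def\<close>)
    next
      case x: False
      with False have x: "x > 0" by simp
      have "((\<lambda>x. poly p (1 / x) * exp (- (1 / x))) has_real_derivative flat_exp ?q x) (at x)"
        using x by (auto intro!: derivative_eq_intros poly_DERIV[THEN DERIV_chain2]
          simp: flat_exp_def field_simps power2_eq_square)
      then show ?thesis
        by (rule has_field_derivative_transform_within_open[of _ _ _ "{0<..}"])
          (use x in \<open>auto simp: flat_exp_def\<close>)
    qed
  next
    case True
    have "((\<lambda>h. flat_exp p h / h) \<longlongrightarrow> 0) (at 0)"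
      proof (rule filterlim_split_at)
      have "eventually (\<lambda>h. 0 = flat_exp p h / h) (at_left (0::real))"
        by (auto simp: eventually_at_filter flat_exp_def)
      then show "((\<lambda>h. flat_exp p h / h) \<longlongrightarrow> 0) (at_left 0)"
        by (rule Lim_transform_eventually[rotated]) simp
      \<comment> \<open>With y = 1/h, dividing by \<open>h\<close> is multiplying by y, which is the
        polynomial \<open>[:0, 1:]\<close>.\<close>
      have "((\<lambda>h. poly ([:0, 1:] * p) (inverse h) * exp (- (inverse h))) \<longlongrightarrow> 0) (at_right (0::real))"
        by (rule filterlim_compose[OF poly_exp_minus_tendsto_0 filterlim_inverse_at_top_right])
      moreover have "eventually (\<lambda>h. poly ([:0, 1:] * p) (inverse h) * exp (- (inverse h)) =
          flat_exp p h / h)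
          (at_right (0::real))"
        by (auto simp: eventually_at_filter flat_exp_def divide_inverse)
      ultimately show "((\<lambda>h. flat_exp p h / h) \<longlongrightarrow> 0) (at_right 0)"
        by (rule Lim_transform_eventually)
    qed
    then show ?thesis using True by (simp add: has_field_derivative_iff flat_exp_def)
  qed
  then show ?thesis
    unfolding has_field_derivative_def by (rule has_derivative_eq_rhs) (simp add: fun_eq_iff)
qed

lemma Ck_on_flat_exp: "Ck_on k UNIV (flat_exp p)"
proof (induction k arbitrary: p)
  case 0
  then show ?case
    using has_derivative_continuous[OF flat_exp_has_derivative]
    by (simp add: continuous_at_imp_continuous_on)
next
  case (Suc k)
  have "frechet_derivative (flat_exp p) (at x) v = v * flat_exp ([:0, 0, 1:] * (p - pderiv p)) x"
      for x v
    by (simp add: frechet_derivative_at[OF flat_exp_has_derivative, symmetric] del: mult_pCons_left)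
  moreover have "Ck_on k UNIV (\<lambda>x. v * flat_exp q x)" for v q
    using Suc by (intro Ck_on_mult Ck_on_const) auto
  ultimately show ?case
    using differentiableI[OF flat_exp_has_derivative] by simp
qed

text \<open>Each coordinate contributes two flat exponentials that switch on at the two faces of the
  box. The dilation steepens them, so that the bumps approach the indicator of the open box while
  staying below 1; \<open>Suc\<close> excludes the factor 0.\<close>

definition box_bump :: "real^'n \<Rightarrow> real^'n \<Rightarrow> nat \<Rightarrow> real^'n \<Rightarrow> real" where
  "box_bump a b m x =
     (\<Prod>i\<in>UNIV. flat_exp 1 (real (Suc m) * (x $ i - a $ i)) * flat_exp 1 (real (Suc m) * (b $ i - x
         $ i)))"

lemma flat_exp_1_bounds: "0 \<le> flat_exp 1 x" "flat_exp 1 x \<le> 1"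
  by (auto simp: flat_exp_def)

lemma box_bump_bounds: "0 \<le> box_bump a b m x" "box_bump a b m x \<le> 1"
  unfolding box_bump_def
  by (auto intro!: prod_nonneg prod_le_1 mult_nonneg_nonneg mult_le_one flat_exp_1_bounds)

lemma box_bump_nonzero_iff:
  fixes x :: "real^'n::finite"
  shows "box_bump a b m x \<noteq> 0 \<longleftrightarrow> x \<in> box a b"
  by (auto simp: box_bump_def flat_exp_def mem_box_cart zero_less_mult_iff not_le mult_le_0_iff)

text \<open>Inside the box each factor is exp(-1/((m+1)t)) with a fixed t > 0 and tends to 1;
  outside, the bump is 0 for every \<open>m\<close>.\<close>

lemma box_bump_tendsto:
  fixes x :: "real^'n::finite"
  shows "(\<lambda>m. box_bump a b m x) \<longlonglongrightarrow> indicator (box a b) x"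
proof (cases "x \<in> box a b")
  case True
  have *: "(\<lambda>m. flat_exp 1 (real (Suc m) * t)) \<longlonglongrightarrow> 1" if "t > 0" for t
  proof -
    have "(\<lambda>m. exp (- (inverse t * inverse (real (Suc m))))) \<longlonglongrightarrow> exp (- (inverse t * 0))"
      by (intro tendsto_intros LIMSEQ_inverse_real_of_nat)
    moreover have "flat_exp 1 (real (Suc m) * t) = exp (- (inverse t * inverse (real (Suc m))))"
        for m
      using that by (simp add: flat_exp_def divide_inverse mult_le_0_iff)
    ultimately show ?thesis by simp
  qed
  have "(\<lambda>m. box_bump a b m x) \<longlonglongrightarrow> (\<Prod>i\<in>(UNIV::'n set). 1 * 1)"
    unfolding box_bump_def using True
    by (intro tendsto_prod tendsto_mult *) (auto simp: mem_box_cart)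
  then show ?thesis using True by simp
next
  case False
  then show ?thesis using box_bump_nonzero_iff[of a b _ x] by simp
qed

lemma box_bump_test_function:
  fixes a b :: "real^'n::finite"
  assumes "cbox a b \<subseteq> V"
  shows "box_bump a b m \<in> test_functions V"
proof -
  have l: "bounded_linear (\<lambda>x::real^'n. real (Suc m) * x $ i)"
    "bounded_linear (\<lambda>x::real^'n. - (real (Suc m) * x $ i))" for i
    by (intro bounded_linear_minus bounded_linear_const_mult bounded_linear_vec_nth)+
  have "Ck_on k UNIV (box_bump a b m)" for k
    unfolding box_bump_def
    using Ck_on_compose_affine[OF l(1) Ck_on_flat_exp, of k "1" _ "- (real (Suc m) * a $ _)"]
      Ck_on_compose_affine[OF l(2) Ck_on_flat_exp, of k "1" _ "real (Suc m) * b $ _"]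
    by (intro Ck_on_prod Ck_on_mult) (auto simp: right_diff_distrib)
  moreover have "closure {x. box_bump a b m x \<noteq> 0} \<subseteq> cbox a b"
    unfolding box_bump_nonzero_iff
    by (rule closure_minimal) (auto simp: box_subset_cbox[THEN subsetD])
  moreover from this have "compact (closure {x. box_bump a b m x \<noteq> 0})"
    by (metis bounded_cbox bounded_subset closed_closure compact_eq_bounded_closed)
  ultimately show ?thesis using assms by (auto simp: test_functions_def smooth_on_def)
qed

section \<open>Weak gradients\<close>

lemma test_functionsD:
  fixes \<eta> :: "'a::real_normed_vector \<Rightarrow> real"
  assumes "\<eta> \<in> test_functions V"
  shows "\<eta> differentiable (at x)" "continuous_on S \<eta>"
    "continuous_on S (\<lambda>x. frechet_derivative \<eta> (at x) v)"
proof -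
  have C: "Ck_on k UNIV \<eta>" for k using assms by (auto simp: test_functions_def smooth_on_def)
  show "\<eta> differentiable (at x)" "continuous_on S \<eta>"
    "continuous_on S (\<lambda>x. frechet_derivative \<eta> (at x) v)"
    using C[of 0] C[of 1] by (auto intro: continuous_on_subset)
qed

lemma test_functionE:
  fixes \<eta> :: "'a::real_normed_vector \<Rightarrow> real"
  assumes "\<eta> \<in> test_functions V"
  obtains K where "compact K" "K \<subseteq> V" "{x. \<eta> x \<noteq> 0} \<subseteq> K" "\<And>x. x \<notin> K \<Longrightarrow> \<eta> x = 0"
    "\<And>x v. x \<notin> K \<Longrightarrow> frechet_derivative \<eta> (at x) v = 0"
proof -
  define K where "K = closure {x. \<eta> x \<noteq> 0}"
  have K: "compact K" "K \<subseteq> V" "{x. \<eta> x \<noteq> 0} \<subseteq> K"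
    using assms closure_subset[of "{x. \<eta> x \<noteq> 0}"] by (auto simp: test_functions_def K_def)
  then have z: "\<eta> x = 0" if "x \<notin> K" for x using that by auto
  have "frechet_derivative \<eta> (at x) v = 0" if "x \<notin> K" for x v
    using frechet_derivative_cong_open(1)[of "- K" x \<eta> "\<lambda>_. 0"] that z K(1)
    by (simp add: compact_imp_closed open_Compl)
  then show ?thesis using that K z by blast
qed

lemma test_functionI:
  fixes \<eta> :: "'a::real_normed_vector \<Rightarrow> real"
  assumes "\<And>k. Ck_on k UNIV \<eta>" "compact K" "K \<subseteq> V" "{x. \<eta> x \<noteq> 0} \<subseteq> K"
  shows "\<eta> \<in> test_functions V"
proof -
  have "closure {x. \<eta> x \<noteq> 0} \<subseteq> K"
    using assms(2,4) by (simp add: closure_minimal compact_imp_closed)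
  moreover from this have "compact (closure {x. \<eta> x \<noteq> 0})"
    using assms(2) by (metis closed_closure compact_Int_closed inf.absorb_iff2)
  ultimately show ?thesis using assms(1,3) by (auto simp: test_functions_def smooth_on_def)
qed

text \<open>\<open>q\<close> is controlled only on \<open>V\<close>, so the product is set to 0
  elsewhere. The open sets \<open>V\<close> and the complement of the compact set carrying
  \<open>\<eta>\<close> cover the space, and the product is smooth on each.\<close>

lemma test_function_mult:
  fixes q \<eta> :: "'a::real_normed_vector \<Rightarrow> real"
  assumes "open V" "smooth_on V q" "\<eta> \<in> test_functions V"
  shows "(\<lambda>x. if x \<in> V then q x * \<eta> x else 0) \<in> test_functions V" (is "?\<theta> \<in> _")
proof -
  obtain K where K: "compact K" "K \<subseteq> V" "\<And>x. x \<notin> K \<Longrightarrow> \<eta> x = 0"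
    using test_functionE[OF assms(3)] by metis
  have "Ck_on k UNIV ?\<theta>" for k
  proof (rule Ck_on_local)
    fix x :: 'a
    have "Ck_on k V \<eta>"
      using assms(3) by (auto simp: smooth_on_def test_functions_def intro: Ck_on_subset)
    moreover have "Ck_on k V q" using assms(2) by (simp add: smooth_on_def)
    ultimately have "Ck_on k V (\<lambda>x. q x * \<eta> x)" by (intro Ck_on_mult assms(1))
    then have "Ck_on k V ?\<theta>"
      by (rule Ck_on_cong[OF assms(1), rotated]) simp
    moreover have o: "open (- K)" using K(1) by (simp add: compact_imp_closed open_Compl)
    moreover have "Ck_on k (- K) ?\<theta>"
      by (rule Ck_on_cong[OF o, of "\<lambda>x. 0"]) (use K(3) in auto)
    ultimately show "\<exists>W. open W \<and> x \<in> W \<and> Ck_on k W ?\<theta>"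
      using assms(1) K(2) by (cases "x \<in> V") auto
  qed
  then show ?thesis
    by (rule test_functionI[OF _ K(1,2)]) (use K(3) in auto)
qed

section \<open>Integrability of products on compact sets\<close>

lemma set_integrable_bounded_mult:
  fixes f h :: "'a \<Rightarrow> real"
  assumes f: "set_integrable M S f" and h: "set_borel_measurable M S h"
    and B: "AE x\<in>S in M. \<bar>h x\<bar> \<le> B"
  shows "set_integrable M S (\<lambda>x. h x * f x)"
proof (rule set_integrable_bound)
  show "set_integrable M S (\<lambda>x. B * f x)" using f by simp
  have "(\<lambda>x. (indicat_real S x *\<^sub>R h x) * (indicat_real S x *\<^sub>R f x)) \<in> borel_measurable M"
    using f h by (intro borel_measurable_times)
      (auto simp: set_integrable_def set_borel_measurable_def)
  then show "set_borel_measurable M S (\<lambda>x. h x * f x)"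
    unfolding set_borel_measurable_def by (rule measurable_cong[THEN iffD1, rotated]) (simp add:
        indicator_def)
  show "AE x\<in>S in M. norm (h x * f x) \<le> norm (B * f x)"
    using B by eventually_elim (auto simp: abs_mult intro!: mult_right_mono)
qed

lemma set_borel_measurable_lebesgue_continuous:
  fixes h :: "'a::euclidean_space \<Rightarrow> 'b::euclidean_space"
  assumes "S \<in> sets borel" "continuous_on S h"
  shows "set_borel_measurable lebesgue S h"
  using set_measurable_continuous_on[OF assms]
  unfolding set_borel_measurable_def by (intro measurable_completion) simp

lemma set_integrable_mult_continuous:
  fixes f h :: "'a::euclidean_space \<Rightarrow> real"
  assumes "compact K" "set_integrable lebesgue K f" "continuous_on K h"
  shows "set_integrable lebesgue K (\<lambda>x. h x * f x)"
proof -
  obtain B where "\<And>x. x \<in> K \<Longrightarrow> \<bar>h x\<bar> \<le> B"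
    using compact_imp_bounded[OF compact_continuous_image[OF assms(3,1)]]
    by (auto simp: bounded_iff)
  then show ?thesis
    by (intro set_integrable_bounded_mult assms set_borel_measurable_lebesgue_continuous AE_I2)
      (use assms borel_compact in auto)
qed

lemma set_integrable_mult_supported:
  fixes f h :: "'a::euclidean_space \<Rightarrow> real"
  assumes "compact K" "K \<subseteq> V" "set_integrable lebesgue K f" "continuous_on K h"
    and "\<And>x. x \<in> V \<Longrightarrow> x \<notin> K \<Longrightarrow> h x = 0"
  shows "set_integrable lebesgue V (\<lambda>x. h x * f x)"
proof -
  have "indicator V x *\<^sub>R (h x * f x) = indicator K x *\<^sub>R (h x * f x)" for x
    using subsetD[OF assms(2), of x] assms(5)[of x] by (auto simp: indicator_def)
  then show ?thesis
    using set_integrable_mult_continuous[OF assms(1,3,4)] unfolding set_integrable_def by (simp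
        only:)
qed

text \<open>The difference quotients of \<open>F\<close> integrate to \<open>0\<close> by translation invariance and converge
  dominatedly to the derivative.\<close>

lemma integral_frechet_derivative_compact_support:
  fixes F :: "'a::euclidean_space \<Rightarrow> real"
  assumes F: "F \<in> test_functions UNIV"
  shows "(LINT x|lebesgue. frechet_derivative F (at x) v) = 0"
proof -
  let ?D = "\<lambda>x. frechet_derivative F (at x) v"
  define t where "t k = inverse (real (Suc k))" for k
  have t: "0 < t k" "t k \<le> 1" for k by (simp_all add: t_def inverse_le_1_iff)
  have t0: "t \<longlonglongrightarrow> 0" unfolding t_def by (rule LIMSEQ_inverse_real_of_nat)
  note cont = test_functionsD(2,3)[OF F, of UNIV]
  obtain K where K: "compact K" and zero: "\<And>x. x \<notin> K \<Longrightarrow> F x = 0" "\<And>x v. x \<notin> K \<Longrightarrow> frechet_derivative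
      F (at x) v = 0"
    using test_functionE[OF F] by metis
  have D: "(F has_derivative frechet_derivative F (at x)) (at x)" for x
    by (intro has_frechet_derivative test_functionsD(1)[OF F])
  have line: "((\<lambda>s. F (x + s *\<^sub>R v)) has_real_derivative ?D (x + s *\<^sub>R v)) (at s)" for x s
  proof -
    have "((\<lambda>s. F (x + s *\<^sub>R v)) has_derivative
        (\<lambda>h. frechet_derivative F (at (x + s *\<^sub>R v)) (h *\<^sub>R v))) (at s)"
      by (rule has_derivative_compose[OF _ D]) (auto intro!: derivative_eq_intros)
    moreover have "frechet_derivative F (at (x + s *\<^sub>R v)) (h *\<^sub>R v) = ?D (x + s *\<^sub>R v) * h" for h
      using linear_cmul[OF linear_frechet_derivative[OF test_functionsD(1)[OF F]]] by simp
    ultimately show ?thesis by (simp add: has_field_derivative_def)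
  qed
  have "bounded (?D ` K)"
    by (intro compact_imp_bounded compact_continuous_image test_functionsD(3)[OF F] K)
  then obtain B0 where B0: "\<And>x. x \<in> K \<Longrightarrow> \<bar>?D x\<bar> \<le> B0"
    by (auto simp: bounded_iff)
  \<comment> \<open>\<open>K\<close> may be empty, and then \<open>B0\<close> need not be
    nonnegative.\<close>
  define B where "B = max B0 0"
  have B: "\<bar>?D x\<bar> \<le> B" for x
    using B0[of x] zero(2)[of x v] by (cases "x \<in> K") (auto simp: B_def)
  obtain R where R: "\<And>x. x \<in> K \<Longrightarrow> norm x \<le> R"
    using compact_imp_bounded[OF K] by (auto simp: bounded_iff)
  define d where "d k x = (F (x + t k *\<^sub>R v) - F x) / t k" for k x
  have "indicator K x *\<^sub>R F x = F x" for x using zero(1)[of x] by (auto simp: indicator_def)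
  then have int: "integrable lborel F"
    using borel_integrable_compact[OF K test_functionsD(2)[OF F]] by (simp only:)
  have trans: "integral\<^sup>L lborel (\<lambda>x. F (x + w)) = integral\<^sup>L lborel F"
    "integrable lborel (\<lambda>x. F (x + w))" for w
  proof -
    have m: "(\<lambda>x. w + x) \<in> borel_measurable lborel" "F \<in> borel_measurable borel"
      using cont(1) by (auto intro: borel_measurable_continuous_onI)
    have "integral\<^sup>L lborel F = integral\<^sup>L (distr lborel borel ((+) w)) F"
      by (simp add: lborel_distr_plus)
    also have "\<dots> = integral\<^sup>L lborel (\<lambda>x. F (w + x))"
      using m by (intro integral_distr) auto
    finally show "integral\<^sup>L lborel (\<lambda>x. F (x + w)) = integral\<^sup>L lborel F" by (simp add:
        add.commute)
    have "integrable (distr lborel borel ((+) w)) F" using int by (simp add: lborel_distr_plus)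
    then have "integrable lborel (\<lambda>x. F (w + x))"
      using m by (subst (asm) integrable_distr_eq) auto
    then show "integrable lborel (\<lambda>x. F (x + w))" by (simp add: add.commute)
  qed
  have d0: "integral\<^sup>L lborel (d k) = 0" for k
    unfolding d_def using trans[of "t k *\<^sub>R v"] int by simp
  have "(\<lambda>k. integral\<^sup>L lborel (d k)) \<longlonglongrightarrow> integral\<^sup>L lborel ?D"
  proof (rule integral_dominated_convergence)
    show "?D \<in> borel_measurable lborel"
      using cont(2) by (auto intro: borel_measurable_continuous_onI)
    show "d k \<in> borel_measurable lborel" for k
      unfolding d_def using trans[of "t k *\<^sub>R v"] int by (intro borel_measurable_divide
          borel_measurable_diff) auto
    \<comment> \<open>Step lengths are at most 1, so every difference quotient vanishes outside the
      ball of radius \<open>R + norm v\<close>; inside, the mean value theorem bounds it by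
      \<open>B\<close>.\<close>
    show "integrable lborel (\<lambda>x. indicator (cball 0 (R + norm v)) x *\<^sub>R B)"
      by (rule borel_integrable_compact) auto
    show "AE x in lborel. (\<lambda>k. d k x) \<longlonglongrightarrow> ?D x"
    proof (rule AE_I2)
      fix x
      have "((\<lambda>h. (F (x + h *\<^sub>R v) - F x) / h) \<longlongrightarrow> ?D x) (at 0)"
        using line[of x 0] by (simp add: has_field_derivative_iff)
      then show "(\<lambda>k. d k x) \<longlonglongrightarrow> ?D x"
        unfolding d_def
        by (rule filterlim_compose) (use t0 t(1) in \<open>auto simp: filterlim_at intro!:
            always_eventually less_imp_neq[THEN not_sym]\<close>)
    qed
    show "AE x in lborel. norm (d k x) \<le> indicator (cball 0 (R + norm v)) x *\<^sub>R B" for k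
    proof (rule AE_I2)
      fix x
      show "norm (d k x) \<le> indicator (cball 0 (R + norm v)) x *\<^sub>R B"
      proof (cases "norm x \<le> R + norm v")
        case True
        obtain z where z: "F (x + t k *\<^sub>R v) - F (x + 0 *\<^sub>R v) = (t k - 0) * ?D (x + z *\<^sub>R v)"
          using MVT2[OF t(1) line] by blast
        have "d k x = ?D (x + z *\<^sub>R v)" using z t(1)[of k] by (simp add: d_def)
        then show ?thesis using True B by simp
      next
        case False
        have "norm (t k *\<^sub>R v) \<le> norm v" using t[of k] by (simp add: mult_left_le_one_le)
        then have "\<not> norm (x + t k *\<^sub>R v) \<le> R"
          using False norm_diff_ineq[of x "t k *\<^sub>R v"] by linarith
        moreover have "\<not> norm x \<le> R" using False norm_ge_zero[of v] by linarith
        ultimately have "F (x + t k *\<^sub>R v) = 0" "F x = 0" using R zero(1) by blast+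
        then show ?thesis using False by (simp add: d_def)
      qed
    qed
  qed
  then have "integral\<^sup>L lborel ?D = 0" by (simp only: d0 LIMSEQ_const_iff)
  then show ?thesis
    using cont(2) by (subst integral_completion) (auto intro: borel_measurable_continuous_onI)
qed

section \<open>Weak gradients of constants and products\<close>

definition grad :: "(real^'n \<Rightarrow> real) \<Rightarrow> real^'n \<Rightarrow> real^'n" where
  "grad f x = (\<chi> i. frechet_derivative f (at x) (axis i 1))"

text \<open>For the constant 1 the defining identity says that derivatives of test functions
  integrate to 0. The constant is the seed for all smooth functions: written as \<open>q\<close>
  times 1, they get their weak gradients from the product rule.\<close>

lemma weak_gradient_one:
  fixes V :: "(real^'n::finite) set"
  assumes "open V"
  shows "weak_gradient V (\<lambda>x. 1) (\<lambda>x. 0)"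
  unfolding weak_gradient_def
proof (intro conjI ballI allI impI)
  fix K :: "(real^'n) set" assume K: "compact K \<and> K \<subseteq> V"
  have "integrable lborel (\<lambda>x. indicator K x *\<^sub>R (1::real))"
    by (rule borel_integrable_compact) (use K in auto)
  then show "set_integrable lebesgue K (\<lambda>x. 1::real)"
    unfolding set_integrable_def by (rule integrable_completion[THEN iffD2, rotated]) (use K
        borel_compact borel_measurable_indicator in auto)
  show "set_integrable lebesgue K (\<lambda>x. 0 :: real^'n)" by (simp add: set_integrable_def)
next
  fix \<eta> :: "real^'n \<Rightarrow> real" and i :: 'n
  assume \<eta>: "\<eta> \<in> test_functions V"
  then have "\<eta> \<in> test_functions UNIV" by (simp add: test_functions_def)
  note 0 = integral_frechet_derivative_compact_support[OF this, of "axis i 1"]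
  obtain K where K: "K \<subseteq> V" "\<And>x v. x \<notin> K \<Longrightarrow> frechet_derivative \<eta> (at x) v = 0"
    using test_functionE[OF \<eta>] by metis
  have "indicator V x *\<^sub>R (1 * frechet_derivative \<eta> (at x) (axis i 1)) = frechet_derivative \<eta> (at
      x) (axis i 1)" for x
    using K by (auto simp: indicator_def)
  then have "(LINT x:V|lebesgue. 1 * frechet_derivative \<eta> (at x) (axis i 1)) = 0"
    unfolding set_lebesgue_integral_def using 0 by (simp only:)
  then show "(LINT x:V|lebesgue. 1 * frechet_derivative \<eta> (at x) (axis i 1)) = - (LINT
      x:V|lebesgue. 0 $ i * \<eta> x)"
    by (simp add: set_lebesgue_integral_def)
qed

text \<open>The conclusion equates predicates on gradients, so that \<open>SOME\<close> in
  \<open>wgrad\<close> picks the very same field for both functions.\<close>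

lemma weak_gradient_cong:
  assumes "\<And>x. x \<in> V \<Longrightarrow> f x = f' x"
  shows "weak_gradient V f = weak_gradient V f'"
proof -
  have 1: "set_integrable lebesgue K f = set_integrable lebesgue K f'" if "K \<subseteq> V" for K
    using that assms by (intro set_integrable_cong) auto
  have 2: "(LINT x:V|lebesgue. f x * h x) = (LINT x:V|lebesgue. f' x * h x)" for h
    using assms unfolding set_lebesgue_integral_def
    by (intro Bochner_Integration.integral_cong) (auto simp: indicator_def)
  show ?thesis unfolding weak_gradient_def fun_eq_iff by (simp add: 1 2 cong: conj_cong)
qed

lemma smooth_on_grad_continuous:
  fixes q :: "real^'n::finite \<Rightarrow> real"
  assumes "smooth_on V q" "S \<subseteq> V"
  shows "continuous_on S q" "continuous_on S (grad q)"
    "continuous_on S (\<lambda>x. frechet_derivative q (at x) v)"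
    "x \<in> V \<Longrightarrow> q differentiable (at x)"
proof -
  have "Ck_on 0 V q" "Ck_on 1 V q" using assms(1) unfolding smooth_on_def by blast+
  then show "continuous_on S q" "continuous_on S (grad q)"
    "continuous_on S (\<lambda>x. frechet_derivative q (at x) v)"
    "x \<in> V \<Longrightarrow> q differentiable (at x)"
    using assms(2) by (auto simp: grad_def intro!: continuous_on_vec_lambda intro:
        continuous_on_subset)
qed

lemma set_integrable_vec_iff:
  fixes G :: "'a \<Rightarrow> real^'n::finite"
  shows "set_integrable M S G \<longleftrightarrow> (\<forall>i. set_integrable M S (\<lambda>x. G x $ i))"
proof
  assume "set_integrable M S G"
  then show "\<forall>i. set_integrable M S (\<lambda>x. G x $ i)"
    using integrable_bounded_linear[OF bounded_linear_vec_nth, of M "\<lambda>x. indicat_real S x *\<^sub>R G x"]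
    by (simp add: set_integrable_def)
next
  assume *: "\<forall>i. set_integrable M S (\<lambda>x. G x $ i)"
  have "integrable M (\<lambda>x. \<Sum>i\<in>UNIV. (indicat_real S x *\<^sub>R G x $ i) *\<^sub>R (axis i 1 :: real^'n))"
    using * by (intro Bochner_Integration.integrable_sum integrable_scaleR_left)
      (simp add: set_integrable_def)
  moreover have "(\<Sum>i\<in>UNIV. (indicat_real S x *\<^sub>R G x $ i) *\<^sub>R (axis i 1 :: real^'n)) =
      indicat_real S x *\<^sub>R G x" for x
    using basis_expansion[of "indicat_real S x *\<^sub>R G x"] by (simp add: scalar_mult_eq_scaleR)
  ultimately show "set_integrable M S G" by (simp add: set_integrable_def)
qed

text \<open>The product of \<open>q\<close> and a test function is again a test function. Testing
  \<open>f\<close> against it and expanding its derivative leaves a term with the derivative of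
  \<open>q\<close>, which moves to the other side and becomes part of the new gradient.\<close>

lemma weak_gradient_mult:
  fixes f q :: "real^'n::finite \<Rightarrow> real"
  assumes V: "open V" and q: "smooth_on V q" and f: "weak_gradient V f G"
  shows "weak_gradient V (\<lambda>x. q x * f x) (\<lambda>x. q x *\<^sub>R G x + f x *\<^sub>R grad q x)"
  unfolding weak_gradient_def
proof (intro conjI ballI allI impI)
  have fK: "set_integrable lebesgue K f" and GK: "set_integrable lebesgue K (\<lambda>x. G x $ i)"
    if "compact K" "K \<subseteq> V" for K i
  proof -
    have *: "\<forall>K. compact K \<and> K \<subseteq> V \<longrightarrow> set_integrable lebesgue K f \<and> set_integrable lebesgue K G"
      using f by (simp add: weak_gradient_def)
    with that show "set_integrable lebesgue K f" by simp
    have "set_integrable lebesgue K G" using * that by simp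
    then show "set_integrable lebesgue K (\<lambda>x. G x $ i)" by (simp add: set_integrable_vec_iff)
  qed
  note cont = smooth_on_grad_continuous[OF q]
  {
    fix K assume K: "compact K \<and> K \<subseteq> V"
    then show "set_integrable lebesgue K (\<lambda>x. q x * f x)"
      by (intro set_integrable_mult_continuous fK cont) auto
    have "set_integrable lebesgue K (\<lambda>x. frechet_derivative q (at x) (axis i 1) * f x)" for i
      using K by (intro set_integrable_mult_continuous fK cont) auto
    moreover have "set_integrable lebesgue K (\<lambda>x. q x * G x $ i)" for i
      using K by (intro set_integrable_mult_continuous GK cont) auto
    ultimately show "set_integrable lebesgue K (\<lambda>x. q x *\<^sub>R G x + f x *\<^sub>R grad q x)"
      unfolding set_integrable_vec_iff by (auto intro!: set_integral_add simp: grad_def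
          mult.commute[of "f _"])
  next
    fix \<eta> :: "real^'n \<Rightarrow> real" and i :: 'n
    assume \<eta>: "\<eta> \<in> test_functions V"
    let ?e = "axis i (1::real)"
    define \<theta> where "\<theta> = (\<lambda>x. if x \<in> V then q x * \<eta> x else 0)"
    have \<theta>: "\<theta> \<in> test_functions V" unfolding \<theta>_def by (rule test_function_mult[OF V q \<eta>])
    have D\<theta>: "frechet_derivative \<theta> (at x) ?e = q x * frechet_derivative \<eta> (at x) ?e
        + frechet_derivative q (at x) ?e * \<eta> x" if "x \<in> V" for x
    proof -
      have "frechet_derivative \<theta> (at x) ?e = frechet_derivative (\<lambda>x. q x * \<eta> x) (at x) ?e"
        using frechet_derivative_cong_open(1)[OF V that, of \<theta> "\<lambda>x. q x * \<eta> x"] by (simp add: \<theta>_def)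
      then show ?thesis
        using frechet_derivative_mult_real[OF cont(4)[OF order_refl that] test_functionsD(1)[OF
            \<eta>]] by simp
    qed
    obtain K where K: "compact K" "K \<subseteq> V"
      and zero: "\<And>x. x \<notin> K \<Longrightarrow> \<eta> x = 0" "\<And>x v. x \<notin> K \<Longrightarrow> frechet_derivative \<eta> (at x) v = 0"
      using test_functionE[OF \<eta>] by metis
    \<comment> \<open>Each summand is integrable by itself because a factor is supported in
      \<open>K\<close>; this licenses splitting the integrals of sums below.\<close>
    have I1: "set_integrable lebesgue V (\<lambda>x. (q x * frechet_derivative \<eta> (at x) ?e) * f x)"
      and I2: "set_integrable lebesgue V (\<lambda>x. (frechet_derivative q (at x) ?e * \<eta> x) * f x)"
      and I3: "set_integrable lebesgue V (\<lambda>x. (q x * \<eta> x) * G x $ i)"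
      by (rule set_integrable_mult_supported[OF K] fK GK K continuous_on_mult cont(1,3)
          test_functionsD(2,3)[OF \<eta>] | simp add: zero)+
    have "(LINT x:V|lebesgue. f x * frechet_derivative \<theta> (at x) ?e) = - (LINT x:V|lebesgue. G x $
        i * \<theta> x)"
      using f \<theta> by (simp add: weak_gradient_def)
    moreover have "(LINT x:V|lebesgue. f x * frechet_derivative \<theta> (at x) ?e) =
        (LINT x:V|lebesgue. (q x * frechet_derivative \<eta> (at x) ?e) * f x + (frechet_derivative q
            (at x) ?e * \<eta> x) * f x)"
      unfolding set_lebesgue_integral_def
      by (intro Bochner_Integration.integral_cong) (auto simp: D\<theta> indicator_def algebra_simps)
    moreover have "(LINT x:V|lebesgue. G x $ i * \<theta> x) = (LINT x:V|lebesgue. (q x * \<eta> x) * G x $ i)"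
      unfolding set_lebesgue_integral_def
      by (intro Bochner_Integration.integral_cong) (auto simp: \<theta>_def indicator_def)
    moreover have "(LINT x:V|lebesgue. q x * f x * frechet_derivative \<eta> (at x) ?e) =
        (LINT x:V|lebesgue. (q x * frechet_derivative \<eta> (at x) ?e) * f x)"
      by (simp add: mult_ac)
    moreover have "(LINT x:V|lebesgue. (q x *\<^sub>R G x + f x *\<^sub>R grad q x) $ i * \<eta> x) =
        (LINT x:V|lebesgue. (q x * \<eta> x) * G x $ i + (frechet_derivative q (at x) ?e * \<eta> x) * f x)"
      by (simp add: grad_def algebra_simps)
    ultimately show "(LINT x:V|lebesgue. q x * f x * frechet_derivative \<eta> (at x) ?e) =
        - (LINT x:V|lebesgue. (q x *\<^sub>R G x + f x *\<^sub>R grad q x) $ i * \<eta> x)"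
      using I1 I2 I3 by (simp add: set_integral_add)
  }
qed


text \<open>Open boxes form an intersection-stable generator of the Borel sets, so vanishing
  integrals spread to all Borel sets by a Dynkin argument. Its complement step uses the integral
  over the whole space, hence the last assumption.\<close>

lemma AE_zero_if_box_integrals_zero:
  fixes F :: "'a::euclidean_space \<Rightarrow> real"
  assumes F: "integrable lebesgue F"
    and box0: "\<And>a b. (LINT x:box a b|lebesgue. F x) = 0" and "integral\<^sup>L lebesgue F = 0"
  shows "AE x in lebesgue. F x = 0"
proof -
  \<comment> \<open>The Dynkin argument runs over Borel sets and \<open>lborel\<close>, so
    \<open>F\<close> is replaced by a Borel representative.\<close>
  obtain F' where F': "F' \<in> borel_measurable lborel" "AE x in lborel. F x = F' x"
    using completion_ex_borel_measurable_real[of F lborel] F by auto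
  have AE: "AE x in lebesgue. F x = F' x" using F'(2) by (rule AE_completion)
  have "integrable lebesgue F'"
    by (rule integrable_cong_AE[THEN iffD1, OF _ _ AE F])
      (rule borel_measurable_integrable[OF F], rule measurable_completion[OF F'(1)])
  then have intF': "integrable lborel F'" by (simp only: integrable_completion[OF F'(1)])
  have eq: "(LINT x:S|lborel. F' x) = (LINT x:S|lebesgue. F x)" if "S \<in> sets borel" for S
  proof -
    have m: "(\<lambda>x. indicator S x *\<^sub>R F' x) \<in> borel_measurable lborel"
      using that F'(1) by (intro borel_measurable_scaleR borel_measurable_indicator) auto
    then have "(LINT x:S|lborel. F' x) = (LINT x:S|lebesgue. F' x)"
      unfolding set_lebesgue_integral_def by (rule integral_completion[symmetric])
    also have "\<dots> = (LINT x:S|lebesgue. F x)"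
      unfolding set_lebesgue_integral_def
    proof (rule integral_cong_AE)
      show "(\<lambda>x. indicat_real S x *\<^sub>R F' x) \<in> borel_measurable lebesgue"
        using m by (rule measurable_completion)
      show "(\<lambda>x. indicat_real S x *\<^sub>R F x) \<in> borel_measurable lebesgue"
        using F that by (intro borel_measurable_scaleR borel_measurable_indicator) auto
      show "AE x in lebesgue. indicat_real S x *\<^sub>R F' x = indicat_real S x *\<^sub>R F x"
        using AE by eventually_elim simp
    qed
    finally show ?thesis .
  qed
  have UNIV0: "integral\<^sup>L lborel F' = 0"
    using eq[of UNIV] assms(3) by (simp add: set_lebesgue_integral_def)
  have I: "set_integrable lborel S F'" if "S \<in> sets borel" for S
    unfolding set_integrable_def using intF' that by (intro integrable_mult_indicator) auto
  have "(LINT x:S|lborel. F' x) = 0" if "S \<in> sets borel" for S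
  proof -
    have "Int_stable (range (\<lambda>(a, b). box a b :: 'a set))"
      by (auto simp: Int_stable_def box_Int_box)
    moreover have "range (\<lambda>(a, b). box a b :: 'a set) \<subseteq> Pow UNIV" by simp
    moreover have borel: "sets borel = sigma_sets UNIV (range (\<lambda>(a, b). box a b :: 'a set))"
      by (simp add: borel_eq_box)
    then have "S \<in> sigma_sets UNIV (range (\<lambda>(a, b). box a b :: 'a set))" using that by simp
    ultimately show ?thesis
    proof (induction rule: sigma_sets_induct_disjoint)
      case (basic S)
      then show ?case using eq box0 by auto
    next
      case empty
      show ?case by (simp add: set_lebesgue_integral_def)
    next
      case (compl S)
      then have S: "S \<in> sets borel" by (simp add: borel)
      have "(LINT x:S \<union> (UNIV - S)|lborel. F' x) = (LINT x:S|lborel. F' x) + (LINT x:UNIV -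
          S|lborel. F' x)"
        using S by (intro set_integral_Un I) auto
      then show ?case using compl UNIV0 by (simp add: set_lebesgue_integral_def)
    next
      case (union S)
      then have S: "S i \<in> sets borel" for i using borel by auto
      have "(LINT x:\<Union>(range S)|lborel. F' x) = (\<Sum>i. LINT x:S i|lborel. F' x)"
        using union(1) S by (intro lebesgue_integral_countable_add I) (auto simp:
            disjoint_family_on_def)
      then show ?case using union by simp
    qed
  qed
  then have "AE x in lborel. F' x = 0"
    by (intro sigma_finite_measure.density_zero sigma_finite_lborel intF') simp
  then have "AE x in lebesgue. F' x = 0" by (rule AE_completion)
  with AE show ?thesis by eventually_elim simp
qed

text \<open>The fundamental lemma of the calculus of variations. Bumps tend to the indicator of a
  box, dominated by \<open>f\<close> on the closed box, so integrals over boxes in \<open>V\<close>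
  vanish. As \<open>f\<close> is only locally integrable, the criterion for boxes is applied to
  \<open>f\<close> cut off to one box at a time; countably many closed boxes fill
  \<open>V\<close>.\<close>

lemma AE_zero_if_test_integrals_zero:
  fixes f :: "real^'n::finite \<Rightarrow> real"
  assumes V: "open V" and fK: "\<And>K. compact K \<Longrightarrow> K \<subseteq> V \<Longrightarrow> set_integrable lebesgue K f"
    and z: "\<And>\<eta>. \<eta> \<in> test_functions V \<Longrightarrow> (LINT x:V|lebesgue. f x * \<eta> x) = 0"
  shows "AE x in lebesgue. x \<in> V \<longrightarrow> f x = 0"
proof -
  have box0: "(LINT x:box a b|lebesgue. f x) = 0" if ab: "cbox a b \<subseteq> V" for a b
  proof -
    have eq: "indicat_real V x *\<^sub>R (f x * box_bump a b m x) =
        box_bump a b m x * (indicat_real (cbox a b) x *\<^sub>R f x)" for m x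
      using box_bump_nonzero_iff[of a b m x] ab box_subset_cbox[of a b] by (auto simp:
          indicator_def)
    have i: "integrable lebesgue (\<lambda>x. indicat_real (cbox a b) x *\<^sub>R f x)"
      using fK[OF compact_cbox ab] by (simp add: set_integrable_def)
    have "(\<lambda>m. LINT x|lebesgue. indicat_real V x *\<^sub>R (f x * box_bump a b m x)) \<longlonglongrightarrow>
        (LINT x|lebesgue. indicat_real (box a b) x *\<^sub>R f x)"
    proof (rule integral_dominated_convergence)
      show "integrable lebesgue (\<lambda>x. norm (indicat_real (cbox a b) x *\<^sub>R f x))"
        using i by (rule integrable_norm)
      show "(\<lambda>x. indicat_real V x *\<^sub>R (f x * box_bump a b m x)) \<in> borel_measurable lebesgue" for m
        unfolding eq
      proof (rule borel_measurable_times)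
        show "box_bump a b m \<in> borel_measurable lebesgue"
          using test_functionsD(2)[OF box_bump_test_function[OF ab], of UNIV m]
          by (intro measurable_completion) (simp add: borel_measurable_continuous_onI)
        show "(\<lambda>x. indicat_real (cbox a b) x *\<^sub>R f x) \<in> borel_measurable lebesgue"
          using i by auto
      qed
      have "indicat_real (box a b) x *\<^sub>R f x = indicat_real (box a b) x * (indicat_real (cbox a b)
          x *\<^sub>R f x)" for x
        using box_subset_cbox[of a b] by (auto simp: indicator_def)
      then show "(\<lambda>x. indicat_real (box a b) x *\<^sub>R f x) \<in> borel_measurable lebesgue"
        using i by (simp only:) (intro borel_measurable_times borel_measurable_indicator, auto)
      show "AE x in lebesgue. (\<lambda>m. indicat_real V x *\<^sub>R (f x * box_bump a b m x))
          \<longlonglongrightarrow> indicat_real (box a b) x *\<^sub>R f x"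
      proof (rule AE_I2)
        fix x
        have "(\<lambda>m. box_bump a b m x * (indicat_real (cbox a b) x *\<^sub>R f x))
          \<longlonglongrightarrow> indicat_real (box a b) x * (indicat_real (cbox a b) x *\<^sub>R f x)"
          by (intro tendsto_mult box_bump_tendsto tendsto_const)
        moreover have "indicat_real (box a b) x * (indicat_real (cbox a b) x *\<^sub>R f x) =
            indicat_real (box a b) x *\<^sub>R f x"
          using box_subset_cbox[of a b] by (auto simp: indicator_def)
        ultimately show "(\<lambda>m. indicat_real V x *\<^sub>R (f x * box_bump a b m x))
          \<longlonglongrightarrow> indicat_real (box a b) x *\<^sub>R f x" unfolding eq by (simp only:)
      qed
      show "AE x in lebesgue. norm (indicat_real V x *\<^sub>R (f x * box_bump a b m x))
          \<le> norm (indicat_real (cbox a b) x *\<^sub>R f x)" for m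
        unfolding eq norm_mult using box_bump_bounds[of a b m]
        by (intro AE_I2 mult_left_le_one_le) auto
    qed
    moreover have "(LINT x|lebesgue. indicat_real V x *\<^sub>R (f x * box_bump a b m x)) = 0" for m
      using z[OF box_bump_test_function[OF ab]] by (simp add: set_lebesgue_integral_def)
    ultimately show ?thesis by (simp add: set_lebesgue_integral_def LIMSEQ_const_iff)
  qed
  have loc: "AE x in lebesgue. x \<in> cbox p q \<longrightarrow> f x = 0" if pq: "cbox p q \<subseteq> V" for p q
  proof -
    let ?F = "\<lambda>x. indicator (box p q) x *\<^sub>R f x"
    have "AE x in lebesgue. ?F x = 0"
    proof (rule AE_zero_if_box_integrals_zero)
      show "integrable lebesgue ?F"
        using set_integrable_subset[OF fK[OF compact_cbox pq], of "box p q"] box_subset_cbox[of p q]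
        by (simp add: set_integrable_def)
      show "integral\<^sup>L lebesgue ?F = 0"
        using box0[OF pq] by (simp add: set_lebesgue_integral_def)
      show "(LINT x:box a b|lebesgue. ?F x) = 0" for a b
      proof -
        obtain c d where cd: "box a b \<inter> box p q = box c d" by (simp add: box_Int_box)
        have "(LINT x:box a b|lebesgue. ?F x) = (LINT x:box c d|lebesgue. f x)"
          unfolding set_lebesgue_integral_def cd[symmetric]
          by (intro Bochner_Integration.integral_cong) (auto simp: indicator_def)
        also have "\<dots> = 0"
        proof (cases "box c d = {}")
          \<comment> \<open>If the open box is empty, the closed one need not be its closure and
            might leave \<open>V\<close>; that case is settled separately.\<close>
          case False
          have "box c d \<subseteq> cbox p q" using cd box_subset_cbox by blast
          then have "closure (box c d) \<subseteq> cbox p q" by (rule closure_minimal) (rule closed_cbox)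
          then have "cbox c d \<subseteq> cbox p q" by (simp add: closure_box[OF False])
          then show ?thesis using pq by (intro box0) auto
        qed (simp add: set_lebesgue_integral_def)
        finally show ?thesis .
      qed
    qed
    \<comment> \<open>Only the open box has been treated; its faces are negligible.\<close>
    moreover have "AE x in lebesgue. x \<notin> cbox p q - box p q"
      using negligible_frontier_interval[of p q] by (intro AE_not_in) (simp add:
          negligible_iff_null_sets)
    ultimately show ?thesis by eventually_elim (auto simp: indicator_def)
  qed
  obtain D where D: "countable D" "D \<subseteq> Pow V" "\<And>X. X \<in> D \<Longrightarrow> \<exists>a b. X = cbox a b" "\<Union>D = V"
    using open_countable_Union_open_cbox[OF V] by metis
  have "AE x in lebesgue. \<forall>X\<in>D. x \<in> X \<longrightarrow> f x = 0"
    using D(1-3) loc by (subst AE_ball_countable) blast+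
  then show ?thesis by eventually_elim (use D(4) in blast)
qed

text \<open>Componentwise, the difference of two weak gradients is annihilated by all test
  functions. This is what makes the choice by \<open>SOME\<close> in \<open>wgrad\<close> computable
  up to null sets.\<close>

lemma weak_gradient_unique:
  fixes V :: "(real^'n::finite) set"
  assumes V: "open V" and G: "weak_gradient V f G" and H: "weak_gradient V f H"
  shows "AE x in lebesgue. x \<in> V \<longrightarrow> G x = H x"
proof -
  have I: "set_integrable lebesgue K (\<lambda>x. G x $ i)" "set_integrable lebesgue K (\<lambda>x. H x $ i)"
    if "compact K" "K \<subseteq> V" for K i
    using G H that set_integrable_vec_iff[of lebesgue K G] set_integrable_vec_iff[of lebesgue K H]
    by (simp_all add: weak_gradient_def)
  have "AE x in lebesgue. x \<in> V \<longrightarrow> G x $ i - H x $ i = 0" for i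
  proof (rule AE_zero_if_test_integrals_zero[OF V])
    show "set_integrable lebesgue K (\<lambda>x. G x $ i - H x $ i)" if "compact K" "K \<subseteq> V" for K
      using I that by (intro set_integral_diff)
  next
    fix \<eta> :: "real^'n \<Rightarrow> real" assume \<eta>: "\<eta> \<in> test_functions V"
    obtain K where K: "compact K" "K \<subseteq> V" "\<And>x. x \<notin> K \<Longrightarrow> \<eta> x = 0"
      using test_functionE[OF \<eta>] by metis
    have "set_integrable lebesgue V (\<lambda>x. \<eta> x * G x $ i)" "set_integrable lebesgue V (\<lambda>x. \<eta> x * H x
        $ i)"
      by (simp_all add: set_integrable_mult_supported[OF K(1,2)] I K test_functionsD(2)[OF \<eta>])
    then have "(LINT x:V|lebesgue. \<eta> x * G x $ i - \<eta> x * H x $ i) =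
        (LINT x:V|lebesgue. \<eta> x * G x $ i) - (LINT x:V|lebesgue. \<eta> x * H x $ i)"
      by (rule set_integral_diff)
    moreover have "- (LINT x:V|lebesgue. G x $ i * \<eta> x) = - (LINT x:V|lebesgue. H x $ i * \<eta> x)"
      using G H \<eta> by (simp add: weak_gradient_def)
    ultimately show "(LINT x:V|lebesgue. (G x $ i - H x $ i) * \<eta> x) = 0"
      by (simp add: left_diff_distrib mult.commute[of "\<eta> _"])
  qed
  then have "AE x in lebesgue. \<forall>i\<in>UNIV. x \<in> V \<longrightarrow> G x $ i - H x $ i = 0"
    by (intro AE_finite_allI) auto
  then show ?thesis by eventually_elim (simp add: vec_eq_iff)
qed

section \<open>Smoothness on sets that need not be open\<close>

lemma smooth_on_mult:
  fixes f g :: "'a::real_normed_vector \<Rightarrow> real"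
  shows "open V \<Longrightarrow> smooth_on V f \<Longrightarrow> smooth_on V g \<Longrightarrow> smooth_on V (\<lambda>x. f x * g x)"
  by (simp add: smooth_on_def Ck_on_mult)

lemma smooth_on_subset: "smooth_on V f \<Longrightarrow> W \<subseteq> V \<Longrightarrow> smooth_on W f"
  unfolding smooth_on_def using Ck_on_subset by blast

lemma smooth_rel_const: "smooth_rel S (\<lambda>x. b)"
  unfolding smooth_rel_def smooth_on_def by (intro ballI exI[of _ UNIV] exI[of _ "\<lambda>x. b"]) simp

lemma smooth_rel_mult:
  fixes f g :: "'a::real_normed_vector \<Rightarrow> real"
  assumes "smooth_rel S f" "smooth_rel S g"
  shows "smooth_rel S (\<lambda>x. f x * g x)"
  unfolding smooth_rel_def
proof
  fix x assume x: "x \<in> S"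
  obtain V F where F: "open V" "x \<in> V" "smooth_on V F" "\<forall>y\<in>V \<inter> S. F y = f y"
    using assms(1) x unfolding smooth_rel_def by blast
  obtain W G where G: "open W" "x \<in> W" "smooth_on W G" "\<forall>y\<in>W \<inter> S. G y = g y"
    using assms(2) x unfolding smooth_rel_def by blast
  have o: "open (V \<inter> W)" using F(1) G(1) by (rule open_Int)
  have "smooth_on (V \<inter> W) (\<lambda>x. F x * G x)"
    by (rule smooth_on_mult[OF o smooth_on_subset[OF F(3)] smooth_on_subset[OF G(3)]]) auto
  with o F G show "\<exists>V H. open V \<and> x \<in> V \<and> smooth_on V H \<and> (\<forall>y\<in>V \<inter> S. H y = f y * g y)"
    by (intro exI[of _ "V \<inter> W"] exI[of _ "\<lambda>x. F x * G x"]) simp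
qed

text \<open>A local extension may vanish off \<open>S\<close>, so it is restricted to the open set
  where it does not.\<close>

lemma smooth_rel_inverse:
  fixes f :: "'a::real_normed_vector \<Rightarrow> real"
  assumes "smooth_rel S f" "\<And>x. x \<in> S \<Longrightarrow> f x \<noteq> 0"
  shows "smooth_rel S (\<lambda>x. inverse (f x))"
  unfolding smooth_rel_def
proof
  fix x assume x: "x \<in> S"
  obtain V F where F: "open V" "x \<in> V" "smooth_on V F" "\<forall>y\<in>V \<inter> S. F y = f y"
    using assms(1) x unfolding smooth_rel_def by blast
  define W where "W = V \<inter> F -` (- {0})"
  have "Ck_on 0 V F" using F(3) unfolding smooth_on_def by blast
  then have W: "open W" unfolding W_def
    by (intro continuous_open_preimage F(1)) auto
  have "Ck_on k W (\<lambda>x. inverse (F x))" for k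
    using F(3) by (intro Ck_on_inverse[OF W]) (auto simp: W_def smooth_on_def intro: Ck_on_subset)
  moreover have "x \<in> W" using F x assms(2)[OF x] by (simp add: W_def)
  ultimately show "\<exists>V G. open V \<and> x \<in> V \<and> smooth_on V G \<and> (\<forall>y\<in>V \<inter> S. G y = inverse (f y))"
    using W F(4) by (intro exI[of _ W] exI[of _ "\<lambda>x. inverse (F x)"]) (auto simp: W_def
        smooth_on_def)
qed

lemma smooth_rel_imp_smooth_on:
  assumes "smooth_rel S f" "open V" "V \<subseteq> S"
  shows "smooth_on V f"
  unfolding smooth_on_def
proof (intro allI Ck_on_local)
  fix k x assume x: "x \<in> V"
  with assms(1,3) obtain W F where F: "open W" "x \<in> W" "smooth_on W F" "\<forall>y\<in>W \<inter> S. F y = f y"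
    unfolding smooth_rel_def by blast
  have o: "open (W \<inter> V)" using F(1) assms(2) by (rule open_Int)
  have "Ck_on k (W \<inter> V) F" using F(3) unfolding smooth_on_def by (auto intro: Ck_on_subset)
  then have "Ck_on k (W \<inter> V) f"
    by (rule Ck_on_cong[OF o, rotated]) (use F(4) assms(3) in auto)
  with o x F(2) show "\<exists>W. open W \<and> x \<in> W \<and> Ck_on k W f" by blast
qed

text \<open>A smooth extension is bounded with its gradient on a small closed ball. Gradients are
  compared only at interior points of \<open>S\<close>: elsewhere
  \<open>frechet_derivative f\<close> depends on arbitrary values of \<open>f\<close> off
  \<open>S\<close>.\<close>

lemma smooth_rel_locally_bounded:
  fixes f :: "real^'n::finite \<Rightarrow> real"
  assumes "smooth_rel S f" "x \<in> S"
  shows "\<exists>e>0. \<exists>B. \<forall>y\<in>ball x e \<inter> S. \<bar>f y\<bar> \<le> B \<and> (y \<in> interior S \<longrightarrow> norm (grad f y) \<le> B)"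
proof -
  obtain V F where F: "open V" "x \<in> V" "smooth_on V F" "\<forall>y\<in>V \<inter> S. F y = f y"
    using assms unfolding smooth_rel_def by blast
  obtain e where e: "e > 0" "cball x e \<subseteq> V" using F(1,2) by (auto simp: open_contains_cball)
  note c = smooth_on_grad_continuous[OF F(3) e(2)]
  obtain B1 where B1: "\<And>y. y \<in> cball x e \<Longrightarrow> \<bar>F y\<bar> \<le> B1"
    using compact_imp_bounded[OF compact_continuous_image[OF c(1) compact_cball]]
    by (auto simp: bounded_iff simp del: mem_cball)
  obtain B2 where B2: "\<And>y. y \<in> cball x e \<Longrightarrow> norm (grad F y) \<le> B2"
    using compact_imp_bounded[OF compact_continuous_image[OF c(2) compact_cball]]
    by (auto simp: bounded_iff simp del: mem_cball)
  have "\<bar>f y\<bar> \<le> max B1 B2 \<and> (y \<in> interior S \<longrightarrow> norm (grad f y) \<le> max B1 B2)" if y: "y \<in> ball x e \<inter>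
      S" for y
  proof -
    have yV: "y \<in> V" and yc: "y \<in> cball x e" using y e(2) by auto
    have "\<bar>f y\<bar> \<le> max B1 B2" using B1[OF yc] F(4) yV y by (metis IntE IntI max.coboundedI1)
    moreover have "norm (grad f y) \<le> max B1 B2" if "y \<in> interior S"
    proof -
      have "frechet_derivative F (at y) = frechet_derivative f (at y)"
        by (rule frechet_derivative_cong_open(1)[of "V \<inter> interior S"])
          (use F(1,4) yV that interior_subset[of S] in auto)
      then show ?thesis using B2[OF yc] by (simp add: grad_def)
    qed
    ultimately show ?thesis by simp
  qed
  with e(1) show ?thesis by blast
qed

lemma smooth_rel_bounded_on_compact:
  fixes f :: "real^'n::finite \<Rightarrow> real"
  assumes f: "smooth_rel S f" and K: "compact K" "K \<subseteq> S"
  obtains B where "B \<ge> 0" "\<And>x. x \<in> K \<Longrightarrow> \<bar>f x\<bar> \<le> B"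
    "\<And>x. x \<in> K \<Longrightarrow> x \<in> interior S \<Longrightarrow> norm (grad f x) \<le> B"
proof -
  have "\<forall>x\<in>K. \<exists>e B. e > 0 \<and> (\<forall>y\<in>ball x e \<inter> S. \<bar>f y\<bar> \<le> B \<and> (y \<in> interior S \<longrightarrow> norm (grad f y) \<le> B))"
    using smooth_rel_locally_bounded[OF f] K(2) by blast
  then obtain e b where eb: "\<And>x. x \<in> K \<Longrightarrow> e x > 0"
    "\<And>x y. x \<in> K \<Longrightarrow> y \<in> ball x (e x) \<inter> S \<Longrightarrow> \<bar>f y\<bar> \<le> b x \<and> (y \<in> interior S \<longrightarrow> norm (grad f y) \<le> b x)"
    by metis
  have "K \<subseteq> (\<Union>x\<in>K. ball x (e x))" using eb(1) by force
  then obtain D where D: "D \<subseteq> K" "finite D" "K \<subseteq> (\<Union>x\<in>D. ball x (e x))"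
    using compactE_image[OF K(1), of K "\<lambda>x. ball x (e x)"] by auto
  \<comment> \<open>The sum of absolute values dominates every local bound of the finite cover and
    is nonnegative even for an empty cover.\<close>
  define B where "B = (\<Sum>x\<in>D. \<bar>b x\<bar>)"
  have B: "b x \<le> B" if "x \<in> D" for x
    using member_le_sum[of x D "\<lambda>x. \<bar>b x\<bar>"] D(2) that by (simp add: B_def)
  show ?thesis
  proof (rule that[of B])
    show "B \<ge> 0" by (simp add: B_def sum_nonneg)
    fix y assume y: "y \<in> K"
    then obtain x where x: "x \<in> D" "y \<in> ball x (e x)" using D(3) by auto
    have "\<bar>f y\<bar> \<le> b x \<and> (y \<in> interior S \<longrightarrow> norm (grad f y) \<le> b x)"
      using eb(2)[of x y] x D(1) y K(2) by auto
    with B[OF x(1)] show "\<bar>f y\<bar> \<le> B" "y \<in> interior S \<Longrightarrow> norm (grad f y) \<le> B" by auto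
  qed
qed

lemma smooth_rel_continuous_on:
  fixes f :: "'a::real_normed_vector \<Rightarrow> 'b::real_normed_vector"
  assumes "smooth_rel S f"
  shows "continuous_on S f"
  unfolding continuous_on_eq_continuous_within
proof
  fix x assume x: "x \<in> S"
  obtain V F where F: "open V" "x \<in> V" "smooth_on V F" "\<forall>y\<in>V \<inter> S. F y = f y"
    using assms x unfolding smooth_rel_def by blast
  have "Ck_on 0 V F" using F(3) unfolding smooth_on_def by blast
  then have "continuous (at x within S) F"
    using F(1,2) by (auto simp: continuous_on_eq_continuous_at intro:
        continuous_at_imp_continuous_at_within)
  then have *: "(F \<longlongrightarrow> f x) (at x within S)" using F x by (auto simp: continuous_within)
  have "\<forall>\<^sub>F y in at x within S. F y = f y"
    unfolding eventually_at_topological using F by (intro exI[of _ V]) auto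
  with * show "continuous (at x within S) f"
    unfolding continuous_within by (rule Lim_transform_eventually)
qed

section \<open>Charts\<close>

lemma chart_img_openin: "is_chart M C \<Longrightarrow> openin (top_of_set half_space) (chart_img C)"
  by (simp add: is_chart_def)

lemma chart_img_minus_bd_hyperplane:
  assumes "is_chart M C"
  shows "chart_img C - bd_hyperplane \<subseteq> interior (chart_img C)"
proof -
  obtain T where T: "open T" "chart_img C = half_space \<inter> T"
    using chart_img_openin[OF assms] by (auto simp: openin_open)
  have "open {x::real^'b. 0 < x $ bd_ix}" by (intro open_Collect_less continuous_intros)
  then have "open ({x. 0 < x $ bd_ix} \<inter> T)" using T(1) by (rule open_Int)
  moreover have "{x. 0 < x $ bd_ix} \<inter> T \<subseteq> chart_img C"
    unfolding T(2) half_space_def by (intro Int_mono subsetI) simp_all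
  ultimately have "{x. 0 < x $ bd_ix} \<inter> T \<subseteq> interior (chart_img C)"
    by (rule interior_maximal[rotated])
  moreover have "chart_img C - bd_hyperplane \<subseteq> {x. 0 < x $ bd_ix} \<inter> T"
    unfolding T(2) half_space_def bd_hyperplane_def by (intro subsetI) (simp add: less_le)
  ultimately show ?thesis by (rule order_trans[rotated])
qed

text \<open>Passing to the interior removes only points of the boundary hyperplane, a null set. This
  links weak gradients, which live on the interior, with the square integrability imposed up to the
  hyperplane.\<close>

lemma AE_chart_img_interior:
  assumes "is_chart M C"
  shows "AE x in lebesgue. x \<in> chart_img C \<longrightarrow> x \<in> interior (chart_img C)"
proof -
  have "AE x in lebesgue. x \<notin> (bd_hyperplane :: (real^'b) set)"
    unfolding bd_hyperplane_def
    using negligible_standard_hyperplane_cart[of "bd_ix :: 'b"]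
    by (intro AE_not_in) (simp add: negligible_iff_null_sets)
  then show ?thesis
    by eventually_elim (use chart_img_minus_bd_hyperplane[OF assms] in blast)
qed

lemma chart_inv_in_dom:
  assumes "is_chart M C" "x \<in> chart_img C"
  shows "chart_inv C x \<in> chart_dom C" "chart_map C (chart_inv C x) = x" "chart_inv C x \<in> M"
proof -
  have "homeomorphism (chart_dom C) (chart_img C) (chart_map C) (chart_inv C)"
    and o: "openin (top_of_set M) (chart_dom C)"
    using assms(1) by (auto simp: is_chart_def)
  then show *: "chart_inv C x \<in> chart_dom C" and "chart_map C (chart_inv C x) = x"
    using assms(2) by (auto simp: homeomorphism_def)
  show "chart_inv C x \<in> M" using * openin_imp_subset[OF o] by blast
qed

lemma smooth_fun_mult: "smooth_fun A u \<Longrightarrow> smooth_fun A v \<Longrightarrow> smooth_fun A (\<lambda>p. u p * v p)"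
  unfolding smooth_fun_def in_chart_def by (auto intro: smooth_rel_mult)

lemma smooth_fun_const: "smooth_fun A (\<lambda>p. b)"
  unfolding smooth_fun_def in_chart_def by (auto intro: smooth_rel_const)

lemma smooth_fun_power: "smooth_fun A u \<Longrightarrow> smooth_fun A (\<lambda>p. u p ^ k)"
  by (induction k) (auto intro: smooth_fun_mult smooth_fun_const)

lemma smooth_rel_cong:
  assumes "smooth_rel S f" "\<And>x. x \<in> S \<Longrightarrow> f x = g x"
  shows "smooth_rel S g"
  using assms unfolding smooth_rel_def by (metis (no_types, lifting) IntE)

lemma smooth_fun_cong:
  assumes "smooth_atlas M A" "smooth_fun A u" "\<And>p. p \<in> M \<Longrightarrow> u p = v p"
  shows "smooth_fun A v"
  unfolding smooth_fun_def
proof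
  fix C assume C: "C \<in> A"
  then have "is_chart M C" using assms(1) by (simp add: smooth_atlas_def)
  then show "smooth_rel (chart_img C) (in_chart C v)"
    using assms(2,3) C chart_inv_in_dom(3)[of M C] unfolding smooth_fun_def in_chart_def
    by (blast intro: smooth_rel_cong)
qed

lemma smooth_fun_inverse:
  assumes "smooth_atlas M A" "smooth_fun A u" "\<And>p. p \<in> M \<Longrightarrow> u p \<noteq> 0"
  shows "smooth_fun A (\<lambda>p. inverse (u p))"
  unfolding smooth_fun_def
proof
  fix C assume C: "C \<in> A"
  then have "is_chart M C" using assms(1) by (simp add: smooth_atlas_def)
  then show "smooth_rel (chart_img C) (in_chart C (\<lambda>p. inverse (u p)))"
    using assms(2,3) C chart_inv_in_dom(3)[of M C] unfolding smooth_fun_def in_chart_def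
    by (intro smooth_rel_inverse) auto
qed

section \<open>Square integrable functions\<close>

text \<open>In a complete measure every subset of the exceptional null set is measurable.
  Measurability can thus be carried from an explicit formula to a \<open>wgrad\<close> known only
  almost everywhere.\<close>

lemma set_borel_measurable_complete:
  fixes f g :: "'a \<Rightarrow> 'b::euclidean_space"
  assumes f: "set_borel_measurable (completion N) K f" and AE: "AE x\<in>K in completion N. f x = g x"
  shows "set_borel_measurable (completion N) K g"
proof -
  let ?f = "\<lambda>x. indicat_real K x *\<^sub>R f x" and ?g = "\<lambda>x. indicat_real K x *\<^sub>R g x"
  have f': "?f \<in> borel_measurable (completion N)" using f by (simp add: set_borel_measurable_def)
  have "AE x in completion N. ?f x = ?g x" using AE by eventually_elim (auto simp: indicator_def)
  then obtain Z where Z: "Z \<in> null_sets (completion N)" "{x \<in> space (completion N). ?f x \<noteq> ?g x} \<subseteq>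
      Z"
    unfolding eventually_ae_filter by blast
  have null: "X \<in> sets (completion N)" if "X \<subseteq> Z" for X
    using Z(1) that null_sets_completion_subset[of X Z N] by (auto simp: null_sets_def)
  have "?g -` S \<inter> space (completion N) \<in> sets (completion N)" if "S \<in> sets borel" for S
  proof -
    have "?g -` S \<inter> space (completion N) =
      ((?f -` S \<inter> space (completion N)) - Z) \<union> (?g -` S \<inter> space (completion N) \<inter> Z)"
      using Z(2) by auto
    also have "\<dots> \<in> sets (completion N)"
      using Z(1) that f' by (intro sets.Un sets.Diff null measurable_sets[OF f']) auto
    finally show ?thesis .
  qed
  then show ?thesis unfolding set_borel_measurable_def by (intro measurableI) auto
qed

text \<open>No measurability is required: by completeness, \<open>f\<close> and \<open>g\<close> are both measurable or both not,
  and in the latter case both integrals are \<open>0\<close>.\<close>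

lemma lebesgue_integral_cong_AE:
  fixes f g :: "'a::euclidean_space \<Rightarrow> real"
  assumes "AE x in lebesgue. f x = g x"
  shows "integral\<^sup>L lebesgue f = integral\<^sup>L lebesgue g"
proof (cases "f \<in> borel_measurable lebesgue")
  case True
  with assms show ?thesis using borel_measurable_AE by (blast intro: integral_cong_AE)
next
  case False
  have "AE x in lebesgue. g x = f x" using assms by eventually_elim simp
  then have "g \<notin> borel_measurable lebesgue" using False borel_measurable_AE by blast
  with False show ?thesis
    by (metis borel_measurable_integrable not_integrable_integral_eq)
qed

text \<open>The factor 2 comes from (a + b)^2 \<le> 2 (a^2 + b^2). Two comparison functions are
  provided because the gradient of a product involves both the gradient and the function; where one
  suffices it is passed twice.\<close>

lemma L2_on_norm_bound:
  fixes f :: "'a \<Rightarrow> 'b::euclidean_space" and g :: "'a \<Rightarrow> 'c::euclidean_space" and h :: "'a \<Rightarrow>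
      'd::euclidean_space"
  assumes f: "set_borel_measurable \<mu> K f" and gh: "L2_on \<mu> K g" "L2_on \<mu> K h"
    and le: "AE x\<in>K in \<mu>. norm (f x) \<le> B * norm (g x) + B * norm (h x)"
  shows "L2_on \<mu> K f"
    and "(LINT x:K|\<mu>. (norm (f x))\<^sup>2) \<le> 2 * B\<^sup>2 * ((LINT x:K|\<mu>. (norm (g x))\<^sup>2) + (LINT x:K|\<mu>.
        (norm (h x))\<^sup>2))"
proof -
  have sq: "AE x\<in>K in \<mu>. (norm (f x))\<^sup>2 \<le> 2 * B\<^sup>2 * ((norm (g x))\<^sup>2 + (norm (h x))\<^sup>2)"
    using le
  proof eventually_elim
    case (elim x)
    show ?case
    proof
      assume "x \<in> K"
      then have "(norm (f x))\<^sup>2 \<le> (B * norm (g x) + B * norm (h x))\<^sup>2"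
        using elim by (intro power_mono) auto
      also have "\<dots> = B\<^sup>2 * (norm (g x) + norm (h x))\<^sup>2"
        by (simp add: power_mult_distrib[symmetric] distrib_left)
      also have "\<dots> \<le> B\<^sup>2 * (2 * ((norm (g x))\<^sup>2 + (norm (h x))\<^sup>2))"
        using sum_squares_bound[of "norm (g x)" "norm (h x)"]
        by (intro mult_left_mono) (simp_all add: power2_sum)
      also have "\<dots> = 2 * B\<^sup>2 * ((norm (g x))\<^sup>2 + (norm (h x))\<^sup>2)" by simp
      finally show "(norm (f x))\<^sup>2 \<le> 2 * B\<^sup>2 * ((norm (g x))\<^sup>2 + (norm (h x))\<^sup>2)" .
    qed
  qed
  have i: "set_integrable \<mu> K (\<lambda>x. (norm (g x))\<^sup>2)" "set_integrable \<mu> K (\<lambda>x. (norm (h x))\<^sup>2)"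
    using gh by (auto simp: L2_on_def)
  then have I: "set_integrable \<mu> K (\<lambda>x. 2 * B\<^sup>2 * ((norm (g x))\<^sup>2 + (norm (h x))\<^sup>2))"
    by (intro set_integrable_mult_right set_integral_add)
  have "(\<lambda>x. (norm (indicat_real K x *\<^sub>R f x))\<^sup>2) \<in> borel_measurable \<mu>"
    using f unfolding set_borel_measurable_def
    by (intro borel_measurable_power) (rule measurable_compose[OF _ borel_measurable_norm])
  moreover have "(norm (indicat_real K x *\<^sub>R f x))\<^sup>2 = indicat_real K x *\<^sub>R (norm (f x))\<^sup>2" for x
    by (simp add: indicator_def)
  ultimately have m: "set_borel_measurable \<mu> K (\<lambda>x. (norm (f x))\<^sup>2)"
    by (simp only: set_borel_measurable_def)
  have J: "set_integrable \<mu> K (\<lambda>x. (norm (f x))\<^sup>2)"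
    by (rule set_integrable_bound[OF I m]) (use sq in eventually_elim, auto)
  with f show "L2_on \<mu> K f" by (simp add: L2_on_def)
  have "(LINT x:K|\<mu>. (norm (f x))\<^sup>2) \<le> (LINT x:K|\<mu>. 2 * B\<^sup>2 * ((norm (g x))\<^sup>2 + (norm (h x))\<^sup>2))"
    using J I sq by (rule set_integral_mono_AE)
  also have "\<dots> = 2 * B\<^sup>2 * ((LINT x:K|\<mu>. (norm (g x))\<^sup>2) + (LINT x:K|\<mu>. (norm (h x))\<^sup>2))"
    using i by (simp add: set_integral_add)
  finally show "(LINT x:K|\<mu>. (norm (f x))\<^sup>2) \<le> 2 * B\<^sup>2 * ((LINT x:K|\<mu>. (norm (g x))\<^sup>2) + (LINT
      x:K|\<mu>. (norm (h x))\<^sup>2))" .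
qed

lemma set_borel_measurable_diff:
  fixes f g :: "'a \<Rightarrow> 'b::euclidean_space"
  assumes "set_borel_measurable \<mu> K f" "set_borel_measurable \<mu> K g"
  shows "set_borel_measurable \<mu> K (\<lambda>x. f x - g x)"
  using assms borel_measurable_diff unfolding set_borel_measurable_def scaleR_diff_right by blast

lemma L2_on_diff:
  fixes f g :: "'a \<Rightarrow> 'b::euclidean_space"
  assumes "L2_on \<mu> K f" "L2_on \<mu> K g"
  shows "L2_on \<mu> K (\<lambda>x. f x - g x)"
  using assms
  by (intro L2_on_norm_bound(1)[OF set_borel_measurable_diff assms, where B = 1] AE_I2)
    (auto simp: L2_on_def norm_triangle_ineq4)

lemma L2_tendsto_on_norm_bound:
  fixes f :: "'a \<Rightarrow> 'b::euclidean_space" and g :: "'a \<Rightarrow> 'c::euclidean_space" and h :: "'a \<Rightarrow>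
      'd::euclidean_space"
  assumes f: "\<And>k. L2_on \<mu> K (fs k)" "L2_on \<mu> K f"
    and gh: "L2_tendsto_on \<mu> K gs g" "L2_tendsto_on \<mu> K hs h"
    and le: "\<And>k. AE x\<in>K in \<mu>. norm (fs k x - f x) \<le> B * norm (gs k x - g x) + B * norm (hs k x - h
        x)"
  shows "L2_tendsto_on \<mu> K fs f"
  unfolding L2_tendsto_on_def
proof (intro conjI allI f)
  let ?I = "\<lambda>k. 2 * B\<^sup>2 * ((LINT x:K|\<mu>. (norm (gs k x - g x))\<^sup>2) + (LINT x:K|\<mu>. (norm (hs k x - h
      x))\<^sup>2))"
  have "(LINT x:K|\<mu>. (norm (fs k x - f x))\<^sup>2) \<le> ?I k" for k
    using f gh
    by (intro L2_on_norm_bound(2)[OF _ _ _ le] L2_on_diff set_borel_measurable_diff)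
      (auto simp: L2_tendsto_on_def L2_on_def)
  moreover have "?I \<longlonglongrightarrow> 2 * B\<^sup>2 * (0 + 0)"
    using gh by (intro tendsto_intros) (auto simp: L2_tendsto_on_def)
  then have "?I \<longlonglongrightarrow> 0" by (simp only: add_0_left mult_zero_right)
  moreover have "0 \<le> (LINT x:K|\<mu>. (norm (fs k x - f x))\<^sup>2)" for k
    by (simp add: set_lebesgue_integral_def)
  ultimately show "(\<lambda>k. LINT x:K|\<mu>. (norm (fs k x - f x))\<^sup>2) \<longlonglongrightarrow> 0"
    using tendsto_sandwich[of "\<lambda>_. 0" "\<lambda>k. LINT x:K|\<mu>. (norm (fs k x - f x))\<^sup>2" sequentially ?I 0]
    by (simp add: always_eventually)
qed

section \<open>Multiplication of Sobolev functions by smooth functions\<close>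

lemma smooth_atlas_is_chart: "smooth_atlas M A \<Longrightarrow> C \<in> A \<Longrightarrow> is_chart M C"
  by (simp add: smooth_atlas_def)

lemma in_chart_mult [simp]: "in_chart C (\<lambda>p. u p * v p) = (\<lambda>x. in_chart C u x * in_chart C v x)"
  by (simp add: in_chart_def)

lemma H1_weak_gradient:
  assumes "u \<in> H1 A" "C \<in> A"
  shows "weak_gradient (interior (chart_img C)) (in_chart C u) (wgrad u C)"
proof -
  have "\<exists>G. weak_gradient (interior (chart_img C)) (in_chart C u) G"
    using assms by (simp add: H1_def)
  then show ?thesis unfolding wgrad_def by (rule someI_ex)
qed

lemma H1_L2_on:
  assumes "u \<in> H1 A" "C \<in> A" "compact K" "K \<subseteq> chart_img C"
  shows "L2_on lebesgue K (in_chart C u)" "L2_on lebesgue K (wgrad u C)"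
  using assms by (simp_all add: H1_def)

text \<open>By uniqueness, the gradient chosen by \<open>SOME\<close> may be replaced by any
  explicitly known one, first on the interior and then up to the boundary hyperplane.\<close>

lemma wgrad_AE_eq:
  assumes "is_chart M C" "weak_gradient (interior (chart_img C)) (in_chart C u) G"
  shows "AE x\<in>chart_img C in lebesgue. wgrad u C x = G x"
proof -
  have "weak_gradient (interior (chart_img C)) (in_chart C u) (wgrad u C)"
    unfolding wgrad_def by (rule someI[of "weak_gradient (interior (chart_img C)) (in_chart C u)",
        OF assms(2)])
  from AE_chart_img_interior[OF assms(1)] weak_gradient_unique[OF open_interior this assms(2)]
  show ?thesis by eventually_elim blast
qed

lemma smooth_fun_smooth_on_interior:
  assumes "smooth_fun A q" "C \<in> A"
  shows "smooth_on (interior (chart_img C)) (in_chart C q)"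
  using assms by (intro smooth_rel_imp_smooth_on[OF _ open_interior interior_subset]) (simp add:
      smooth_fun_def)

lemma wgrad_mult_AE:
  assumes "is_chart M C" "C \<in> A" "smooth_fun A q" "u \<in> H1 A"
  shows "AE x\<in>chart_img C in lebesgue. wgrad (\<lambda>p. q p * u p) C x =
    in_chart C q x *\<^sub>R wgrad u C x + in_chart C u x *\<^sub>R grad (in_chart C q) x"
proof (rule wgrad_AE_eq[OF assms(1)])
  show "weak_gradient (interior (chart_img C)) (in_chart C (\<lambda>p. q p * u p))
      (\<lambda>x. in_chart C q x *\<^sub>R wgrad u C x + in_chart C u x *\<^sub>R grad (in_chart C q) x)"
    using weak_gradient_mult[OF open_interior smooth_fun_smooth_on_interior[OF assms(3,2)]
        H1_weak_gradient[OF assms(4,2)]]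
    by simp
qed

lemma wgrad_one_AE:
  assumes "is_chart M C"
  shows "AE x\<in>chart_img C in lebesgue. wgrad (\<lambda>p. 1) C x = 0"
proof (rule wgrad_AE_eq[OF assms(1)])
  show "weak_gradient (interior (chart_img C)) (in_chart C (\<lambda>p. 1)) (\<lambda>x. 0)"
    using weak_gradient_one[OF open_interior] by (simp add: in_chart_def)
qed

lemma set_borel_measurable_mult:
  fixes f g :: "'a \<Rightarrow> real"
  assumes "set_borel_measurable \<mu> K f" "set_borel_measurable \<mu> K g"
  shows "set_borel_measurable \<mu> K (\<lambda>x. f x * g x)"
proof -
  have "(\<lambda>x. (indicat_real K x *\<^sub>R f x) * (indicat_real K x *\<^sub>R g x)) \<in> borel_measurable \<mu>"
    using assms unfolding set_borel_measurable_def by (rule borel_measurable_times)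
  moreover have "(indicat_real K x *\<^sub>R f x) * (indicat_real K x *\<^sub>R g x) = indicat_real K x *\<^sub>R (f
      x * g x)" for x
    by (simp add: indicator_def)
  ultimately show ?thesis by (simp only: set_borel_measurable_def)
qed

lemma set_borel_measurable_scaleR:
  fixes f :: "'a \<Rightarrow> real" and g :: "'a \<Rightarrow> 'b::euclidean_space"
  assumes "set_borel_measurable \<mu> K f" "set_borel_measurable \<mu> K g"
  shows "set_borel_measurable \<mu> K (\<lambda>x. f x *\<^sub>R g x)"
proof -
  have "(\<lambda>x. (indicat_real K x *\<^sub>R f x) *\<^sub>R (indicat_real K x *\<^sub>R g x)) \<in> borel_measurable \<mu>"
    using assms unfolding set_borel_measurable_def by (rule borel_measurable_scaleR)
  moreover have "(indicat_real K x *\<^sub>R f x) *\<^sub>R (indicat_real K x *\<^sub>R g x) = indicat_real K x *\<^sub>R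
      (f x *\<^sub>R g x)" for x
    by (simp add: indicator_def)
  ultimately show ?thesis by (simp only: set_borel_measurable_def)
qed

lemma set_borel_measurable_add:
  fixes f g :: "'a \<Rightarrow> 'b::euclidean_space"
  assumes "set_borel_measurable \<mu> K f" "set_borel_measurable \<mu> K g"
  shows "set_borel_measurable \<mu> K (\<lambda>x. f x + g x)"
  using assms borel_measurable_add unfolding set_borel_measurable_def scaleR_add_right by blast

lemma set_borel_measurable_bd_continuous:
  fixes h :: "real^'n::finite \<Rightarrow> 'b::euclidean_space"
  assumes "S \<in> sets borel" "continuous_on S h"
  shows "set_borel_measurable lebesgue_bd S h"
  using set_measurable_continuous_on[OF assms]
  unfolding set_borel_measurable_def lebesgue_bd_def by (intro measurable_completion) simp

lemma smooth_fun_bounds: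
  fixes A :: "('a, 'n::finite) chart set"
  assumes "smooth_fun A q" "C \<in> A" "compact K" "K \<subseteq> chart_img C"
  obtains B where "B \<ge> 0" "\<And>x. x \<in> K \<Longrightarrow> \<bar>in_chart C q x\<bar> \<le> B"
    "\<And>x. x \<in> K \<Longrightarrow> x \<in> interior (chart_img C) \<Longrightarrow> norm (grad (in_chart C q) x) \<le> B"
    "continuous_on K (in_chart C q)" "K \<in> sets borel"
proof -
  have s: "smooth_rel (chart_img C) (in_chart C q)" using assms(1,2) by (simp add: smooth_fun_def)
  show ?thesis
    by (rule smooth_rel_bounded_on_compact[OF s assms(3,4)])
      (rule that; use continuous_on_subset[OF smooth_rel_continuous_on[OF s] assms(4)]
          borel_compact[OF assms(3)] in simp)
qed

text \<open>The classical gradient is continuous on the interior of the chart image; its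
  uncontrolled values on the hyperplane lie over a null set.\<close>

lemma set_borel_measurable_grad_in_chart:
  fixes A :: "('a::t2_space, 'n::finite) chart set"
  assumes "is_chart M C" "smooth_fun A q" "C \<in> A" "compact K" "K \<subseteq> chart_img C"
  shows "set_borel_measurable lebesgue K (grad (in_chart C q))"
proof -
  let ?I = "interior (chart_img C)"
  have "set_borel_measurable lebesgue (K \<inter> ?I) (grad (in_chart C q))"
    by (intro set_borel_measurable_lebesgue_continuous sets.Int borel_compact assms(4) borel_open
        open_interior
      smooth_on_grad_continuous(2)[OF smooth_fun_smooth_on_interior[OF assms(2,3)] Int_lower2])
  then have "set_borel_measurable lebesgue K (\<lambda>x. indicat_real ?I x *\<^sub>R grad (in_chart C q) x)"
    by (simp add: set_borel_measurable_def indicator_inter_arith)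
  then show ?thesis
  proof (rule set_borel_measurable_complete)
    show "AE x\<in>K in lebesgue. indicat_real ?I x *\<^sub>R grad (in_chart C q) x = grad (in_chart C q) x"
      using AE_chart_img_interior[OF assms(1)] by eventually_elim (use assms(5) in auto)
  qed
qed

lemma H1_mult:
  fixes A :: "('a::t2_space, 'n::finite) chart set"
  assumes A: "smooth_atlas M A" and q: "smooth_fun A q" and u: "u \<in> H1 A"
  shows "(\<lambda>p. q p * u p) \<in> H1 A"
  unfolding H1_def mem_Collect_eq
proof (intro ballI conjI allI impI)
  fix C assume C: "C \<in> A"
  have ch: "is_chart M C" by (rule smooth_atlas_is_chart[OF A C])
  show "\<exists>G. weak_gradient (interior (chart_img C)) (in_chart C (\<lambda>p. q p * u p)) G"
    using weak_gradient_mult[OF open_interior smooth_fun_smooth_on_interior[OF q C]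
        H1_weak_gradient[OF u C]]
    by auto
  fix K assume "compact K \<and> K \<subseteq> chart_img C"
  then have K: "compact K" "K \<subseteq> chart_img C" by auto
  obtain B where B: "B \<ge> 0" "\<And>x. x \<in> K \<Longrightarrow> \<bar>in_chart C q x\<bar> \<le> B"
    "\<And>x. x \<in> K \<Longrightarrow> x \<in> interior (chart_img C) \<Longrightarrow> norm (grad (in_chart C q) x) \<le> B"
    and qc: "continuous_on K (in_chart C q)" "K \<in> sets borel"
    using smooth_fun_bounds[OF q C K] by metis
  note L = H1_L2_on[OF u C K]
  note qm = set_borel_measurable_lebesgue_continuous[OF qc(2,1)]
  have um: "set_borel_measurable lebesgue K (in_chart C u)" "set_borel_measurable lebesgue K
      (wgrad u C)"
    using L by (simp_all add: L2_on_def)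
  show "L2_on lebesgue K (in_chart C (\<lambda>p. q p * u p))"
    unfolding in_chart_mult
  proof (rule L2_on_norm_bound(1)[OF _ L(1) L(1), where B = B])
    show "set_borel_measurable lebesgue K (\<lambda>x. in_chart C q x * in_chart C u x)"
      by (rule set_borel_measurable_mult[OF qm um(1)])
    show "AE x\<in>K in lebesgue. norm (in_chart C q x * in_chart C u x)
        \<le> B * norm (in_chart C u x) + B * norm (in_chart C u x)"
    proof (rule AE_I2, rule impI)
      fix x assume "x \<in> K"
      then have "norm (in_chart C q x * in_chart C u x) \<le> B * norm (in_chart C u x)"
        using B by (simp add: abs_mult mult_right_mono)
      then show "norm (in_chart C q x * in_chart C u x) \<le> B * norm (in_chart C u x) + B * norm
          (in_chart C u x)"
        using B(1) by (simp add: add_increasing2)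
    qed
  qed
  let ?G = "\<lambda>x. in_chart C q x *\<^sub>R wgrad u C x + in_chart C u x *\<^sub>R grad (in_chart C q) x"
  have AE: "AE x\<in>K in lebesgue. wgrad (\<lambda>p. q p * u p) C x = ?G x"
    using wgrad_mult_AE[OF ch C q u] by eventually_elim (use K in blast)
  show "L2_on lebesgue K (wgrad (\<lambda>p. q p * u p) C)"
  proof (rule L2_on_norm_bound(1)[OF _ L(2) L(1), where B = B])
    have "set_borel_measurable lebesgue K ?G"
      by (intro set_borel_measurable_add set_borel_measurable_scaleR qm um
        set_borel_measurable_grad_in_chart[OF ch q C K])
    then show "set_borel_measurable lebesgue K (wgrad (\<lambda>p. q p * u p) C)"
      by (rule set_borel_measurable_complete) (use AE in eventually_elim, simp)
    show "AE x\<in>K in lebesgue. norm (wgrad (\<lambda>p. q p * u p) C x)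
        \<le> B * norm (wgrad u C x) + B * norm (in_chart C u x)"
      using AE AE_chart_img_interior[OF ch]
    proof eventually_elim
      case (elim x)
      show ?case
      proof
        assume x: "x \<in> K"
        have "norm (?G x) \<le> \<bar>in_chart C q x\<bar> * norm (wgrad u C x) + norm (grad (in_chart C q) x) *
            norm (in_chart C u x)"
          using norm_triangle_ineq[of "in_chart C q x *\<^sub>R wgrad u C x" "in_chart C u x *\<^sub>R grad
              (in_chart C q) x"]
          by (simp add: mult.commute)
        also have "\<dots> \<le> B * norm (wgrad u C x) + B * norm (in_chart C u x)"
          using B x elim K by (intro add_mono mult_right_mono) auto
        finally show "norm (wgrad (\<lambda>p. q p * u p) C x) \<le> B * norm (wgrad u C x) + B * norm
            (in_chart C u x)"
          using elim x by simp
      qed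
    qed
  qed
qed

lemma one_in_H1:
  fixes A :: "('a::t2_space, 'n::finite) chart set"
  assumes A: "smooth_atlas M A"
  shows "(\<lambda>p. 1) \<in> H1 A"
  unfolding H1_def mem_Collect_eq
proof (intro ballI conjI allI impI)
  fix C assume C: "C \<in> A"
  have ch: "is_chart M C" by (rule smooth_atlas_is_chart[OF A C])
  show "\<exists>G. weak_gradient (interior (chart_img C)) (in_chart C (\<lambda>p. 1)) G"
    using weak_gradient_one[OF open_interior] by (auto simp: in_chart_def)
  fix K assume "compact K \<and> K \<subseteq> chart_img C"
  then have K: "compact K" "K \<subseteq> chart_img C" by auto
  have one: "set_integrable lebesgue K (\<lambda>x. 1::real)"
    using weak_gradient_one[OF open_UNIV[where 'a = "real^'n"]] K by (simp add: weak_gradient_def)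
  then show L1: "L2_on lebesgue K (in_chart C (\<lambda>p. 1))"
    by (simp add: L2_on_def in_chart_def set_integrable_def set_borel_measurable_def)
  have AE: "AE x\<in>K in lebesgue. 0 = wgrad (\<lambda>p. 1) C x"
    using wgrad_one_AE[OF ch] by eventually_elim (use K in auto)
  have m: "set_borel_measurable lebesgue K (wgrad (\<lambda>p. 1) C)"
    by (rule set_borel_measurable_complete[OF _ AE]) (simp add: set_borel_measurable_def)
  show "L2_on lebesgue K (wgrad (\<lambda>p. 1) C)"
    by (rule L2_on_norm_bound(1)[OF m L1 L1, where B = 0]) (use AE in eventually_elim, auto)
qed

lemma smooth_fun_H1:
  fixes A :: "('a::t2_space, 'n::finite) chart set"
  assumes "smooth_atlas M A" "smooth_fun A q"
  shows "q \<in> H1 A"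
  using H1_mult[OF assms one_in_H1[OF assms(1)]] by simp

lemma wgrad_smooth_AE:
  fixes A :: "('a::t2_space, 'n::finite) chart set"
  assumes "smooth_atlas M A" "C \<in> A" "smooth_fun A q"
  shows "AE x\<in>chart_img C in lebesgue. wgrad q C x = grad (in_chart C q) x"
proof -
  have ch: "is_chart M C" by (rule smooth_atlas_is_chart[OF assms(1,2)])
  from wgrad_mult_AE[OF ch assms(2,3) one_in_H1[OF assms(1)]] wgrad_one_AE[OF ch]
  show ?thesis by eventually_elim (simp add: in_chart_def)
qed

text \<open>Subtracting the product rules for \<open>us k\<close> and \<open>u\<close> leaves an
  expression linear in the two differences. On each compact set one constant \<open>B\<close>,
  independent of \<open>k\<close>, bounds its coefficients.\<close>

lemma H1_tendsto_mult:
  fixes A :: "('a::t2_space, 'n::finite) chart set"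
  assumes A: "smooth_atlas M A" and q: "smooth_fun A q" and us: "H1_tendsto A us u"
  shows "H1_tendsto A (\<lambda>k p. q p * us k p) (\<lambda>p. q p * u p)"
proof -
  have H: "us k \<in> H1 A" "u \<in> H1 A" for k using us by (auto simp: H1_tendsto_def)
  note Hq = H1_mult[OF A q H(1)] H1_mult[OF A q H(2)]
  have "L2_tendsto_on lebesgue K (\<lambda>k. in_chart C (\<lambda>p. q p * us k p)) (in_chart C (\<lambda>p. q p * u p)) \<and>
    L2_tendsto_on lebesgue K (\<lambda>k. wgrad (\<lambda>p. q p * us k p) C) (wgrad (\<lambda>p. q p * u p) C)"
    if C: "C \<in> A" and K: "compact K" "K \<subseteq> chart_img C" for C K
  proof
    have ch: "is_chart M C" by (rule smooth_atlas_is_chart[OF A C])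
    obtain B where B: "B \<ge> 0" "\<And>x. x \<in> K \<Longrightarrow> \<bar>in_chart C q x\<bar> \<le> B"
      "\<And>x. x \<in> K \<Longrightarrow> x \<in> interior (chart_img C) \<Longrightarrow> norm (grad (in_chart C q) x) \<le> B"
      using smooth_fun_bounds[OF q C K] by metis
    have t: "L2_tendsto_on lebesgue K (\<lambda>k. in_chart C (us k)) (in_chart C u)"
      "L2_tendsto_on lebesgue K (\<lambda>k. wgrad (us k) C) (wgrad u C)"
      using us C K by (auto simp: H1_tendsto_def)
    show "L2_tendsto_on lebesgue K (\<lambda>k. in_chart C (\<lambda>p. q p * us k p)) (in_chart C (\<lambda>p. q p * u p))"
    proof (rule L2_tendsto_on_norm_bound[OF H1_L2_on(1)[OF Hq(1) C K] H1_L2_on(1)[OF Hq(2) C K]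
        t(1) t(1), where B = B])
      show "AE x\<in>K in lebesgue. norm (in_chart C (\<lambda>p. q p * us k p) x - in_chart C (\<lambda>p. q p * u p)
          x)
          \<le> B * norm (in_chart C (us k) x - in_chart C u x) + B * norm (in_chart C (us k) x -
              in_chart C u x)" for k
      proof (rule AE_I2, rule impI)
        fix x assume x: "x \<in> K"
        have "norm (in_chart C (\<lambda>p. q p * us k p) x - in_chart C (\<lambda>p. q p * u p) x)
            = \<bar>in_chart C q x\<bar> * norm (in_chart C (us k) x - in_chart C u x)"
          by (simp add: right_diff_distrib[symmetric] abs_mult)
        also have "\<dots> \<le> B * norm (in_chart C (us k) x - in_chart C u x)"
          using B(2)[OF x] by (rule mult_right_mono) simp
        finally show "norm (in_chart C (\<lambda>p. q p * us k p) x - in_chart C (\<lambda>p. q p * u p) x)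
          \<le> B * norm (in_chart C (us k) x - in_chart C u x) + B * norm (in_chart C (us k) x -
              in_chart C u x)"
          using B(1) by (simp add: add_increasing2)
      qed
    qed
    show "L2_tendsto_on lebesgue K (\<lambda>k. wgrad (\<lambda>p. q p * us k p) C) (wgrad (\<lambda>p. q p * u p) C)"
    proof (rule L2_tendsto_on_norm_bound[OF H1_L2_on(2)[OF Hq(1) C K] H1_L2_on(2)[OF Hq(2) C K]
        t(2) t(1), where B = B])
      fix k
      show "AE x\<in>K in lebesgue. norm (wgrad (\<lambda>p. q p * us k p) C x - wgrad (\<lambda>p. q p * u p) C x)
          \<le> B * norm (wgrad (us k) C x - wgrad u C x) + B * norm (in_chart C (us k) x - in_chart C
              u x)"
        using wgrad_mult_AE[OF ch C q H(1)[of k]] wgrad_mult_AE[OF ch C q H(2)]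
            AE_chart_img_interior[OF ch]
      proof eventually_elim
        case (elim x)
        show ?case
        proof
          assume x: "x \<in> K"
          let ?d = "wgrad (us k) C x - wgrad u C x" and ?e = "in_chart C (us k) x - in_chart C u x"
          have "wgrad (\<lambda>p. q p * us k p) C x - wgrad (\<lambda>p. q p * u p) C x
              = in_chart C q x *\<^sub>R ?d + ?e *\<^sub>R grad (in_chart C q) x"
            using elim x K(2) by (auto simp: algebra_simps)
          also have "norm \<dots> \<le> \<bar>in_chart C q x\<bar> * norm ?d + norm (grad (in_chart C q) x) * norm ?e"
            using norm_triangle_ineq[of "in_chart C q x *\<^sub>R ?d" "?e *\<^sub>R grad (in_chart C q) x"]
            by (simp add: mult.commute)
          also have "\<dots> \<le> B * norm ?d + B * norm ?e"
            using B x elim K by (intro add_mono mult_right_mono) auto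
          finally show "norm (wgrad (\<lambda>p. q p * us k p) C x - wgrad (\<lambda>p. q p * u p) C x) \<le> B * norm
              ?d + B * norm ?e" .
        qed
      qed
    qed
  qed
  with Hq show ?thesis by (simp add: H1_tendsto_def)
qed

lemma L2_bd_tendsto_mult:
  fixes A :: "('a::t2_space, 'n::finite) chart set"
  assumes q: "smooth_fun A q" and fs: "L2_bd_tendsto A fs f"
  shows "L2_bd_tendsto A (\<lambda>k p. q p * fs k p) (\<lambda>p. q p * f p)"
  unfolding L2_bd_tendsto_def
proof (intro ballI allI impI)
  fix C K assume C: "C \<in> A" and K: "compact K \<and> K \<subseteq> chart_img C \<inter> bd_hyperplane"
  then have K': "compact K" "K \<subseteq> chart_img C" by auto
  have t: "L2_tendsto_on lebesgue_bd K (\<lambda>k. in_chart C (fs k)) (in_chart C f)"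
    using fs C K by (simp add: L2_bd_tendsto_def)
  obtain B where B: "B \<ge> 0" "\<And>x. x \<in> K \<Longrightarrow> \<bar>in_chart C q x\<bar> \<le> B"
    and qc: "continuous_on K (in_chart C q)" "K \<in> sets borel"
    using smooth_fun_bounds[OF q C K'] by metis
  have le: "norm (in_chart C q x * h) \<le> B * norm h + B * norm h" if "x \<in> K" for x and h :: real
  proof -
    have "norm (in_chart C q x * h) \<le> B * norm h"
      using B(2)[OF that] by (simp add: abs_mult mult_right_mono)
    then show ?thesis using B(1) by (simp add: add_increasing2)
  qed
  have L: "L2_on lebesgue_bd K (in_chart C (\<lambda>p. q p * h p))" if "L2_on lebesgue_bd K (in_chart C
      h)" for h
  proof (rule L2_on_norm_bound(1)[OF _ that that, where B = B])
    show "set_borel_measurable lebesgue_bd K (in_chart C (\<lambda>p. q p * h p))"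
      unfolding in_chart_mult using that set_borel_measurable_bd_continuous[OF qc(2,1)]
      by (intro set_borel_measurable_mult) (simp_all add: L2_on_def)
    show "AE x\<in>K in lebesgue_bd. norm (in_chart C (\<lambda>p. q p * h p) x)
        \<le> B * norm (in_chart C h x) + B * norm (in_chart C h x)"
      unfolding in_chart_mult using le by (intro AE_I2) blast
  qed
  show "L2_tendsto_on lebesgue_bd K (\<lambda>k. in_chart C (\<lambda>p. q p * fs k p)) (in_chart C (\<lambda>p. q p * f
      p))"
  proof (rule L2_tendsto_on_norm_bound[OF L L t t, where B = B])
    show "AE x\<in>K in lebesgue_bd. norm (in_chart C (\<lambda>p. q p * fs k p) x - in_chart C (\<lambda>p. q p * f
        p) x)
       \<le> B * norm (in_chart C (fs k) x - in_chart C f x) + B * norm (in_chart C (fs k) x -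
           in_chart C f x)" for k
      unfolding in_chart_mult right_diff_distrib[symmetric] using le by (intro AE_I2) blast
  qed (use t in \<open>simp_all add: L2_tendsto_on_def\<close>)
qed

lemma has_trace_mult:
  fixes A :: "('a::t2_space, 'n::finite) chart set"
  assumes "smooth_atlas M A" "smooth_fun A q" "has_trace A w f"
  shows "has_trace A (\<lambda>p. q p * w p) (\<lambda>p. q p * f p)"
proof -
  obtain ws where "\<And>k. smooth_fun A (ws k)" "H1_tendsto A ws w" "L2_bd_tendsto A ws f"
    using assms(3) by (auto simp: has_trace_def)
  then show ?thesis
    using smooth_fun_mult[OF assms(2)] H1_tendsto_mult[OF assms(1,2)] L2_bd_tendsto_mult[OF
        assms(2)]
    unfolding has_trace_def by (intro exI[of _ "\<lambda>k p. q p * ws k p"]) blast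
qed

lemma H10_mult:
  fixes A :: "('a::t2_space, 'n::finite) chart set"
  assumes "smooth_atlas M A" "smooth_fun A q" "w \<in> H10 M A"
  shows "(\<lambda>p. q p * w p) \<in> H10 M A"
proof -
  obtain ws where ws: "\<And>k. ws k \<in> Cc_interior M A" "H1_tendsto A ws w"
    using assms(3) by (auto simp: H10_def)
  have "(\<lambda>p. q p * ws k p) \<in> Cc_interior M A" for k
  proof -
    obtain K where "compact K \<and> K \<subseteq> M - mfd_boundary A \<and> (\<forall>p\<in>M - K. ws k p = 0)"
      using ws(1)[of k] by (auto simp: Cc_interior_def)
    then have "compact K \<and> K \<subseteq> M - mfd_boundary A \<and> (\<forall>p\<in>M - K. q p * ws k p = 0)" by simp
    moreover have "smooth_fun A (\<lambda>p. q p * ws k p)"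
      using ws(1)[of k] by (intro smooth_fun_mult assms(2)) (simp add: Cc_interior_def)
    ultimately show ?thesis unfolding Cc_interior_def mem_Collect_eq by blast
  qed
  then show ?thesis
    using H1_tendsto_mult[OF assms(1,2) ws(2)] unfolding H10_def mem_Collect_eq
    by (intro exI[of _ "\<lambda>k p. q p * ws k p"]) blast
qed

section \<open>Traces and supports on the boundary\<close>

lemma null_sets_lebesgue_bd_subset:
  "N \<in> null_sets lebesgue_bd \<Longrightarrow> N' \<subseteq> N \<Longrightarrow> N' \<in> null_sets lebesgue_bd"
  unfolding lebesgue_bd_def by (rule null_sets_completion_subset)

lemma bd_null_subset:
  assumes "bd_null A N" "N' \<inter> mfd_boundary A \<subseteq> N"
  shows "bd_null A N'"
  unfolding bd_null_def
proof
  fix C assume "C \<in> A"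
  then have "chart_map C ` (N \<inter> mfd_boundary A \<inter> chart_dom C) \<in> null_sets lebesgue_bd"
    using assms(1) by (simp add: bd_null_def)
  then show "chart_map C ` (N' \<inter> mfd_boundary A \<inter> chart_dom C) \<in> null_sets lebesgue_bd"
    by (rule null_sets_lebesgue_bd_subset) (use assms(2) in auto)
qed

lemma bd_support_mult_subset: "bd_support A (\<lambda>p. h p * f p) \<subseteq> bd_support A f"
proof
  fix p assume p: "p \<in> bd_support A (\<lambda>p. h p * f p)"
  show "p \<in> bd_support A f"
    unfolding bd_support_def
  proof (intro CollectI conjI allI impI notI)
    show "p \<in> mfd_boundary A" using p by (simp add: bd_support_def)
    fix W assume W: "openin (top_of_set (mfd_boundary A)) W \<and> p \<in> W" and "bd_null A {q \<in> W. f q \<noteq>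
        0}"
    then have "bd_null A {q \<in> W. h q * f q \<noteq> 0}" by (elim bd_null_subset) auto
    with p W show False unfolding bd_support_def by blast
  qed
qed

text \<open>Every boundary point outside the support has a neighbourhood on which \<open>f\<close>
  vanishes up to a null set, but these are uncountably many. In a chart the Lindelof property leaves
  countably many, and their null sets add up to a null set.\<close>

lemma bd_null_outside_support:
  fixes A :: "('a::t2_space, 'n::finite) chart set"
  assumes A: "smooth_atlas M A"
  shows "bd_null A {p. p \<notin> bd_support A f \<and> f p \<noteq> 0}"
  unfolding bd_null_def
proof
  fix C assume C: "C \<in> A"
  have hom: "homeomorphism (chart_dom C) (chart_img C) (chart_map C) (chart_inv C)"
    using smooth_atlas_is_chart[OF A C] by (simp add: is_chart_def)
  define D where "D = mfd_boundary A \<inter> chart_dom C"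
  define T where "T = chart_map C ` D"
  have homD: "homeomorphism D T (chart_map C) (chart_inv C)"
    by (rule homeomorphism_of_subsets[OF hom]) (auto simp: D_def T_def)
  define \<W> where "\<W> = {W. openin (top_of_set (mfd_boundary A)) W \<and> bd_null A {q \<in> W. f q \<noteq> 0}}"
  let ?F = "(\<lambda>W. chart_map C ` (W \<inter> chart_dom C)) ` \<W>"
  have "openin (top_of_set T) S" if "S \<in> ?F" for S
  proof -
    from that obtain W where W: "openin (top_of_set (mfd_boundary A)) W" "S = chart_map C ` (W \<inter>
        chart_dom C)"
      by (auto simp: \<W>_def)
    have "openin (top_of_set D) (W \<inter> chart_dom C)"
      using W(1) unfolding openin_open D_def by blast
    then show ?thesis unfolding W(2) by (rule homeomorphism_imp_open_map[OF homD])
  qed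
  then obtain F' where F': "F' \<subseteq> ?F" "countable F'" "\<Union>F' = \<Union>?F" by (rule Lindelof_openin)
  obtain \<V> where V: "\<V> \<subseteq> \<W>" "countable \<V>" "F' = (\<lambda>W. chart_map C ` (W \<inter> chart_dom C)) ` \<V>"
    using F'(1,2) by (metis countable_subset_image)
  let ?N = "\<lambda>W. chart_map C ` ({q \<in> W. f q \<noteq> 0} \<inter> mfd_boundary A \<inter> chart_dom C)"
  have "(\<Union>W\<in>\<V>. ?N W) \<in> null_sets lebesgue_bd"
    using V(1,2) C by (intro null_sets_UN') (auto simp: \<W>_def bd_null_def)
  moreover have "chart_map C ` ({p. p \<notin> bd_support A f \<and> f p \<noteq> 0} \<inter> mfd_boundary A \<inter> chart_dom C)
      \<subseteq> (\<Union>W\<in>\<V>. ?N W)"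
  proof (rule image_subsetI)
    fix p assume p: "p \<in> {p. p \<notin> bd_support A f \<and> f p \<noteq> 0} \<inter> mfd_boundary A \<inter> chart_dom C"
    then obtain W where "W \<in> \<W>" "p \<in> W" by (auto simp: bd_support_def \<W>_def)
    then have "chart_map C p \<in> \<Union>F'" using p unfolding F'(3) by auto
    \<comment> \<open>The countable subfamily covers the image of \<open>p\<close>; injectivity of
      the chart identifies the covering point \<open>p'\<close> with \<open>p\<close>.\<close>
    then obtain W' p' where W': "W' \<in> \<V>" "p' \<in> W' \<inter> chart_dom C" "chart_map C p = chart_map C p'"
      unfolding V(3) by auto
    have "chart_inv C (chart_map C p') = p'" "chart_inv C (chart_map C p) = p"
      using W'(2) p by (auto intro: homeomorphism_apply1[OF hom])
    then have "p' = p" using W'(3) by simp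
    with W' p show "chart_map C p \<in> (\<Union>W\<in>\<V>. ?N W)" by blast
  qed
  ultimately show "chart_map C ` ({p. p \<notin> bd_support A f \<and> f p \<noteq> 0} \<inter> mfd_boundary A \<inter> chart_dom C)
      \<in> null_sets lebesgue_bd"
    by (rule null_sets_lebesgue_bd_subset)
qed

lemma L2_tendsto_on_cong_limit:
  fixes f f' :: "'a \<Rightarrow> 'b::euclidean_space"
  assumes "L2_tendsto_on (completion N) K fs f" and AE: "AE x\<in>K in completion N. f x = f' x"
  shows "L2_tendsto_on (completion N) K fs f'"
proof -
  have L: "L2_on (completion N) K f" "\<And>k. L2_on (completion N) K (fs k)"
    using assms(1) by (auto simp: L2_tendsto_on_def)
  have m: "set_borel_measurable (completion N) K f'"
    using L(1) by (intro set_borel_measurable_complete[OF _ AE]) (simp add: L2_on_def)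
  have "L2_on (completion N) K f'"
    by (rule L2_on_norm_bound(1)[OF m L(1) L(1), where B = 1]) (use AE in eventually_elim, auto)
  note bound = L2_tendsto_on_norm_bound[OF L(2) this assms(1,1), where B = 1]
  show ?thesis
    by (rule bound) (use AE in eventually_elim, auto)
qed

lemma has_trace_cong:
  fixes A :: "('a::t2_space, 'n::finite) chart set"
  assumes A: "smooth_atlas M A" and tr: "has_trace A w f" and null: "bd_null A {p. f p \<noteq> f' p}"
  shows "has_trace A w f'"
proof -
  obtain ws where ws: "\<And>k. smooth_fun A (ws k)" "H1_tendsto A ws w" "L2_bd_tendsto A ws f"
    using tr by (auto simp: has_trace_def)
  have "L2_bd_tendsto A ws f'"
    unfolding L2_bd_tendsto_def
  proof (intro ballI allI impI)
    fix C K assume C: "C \<in> A" and K: "compact K \<and> K \<subseteq> chart_img C \<inter> bd_hyperplane"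
    have ch: "is_chart M C" by (rule smooth_atlas_is_chart[OF A C])
    let ?N = "chart_map C ` ({p. f p \<noteq> f' p} \<inter> mfd_boundary A \<inter> chart_dom C)"
    have "?N \<in> null_sets lebesgue_bd" using null C by (simp add: bd_null_def)
    then have "AE x in lebesgue_bd. x \<notin> ?N" by (rule AE_not_in)
    then have "AE x\<in>K in lebesgue_bd. in_chart C f x = in_chart C f' x"
    proof eventually_elim
      case (elim x)
      show ?case
      proof
        assume "x \<in> K"
        then have x: "x \<in> chart_img C" "x \<in> bd_hyperplane" using K by auto
        note p = chart_inv_in_dom(1,2)[OF ch x(1)]
        have "chart_inv C x \<in> mfd_boundary A" using p x(2) C by (auto simp: mfd_boundary_def)
        then have "chart_inv C x \<notin> {p. f p \<noteq> f' p}" using elim p by (metis IntI image_eqI)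
        then show "in_chart C f x = in_chart C f' x" by (simp add: in_chart_def)
      qed
    qed
    moreover have "L2_tendsto_on lebesgue_bd K (\<lambda>k. in_chart C (ws k)) (in_chart C f)"
      using ws(3) C K by (simp add: L2_bd_tendsto_def)
    ultimately show "L2_tendsto_on lebesgue_bd K (\<lambda>k. in_chart C (ws k)) (in_chart C f')"
      unfolding lebesgue_bd_def by (rule L2_tendsto_on_cong_limit[rotated])
  qed
  with ws(1,2) show ?thesis by (auto simp: has_trace_def)
qed

section \<open>Inverse matrices\<close>

lemma matrix_inv_eqI:
  fixes A B :: "real^'n^'n"
  assumes "A ** B = mat 1"
  shows "matrix_inv A = B"
proof -
  have "B ** A = mat 1" using assms by (simp add: matrix_left_right_inverse)
  then have "A ** matrix_inv A = mat 1 \<and> matrix_inv A ** A = mat 1"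
    unfolding matrix_inv_def using assms by (intro someI[of "\<lambda>A'. A ** A' = mat 1 \<and> A' ** A = mat
        1"]) simp
  then have "matrix_inv A ** (A ** B) = B" by (simp add: matrix_mul_assoc)
  then show ?thesis by (simp add: assms)
qed

lemma matrix_mult_matrix_inv:
  fixes A :: "real^'n^'n"
  assumes "invertible A"
  shows "A ** matrix_inv A = mat 1"
  using assms matrix_inv_eqI unfolding invertible_def by metis

lemma matrix_inv_scaleR:
  fixes A :: "real^'n^'n"
  assumes "invertible A" "s \<noteq> 0"
  shows "matrix_inv (s *\<^sub>R A) = inverse s *\<^sub>R matrix_inv A"
proof (rule matrix_inv_eqI)
  have "(s *\<^sub>R A) ** (inverse s *\<^sub>R matrix_inv A) = A ** matrix_inv A"
    using assms(2) by (simp add: matrix_matrix_mult_def vec_eq_iff field_simps)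
  then show "(s *\<^sub>R A) ** (inverse s *\<^sub>R matrix_inv A) = mat 1"
    by (simp add: matrix_mult_matrix_inv[OF assms(1)])
qed

lemma transpose_matrix_inv:
  fixes A :: "real^'n^'n"
  assumes "invertible A" "transpose A = A"
  shows "transpose (matrix_inv A) = matrix_inv A"
proof -
  have "transpose (matrix_inv A) ** A = mat 1"
    using matrix_mult_matrix_inv[OF assms(1)] assms(2) by (metis matrix_transpose_mul transpose_mat)
  then show ?thesis by (metis matrix_inv_eqI matrix_left_right_inverse)
qed

lemma det_scaleR:
  fixes A :: "real^'n^'n"
  shows "det (s *\<^sub>R A) = s ^ CARD('n) * det A"
  by (simp add: det_def prod.distrib sum_distrib_left mult_ac)

text \<open>Cramer's rule. It writes the entry as a quotient of determinants, hence of polynomials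
  in the entries of \<open>A\<close>, through which measurability passes from the metric to its
  inverse.\<close>

lemma matrix_inv_component:
  fixes A :: "real^'n^'n"
  assumes "invertible A"
  shows "matrix_inv A $ i $ j = det (\<chi> k l. if l = i then axis j 1 $ k else A $ k $ l) / det A"
proof -
  have "A *v (matrix_inv A *v axis j 1) = axis j 1"
    by (simp add: matrix_vector_mul_assoc matrix_mult_matrix_inv[OF assms])
  moreover have "det A \<noteq> 0" using assms by (simp add: invertible_det_nz)
  ultimately have "matrix_inv A *v axis j 1 = (\<chi> i. det (\<chi> k l. if l = i then axis j 1 $ k else A
      $ k $ l) / det A)"
    by (simp add: cramer)
  then show ?thesis by (simp add: matrix_vector_mul_component[symmetric] vec_eq_iff
      matrix_vector_mult_basis column_def)
qed

lemma positive_definite_invertible: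
  fixes A :: "real^'n^'n"
  assumes "\<And>\<xi>. \<xi> \<noteq> 0 \<Longrightarrow> 0 < \<xi> \<bullet> (A *v \<xi>)"
  shows "invertible A"
proof -
  have "\<forall>x. A *v x = 0 \<longrightarrow> x = 0" using assms by (metis inner_zero_right less_irrefl)
  then show ?thesis by (simp add: invertible_left_inverse matrix_left_invertible_ker)
qed

text \<open>The Leibniz formula has one product per permutation, and signs have absolute value
  1.\<close>

lemma abs_det_le:
  fixes A :: "real^'n^'n"
  assumes "\<And>i j. \<bar>A $ i $ j\<bar> \<le> B"
  shows "\<bar>det A\<bar> \<le> (\<Sum>p\<in>{p. p permutes (UNIV :: 'n set)}. B ^ CARD('n))"
  unfolding det_def
proof (rule order_trans[OF sum_abs sum_mono])
  fix p :: "'n \<Rightarrow> 'n"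
  have "\<bar>of_int (sign p) * (\<Prod>i\<in>UNIV. A $ i $ p i)\<bar> = (\<Prod>i\<in>UNIV. \<bar>A $ i $ p i\<bar>)"
    by (simp add: abs_mult abs_prod sign_def)
  also have "\<dots> \<le> (\<Prod>i\<in>(UNIV :: 'n set). B)" by (intro prod_mono) (simp add: assms)
  finally show "\<bar>of_int (sign p) * (\<Prod>i\<in>UNIV. A $ i $ p i)\<bar> \<le> B ^ CARD('n)" by simp
qed

section \<open>The Dirichlet form\<close>

lemma riemannian_metric_AE:
  assumes "riemannian_metric A g" "C \<in> A"
  shows "AE x\<in>chart_img C in lebesgue. invertible (g C x) \<and> transpose (matrix_inv (g C x)) =
      matrix_inv (g C x)"
proof -
  have "AE x in lebesgue. x \<in> chart_img C \<longrightarrow>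
        transpose (g C x) = g C x \<and> (\<forall>\<xi>. \<xi> \<noteq> 0 \<longrightarrow> 0 < \<xi> \<bullet> (g C x *v \<xi>))"
    using assms by (simp add: riemannian_metric_def)
  then show ?thesis
    by eventually_elim (metis positive_definite_invertible transpose_matrix_inv)
qed

text \<open>The arguments are arbitrary vector fields, so that multiples of gradients and
  differences of gradients can be inserted. The volume factor is included because only the product
  of coefficients and volume factor is integrated.\<close>

definition dirichlet_density :: "('a, 'n::finite) metric \<Rightarrow> ('a, 'n) chart \<Rightarrow> (real^'n \<Rightarrow> real^'n) \<Rightarrow>
    (real^'n \<Rightarrow> real^'n) \<Rightarrow> real^'n \<Rightarrow> real" where
  "dirichlet_density g C U W x = (U x \<bullet> (matrix_inv (g C x) *v W x)) * sqrt (det (g C x))"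

lemma pairing_eq_inner: "pairing g u w C x = wgrad u C x \<bullet> (matrix_inv (g C x) *v wgrad w C x)"
  by (simp add: pairing_def inner_vec_def matrix_vector_mult_def sum_distrib_left mult_ac)

lemma set_borel_measurable_iff_restrict:
  fixes f :: "'a \<Rightarrow> 'b::euclidean_space"
  assumes "K \<in> sets \<mu>"
  shows "set_borel_measurable \<mu> K f \<longleftrightarrow> f \<in> borel_measurable (restrict_space \<mu> K)"
  using assms by (simp add: set_borel_measurable_def borel_measurable_restrict_space_iff
      sets.Int_space_eq2)

text \<open>The Cramer quotient is measurable everywhere on \<open>K\<close> and equals the
  coefficient wherever the metric is invertible, that is almost everywhere; completeness does the
  rest.\<close>

lemma dirichlet_coefficient_measurable:
  fixes A :: "('a::t2_space, 'n::finite) chart set"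
  assumes A: "smooth_atlas M A" and g: "riemannian_metric A g" and C: "C \<in> A"
    and K: "compact K" "K \<subseteq> chart_img C"
  shows "set_borel_measurable lebesgue K (\<lambda>x. matrix_inv (g C x) $ i $ j * sqrt (det (g C x)))"
proof -
  have Ks: "K \<in> sets lebesgue" using borel_compact[OF K(1)] by simp
  have "set_borel_measurable lebesgue (chart_img C) (\<lambda>x. g C x $ k $ l)" for k l
    using g C by (simp add: riemannian_metric_def)
  then have gm: "(\<lambda>x. g C x $ k $ l) \<in> borel_measurable (restrict_space lebesgue K)" for k l
    using set_borel_measurable_subset[OF _ Ks K(2)] set_borel_measurable_iff_restrict[OF Ks] by
        blast
  have det: "(\<lambda>x. det (h x)) \<in> borel_measurable (restrict_space lebesgue K)"
    if "\<And>k l. (\<lambda>x. h x $ k $ l) \<in> borel_measurable (restrict_space lebesgue K)" for h :: "real^'n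
        \<Rightarrow> real^'n^'n"
    unfolding det_def
    by (intro borel_measurable_sum borel_measurable_times borel_measurable_prod
        borel_measurable_const that)
  let ?h = "\<lambda>x. (\<chi> k l. if l = i then axis j 1 $ k else g C x $ k $ l) :: real^'n^'n"
  have "(\<lambda>x. ?h x $ k $ l) \<in> borel_measurable (restrict_space lebesgue K)" for k l
    using gm by (cases "l = i") auto
  then have h: "(\<lambda>x. det (?h x)) \<in> borel_measurable (restrict_space lebesgue K)" by (rule det)
  have d: "(\<lambda>x. det (g C x)) \<in> borel_measurable (restrict_space lebesgue K)" by (rule det[OF gm])
  have "(\<lambda>x. det (?h x) / det (g C x) * sqrt (det (g C x))) \<in> borel_measurable (restrict_space
      lebesgue K)"
    by (rule borel_measurable_times[OF borel_measurable_divide[OF h d]])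
      (rule measurable_compose[OF d], rule borel_measurable_continuous_onI, rule
          continuous_on_real_sqrt, rule continuous_on_id)
  then have "set_borel_measurable lebesgue K (\<lambda>x. det (?h x) / det (g C x) * sqrt (det (g C x)))"
    by (simp only: set_borel_measurable_iff_restrict[OF Ks])
  then show ?thesis
  proof (rule set_borel_measurable_complete)
    show "AE x\<in>K in lebesgue. det (?h x) / det (g C x) * sqrt (det (g C x))
        = matrix_inv (g C x) $ i $ j * sqrt (det (g C x))"
      using riemannian_metric_AE[OF g C] by eventually_elim (use K(2) in \<open>auto simp:
          matrix_inv_component\<close>)
  qed
qed

lemma dirichlet_density_measurable:
  fixes A :: "('a::t2_space, 'n::finite) chart set"
  assumes "smooth_atlas M A" "riemannian_metric A g" "C \<in> A" "compact K" "K \<subseteq> chart_img C"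
    and U: "set_borel_measurable lebesgue K U" and W: "set_borel_measurable lebesgue K W"
  shows "set_borel_measurable lebesgue K (dirichlet_density g C U W)"
proof -
  have Ks: "K \<in> sets lebesgue" using borel_compact[OF assms(4)] by simp
  have *: "(\<lambda>x. V x $ i) \<in> borel_measurable (restrict_space lebesgue K)"
    if "set_borel_measurable lebesgue K V" for V :: "real^'n \<Rightarrow> real^'n" and i
  proof -
    have "V \<in> borel_measurable (restrict_space lebesgue K)"
      using that by (simp only: set_borel_measurable_iff_restrict[OF Ks])
    then have "(\<lambda>x. V x \<bullet> axis i 1) \<in> borel_measurable (restrict_space lebesgue K)"
      by (intro borel_measurable_inner borel_measurable_const)
    then show ?thesis by (simp add: inner_axis)
  qed
  have "(\<lambda>x. \<Sum>i\<in>UNIV. \<Sum>j\<in>UNIV. (matrix_inv (g C x) $ i $ j * sqrt (det (g C x))) * (U x $ i * W x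
      $ j))
      \<in> borel_measurable (restrict_space lebesgue K)"
    using dirichlet_coefficient_measurable[OF assms(1-5)]
    by (intro borel_measurable_sum borel_measurable_times[OF _ borel_measurable_times[OF *[OF U]
        *[OF W]]])
      (simp add: set_borel_measurable_iff_restrict[OF Ks])
  moreover have "dirichlet_density g C U W =
      (\<lambda>x. \<Sum>i\<in>UNIV. \<Sum>j\<in>UNIV. (matrix_inv (g C x) $ i $ j * sqrt (det (g C x))) * (U x $ i * W x $
          j))"
    by (rule ext) (simp add: dirichlet_density_def inner_vec_def matrix_vector_mult_def
        sum_distrib_left
      sum_distrib_right mult_ac)
  ultimately show ?thesis by (simp only: set_borel_measurable_iff_restrict[OF Ks])
qed

text \<open>The fields are quantified inside the almost-everywhere statement: the exceptional set is
  that of the coefficient bounds and serves all fields at once.\<close>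

lemma dirichlet_density_bound:
  fixes A :: "('a::t2_space, 'n::finite) chart set"
  assumes g: "bounded_elliptic A g" and C: "C \<in> A" and K: "compact K" "K \<subseteq> chart_img C"
  obtains B where "B \<ge> 0"
    "AE x\<in>K in lebesgue. \<forall>U W. \<bar>dirichlet_density g C U W x\<bar> \<le> B * (norm (U x) * norm (W x))"
proof -
  obtain b \<kappa> where b: "AE x in lebesgue. x \<in> K \<longrightarrow>
       (\<forall>i j. \<bar>g C x $ i $ j\<bar> \<le> b \<and> \<bar>matrix_inv (g C x) $ i $ j\<bar> \<le> b) \<and>
       (\<forall>\<xi>. (\<Sum>i\<in>UNIV. \<Sum>j\<in>UNIV. matrix_inv (g C x) $ i $ j * \<xi> $ i * \<xi> $ j) \<ge> \<kappa> * (norm \<xi>)\<^sup>2)"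
    using g C K unfolding bounded_elliptic_def by blast
  \<comment> \<open>\<open>d\<close> bounds the volume factor by the Leibniz estimate, and
    \<open>B\<close> sums the coefficient bounds over all index pairs. Absolute values guard against
    a negative \<open>b\<close>, which can occur only if \<open>K\<close> is null.\<close>
  define d where "d = sqrt \<bar>\<Sum>p\<in>{p. p permutes (UNIV :: 'n set)}. \<bar>b\<bar> ^ CARD('n)\<bar>"
  define B where "B = (\<Sum>i\<in>(UNIV::'n set). \<Sum>j\<in>(UNIV::'n set). \<bar>b\<bar> * d)"
  have d: "d \<ge> 0" by (simp add: d_def)
  show ?thesis
  proof (rule that[of B])
    show "B \<ge> 0" unfolding B_def using d by (intro sum_nonneg) auto
    show "AE x\<in>K in lebesgue. \<forall>U W. \<bar>dirichlet_density g C U W x\<bar> \<le> B * (norm (U x) * norm (W x))"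
      using b
    proof eventually_elim
      case (elim x)
      show ?case
      proof (intro impI allI)
        fix U W :: "real^'n \<Rightarrow> real^'n" assume "x \<in> K"
        then have le: "\<bar>g C x $ i $ j\<bar> \<le> b" "\<bar>matrix_inv (g C x) $ i $ j\<bar> \<le> b" for i j using elim
            by auto
        have b0: "\<bar>b\<bar> = b" using le(1)[of undefined undefined] by auto
        have "\<bar>det (g C x)\<bar> \<le> \<bar>\<Sum>p\<in>{p. p permutes (UNIV :: 'n set)}. \<bar>b\<bar> ^ CARD('n)\<bar>"
          using abs_det_le[of "g C x" b] le(1) b0 by (metis abs_ge_self order_trans)
        then have s: "\<bar>sqrt (det (g C x))\<bar> \<le> d" by (simp add: d_def real_sqrt_abs' flip:
            real_sqrt_abs2)
        have "dirichlet_density g C U W x =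
          (\<Sum>i\<in>UNIV. \<Sum>j\<in>UNIV. (matrix_inv (g C x) $ i $ j * sqrt (det (g C x))) * (U x $ i * W x $
              j))"
          by (simp add: dirichlet_density_def inner_vec_def matrix_vector_mult_def
              sum_distrib_left sum_distrib_right mult_ac)
        also have "\<bar>\<dots>\<bar> \<le> (\<Sum>i\<in>UNIV. \<Sum>j\<in>UNIV. \<bar>(matrix_inv (g C x) $ i $ j * sqrt (det (g C x))) *
            (U x $ i * W x $ j)\<bar>)"
          by (rule order_trans[OF sum_abs]) (intro sum_mono sum_abs)
        also have "\<dots> \<le> (\<Sum>i\<in>(UNIV::'n set). \<Sum>j\<in>(UNIV::'n set). (\<bar>b\<bar> * d) * (norm (U x) * norm (W
            x)))"
          unfolding abs_mult using le(2) b0 s d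
          by (intro sum_mono mult_mono mult_nonneg_nonneg component_le_norm_cart) auto
        also have "\<dots> = B * (norm (U x) * norm (W x))" by (simp add: B_def sum_distrib_right)
        finally show "\<bar>dirichlet_density g C U W x\<bar> \<le> B * (norm (U x) * norm (W x))" .
      qed
    qed
  qed
qed

text \<open>Young's inequality, from (e a - b)^2 \<ge> 0. The free weight \<open>e\<close> lets it
  stand in for the Cauchy-Schwarz inequality in limits.\<close>

lemma norm_mult_le_scaled_squares:
  fixes a b e :: real
  assumes "e > 0"
  shows "a * b \<le> e / 2 * a\<^sup>2 + 1 / (2 * e) * b\<^sup>2"
proof -
  have "0 \<le> (e * a - b)\<^sup>2 / (2 * e)" using assms by simp
  also have "\<dots> = e / 2 * a\<^sup>2 + 1 / (2 * e) * b\<^sup>2 - a * b"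
    using assms by (simp add: power2_diff field_simps power2_eq_square)
  finally show ?thesis by simp
qed

lemma dirichlet_density_integrable:
  fixes A :: "('a::t2_space, 'n::finite) chart set"
  assumes "smooth_atlas M A" "riemannian_metric A g" "bounded_elliptic A g" "C \<in> A" "compact K" "K
      \<subseteq> chart_img C"
    and U: "L2_on lebesgue K U" and W: "L2_on lebesgue K W"
  shows "set_integrable lebesgue K (dirichlet_density g C U W)"
proof -
  obtain B where B: "B \<ge> 0"
    "AE x\<in>K in lebesgue. \<forall>U W. \<bar>dirichlet_density g C U W x\<bar> \<le> B * (norm (U x) * norm (W x))"
    using dirichlet_density_bound[OF assms(3-6)] by blast
  show ?thesis
  proof (rule set_integrable_bound)
    show "set_integrable lebesgue K (\<lambda>x. B * ((norm (U x))\<^sup>2 + (norm (W x))\<^sup>2))"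
      using U W by (intro set_integrable_mult_right set_integral_add) (auto simp: L2_on_def)
    show "set_borel_measurable lebesgue K (dirichlet_density g C U W)"
      using U W by (intro dirichlet_density_measurable[OF assms(1,2,4-6)]) (auto simp: L2_on_def)
    show "AE x\<in>K in lebesgue. norm (dirichlet_density g C U W x) \<le> norm (B * ((norm (U x))\<^sup>2 +
        (norm (W x))\<^sup>2))"
      using B(2)
    proof eventually_elim
      case (elim x)
      show ?case
      proof
        assume "x \<in> K"
        then have le: "\<bar>dirichlet_density g C U W x\<bar> \<le> B * (norm (U x) * norm (W x))" using elim
            by simp
        have "norm (U x) * norm (W x) \<le> (norm (U x))\<^sup>2 + (norm (W x))\<^sup>2"
          using sum_squares_bound[of "norm (U x)" "norm (W x)"] mult_nonneg_nonneg[of "norm (U x)"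
              "norm (W x)"]
          by (simp del: zero_le_mult_iff mult_nonneg_nonneg)
        then have "B * (norm (U x) * norm (W x)) \<le> B * ((norm (U x))\<^sup>2 + (norm (W x))\<^sup>2)"
          using B(1) by (rule mult_left_mono)
        with le show "norm (dirichlet_density g C U W x) \<le> norm (B * ((norm (U x))\<^sup>2 + (norm (W
            x))\<^sup>2))"
          unfolding real_norm_def by linarith
      qed
    qed
  qed
qed

lemma dirichlet_density_diff_right:
  "dirichlet_density g C U W x - dirichlet_density g C U W' x = dirichlet_density g C U (\<lambda>x. W x -
      W' x) x"
  by (simp add: dirichlet_density_def matrix_vector_mult_diff_distrib inner_diff_right
      left_diff_distrib)

text \<open>Young's inequality splits the error into a multiple of the squared norm of
  \<open>U\<close>, made small by the weight, and a multiple of the squared distance from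
  \<open>Ws k\<close> to \<open>W\<close>, which then tends to 0. Integrals run over the piece
  \<open>S\<close>, estimates over the compact set \<open>K\<close>.\<close>

lemma dirichlet_integral_tendsto:
  fixes A :: "('a::t2_space, 'n::finite) chart set"
  assumes ambient: "smooth_atlas M A" "riemannian_metric A g" "bounded_elliptic A g" "C \<in> A"
      "compact K" "K \<subseteq> chart_img C"
    and S: "S \<in> sets lebesgue" "S \<subseteq> K"
    and U: "L2_on lebesgue K U" and W: "L2_tendsto_on lebesgue K Ws W"
  shows "(\<lambda>k. LINT x:S|lebesgue. dirichlet_density g C U (Ws k) x)
    \<longlonglongrightarrow> (LINT x:S|lebesgue. dirichlet_density g C U W x)"
proof -
  have L: "L2_on lebesgue K (Ws k)" "L2_on lebesgue K W" for k using W by (auto simp: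
      L2_tendsto_on_def)
  obtain B where B: "B \<ge> 0"
    "AE x\<in>K in lebesgue. \<forall>U W. \<bar>dirichlet_density g C U W x\<bar> \<le> B * (norm (U x) * norm (W x))"
    using dirichlet_density_bound[OF ambient(3-6)] by blast
  let ?d = "\<lambda>k. dirichlet_density g C U (\<lambda>x. Ws k x - W x)"
  let ?u = "LINT x:K|lebesgue. (norm (U x))\<^sup>2" and ?w = "\<lambda>k. LINT x:K|lebesgue. (norm (Ws k x - W
      x))\<^sup>2"
  have Ld: "L2_on lebesgue K (\<lambda>x. Ws k x - W x)" for k by (rule L2_on_diff[OF L])
  have bound: "\<bar>(LINT x:S|lebesgue. dirichlet_density g C U (Ws k) x) - (LINT x:S|lebesgue.
      dirichlet_density g C U W x)\<bar>
      \<le> B * (e / 2 * ?u + 1 / (2 * e) * ?w k)" if e: "e > 0" for e k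
  proof -
    have i: "set_integrable lebesgue K (dirichlet_density g C U (Ws k))"
      "set_integrable lebesgue K (dirichlet_density g C U W)" "set_integrable lebesgue K (?d k)"
      by (intro dirichlet_density_integrable[OF ambient U] L Ld)+
    note iS = i[THEN set_integrable_subset, OF S]
    have "(LINT x:S|lebesgue. dirichlet_density g C U (Ws k) x) - (LINT x:S|lebesgue.
        dirichlet_density g C U W x)
        = (LINT x:S|lebesgue. ?d k x)"
      using set_integral_diff(2)[OF iS(1,2)] by (simp add: dirichlet_density_diff_right)
    also have "\<bar>\<dots>\<bar> \<le> (LINT x:S|lebesgue. \<bar>?d k x\<bar>)"
      using set_integral_norm_bound[OF iS(3)] by simp
    also have "\<dots> \<le> (LINT x:K|lebesgue. \<bar>?d k x\<bar>)"
      unfolding set_lebesgue_integral_def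
      using set_integrable_abs[OF i(3)] set_integrable_abs[OF iS(3)] S(2)
      by (intro integral_mono) (auto simp: set_integrable_def indicator_def)
    also have "\<dots> \<le> (LINT x:K|lebesgue. B * (e / 2 * (norm (U x))\<^sup>2 + 1 / (2 * e) * (norm (Ws k x -
        W x))\<^sup>2))"
    proof (rule set_integral_mono_AE)
      show "set_integrable lebesgue K (\<lambda>x. \<bar>?d k x\<bar>)" by (rule set_integrable_abs[OF i(3)])
      show "set_integrable lebesgue K (\<lambda>x. B * (e / 2 * (norm (U x))\<^sup>2 + 1 / (2 * e) * (norm (Ws k
          x - W x))\<^sup>2))"
        using U Ld by (intro set_integrable_mult_right set_integral_add) (auto simp: L2_on_def)
      show "AE x\<in>K in lebesgue. \<bar>?d k x\<bar> \<le> B * (e / 2 * (norm (U x))\<^sup>2 + 1 / (2 * e) * (norm (Ws k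
          x - W x))\<^sup>2)"
        using B(2)
      proof eventually_elim
        case (elim x)
        show ?case
        proof
          assume "x \<in> K"
          then have "\<bar>?d k x\<bar> \<le> B * (norm (U x) * norm (Ws k x - W x))"
            using elim[rule_format, of U "\<lambda>x. Ws k x - W x"] by simp
          also have "\<dots> \<le> B * (e / 2 * (norm (U x))\<^sup>2 + 1 / (2 * e) * (norm (Ws k x - W x))\<^sup>2)"
            using norm_mult_le_scaled_squares[OF e] B(1) by (intro mult_left_mono)
          finally show "\<bar>?d k x\<bar> \<le> B * (e / 2 * (norm (U x))\<^sup>2 + 1 / (2 * e) * (norm (Ws k x - W
              x))\<^sup>2)" .
        qed
      qed
    qed
    also have "\<dots> = B * (e / 2 * ?u + 1 / (2 * e) * ?w k)"
    proof -
      have i2: "set_integrable lebesgue K (\<lambda>x. e / 2 * (norm (U x))\<^sup>2)"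
        "set_integrable lebesgue K (\<lambda>x. 1 / (2 * e) * (norm (Ws k x - W x))\<^sup>2)"
        using U Ld by (auto simp: L2_on_def)
      show ?thesis
        by (simp only: set_integral_mult_right set_integral_add(2)[OF i2])
    qed
    finally show ?thesis .
  qed
  have w0: "?w \<longlonglongrightarrow> 0" using W by (simp add: L2_tendsto_on_def)
  have u0: "?u \<ge> 0" by (simp add: set_lebesgue_integral_def)
  show ?thesis
  proof (rule LIMSEQ_I)
    fix r :: real assume r: "r > 0"
    \<comment> \<open>This keeps the part containing \<open>?u\<close> strictly below
      \<open>r\<close>; the summand 1 excludes a zero denominator.\<close>
    define e where "e = r / (B * ?u + 1)"
    have Bu: "B * ?u \<ge> 0" using B(1) u0 by simp
    have e: "e > 0" using r Bu by (simp add: e_def)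
    have "B * (e / 2 * ?u) < r"
    proof -
      have "e * (B * ?u + 1) = r" using Bu by (simp add: e_def)
      moreover have "e * (B * ?u) \<ge> 0" using e Bu by simp
      ultimately show ?thesis using e by (simp add: algebra_simps)
    qed
    moreover have "(\<lambda>k. B * (e / 2 * ?u + 1 / (2 * e) * ?w k)) \<longlonglongrightarrow> B * (e / 2 * ?u + 1 / (2 * e) * 0)"
      by (intro tendsto_intros w0)
    ultimately have "\<forall>\<^sub>F k in sequentially. B * (e / 2 * ?u + 1 / (2 * e) * ?w k) < r"
      by (intro order_tendstoD(2)) auto
    then obtain N where "\<And>k. k \<ge> N \<Longrightarrow> B * (e / 2 * ?u + 1 / (2 * e) * ?w k) < r"
      by (auto simp: eventually_sequentially)
    then show "\<exists>N. \<forall>k\<ge>N. norm ((LINT x:S|lebesgue. dirichlet_density g C U (Ws k) x)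
        - (LINT x:S|lebesgue. dirichlet_density g C U W x)) < r"
      using bound[OF e] by (intro exI[of _ N]) (auto intro: le_less_trans)
  qed
qed

section \<open>The conformal change of the Dirichlet form\<close>

lemma manifold_atlas: "compact_connected_manifold M A \<Longrightarrow> smooth_atlas M A"
  by (simp add: compact_connected_manifold_def)

text \<open>A piece is a compact set minus a compact set. The chart is injective on its domain, so
  the image is again such a difference and hence measurable.\<close>

lemma patch_piece:
  fixes A :: "('a::t2_space, 'n::finite) chart set"
  assumes M: "compact_connected_manifold M A" and k: "k < length (patches M A)"
    and C: "C = fst (patches M A ! k)"
  obtains K where "C \<in> A" "compact K" "K \<subseteq> chart_img C"
    "chart_map C ` piece (patches M A) k \<subseteq> K" "chart_map C ` piece (patches M A) k \<in> sets lebesgue"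
proof -
  let ?P = "patches M A"
  have P: "fst (?P ! j) \<in> A" "compact (snd (?P ! j))" "snd (?P ! j) \<subseteq> chart_dom (fst (?P ! j))"
    if "j < length ?P" for j
    using patch_cover_exists[OF M] nth_mem[OF that] unfolding is_patch_cover_def by (auto simp:
        case_prod_beta)
  have CA: "C \<in> A" using P(1)[OF k] C by simp
  have hom: "homeomorphism (chart_dom C) (chart_img C) (chart_map C) (chart_inv C)"
    using smooth_atlas_is_chart[OF manifold_atlas[OF M] CA] by (simp add: is_chart_def)
  define L where "L = snd (?P ! k)"
  \<comment> \<open>Earlier patches are cut down to \<open>L\<close>, where the chart map is
    continuous and injective.\<close>
  define B where "B = (\<Union>j<k. L \<inter> snd (?P ! j))"
  have L: "compact L" "L \<subseteq> chart_dom C" using P(2,3)[OF k] C by (simp_all add: L_def)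
  have B: "compact B" "B \<subseteq> L"
    unfolding B_def using L(1) P(2) k by (auto intro!: compact_UN compact_Int)
  have cont: "continuous_on L (chart_map C)" "continuous_on B (chart_map C)"
    by (rule continuous_on_subset[OF homeomorphism_cont1[OF hom]], use L(2) B(2) in blast)+
  have cL: "compact (chart_map C ` L)" "compact (chart_map C ` B)"
    by (rule compact_continuous_image[OF cont(1) L(1)], rule compact_continuous_image[OF cont(2)
        B(1)])
  have "inj_on (chart_map C) L"
    by (rule inj_on_inverseI[of _ "chart_inv C"]) (rule homeomorphism_apply1[OF hom subsetD[OF
        L(2)]])
  moreover have "piece ?P k = L - B" by (auto simp: piece_def L_def B_def)
  ultimately have eq: "chart_map C ` piece ?P k = chart_map C ` L - chart_map C ` B"
    using B(2) by (simp add: inj_on_image_set_diff)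
  show ?thesis
  proof (rule that[OF CA cL(1)])
    show "chart_map C ` L \<subseteq> chart_img C" using L(2) by (auto simp: chart_img_def)
    show "chart_map C ` piece ?P k \<subseteq> chart_map C ` L" unfolding eq by blast
    show "chart_map C ` piece ?P k \<in> sets lebesgue"
      unfolding eq using borel_compact[OF cL(1)] borel_compact[OF cL(2)] by (intro sets.Diff) auto
  qed
qed

lemma vol_integral_cong_AE:
  fixes A :: "('a::t2_space, 'n::finite) chart set"
  assumes M: "compact_connected_manifold M A"
    and eq: "\<And>C. C \<in> A \<Longrightarrow> AE x\<in>chart_img C in lebesgue. F C x * sqrt (det (g C x)) = F' C x * sqrt
        (det (g' C x))"
  shows "vol_integral M A g F = vol_integral M A g' F'"
  unfolding vol_integral_def Let_def
proof (rule sum.cong[OF refl])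
  fix k assume "k \<in> {..<length (patches M A)}"
  then have k: "k < length (patches M A)" by simp
  define C where "C = fst (patches M A ! k)"
  obtain K where C: "C \<in> A" and K: "K \<subseteq> chart_img C" "chart_map C ` piece (patches M A) k \<subseteq> K"
    by (rule patch_piece[OF M k C_def], rule that) simp_all
  have "(LINT x:chart_map C ` piece (patches M A) k|lebesgue. F C x * sqrt (det (g C x))) =
      (LINT x:chart_map C ` piece (patches M A) k|lebesgue. F' C x * sqrt (det (g' C x)))"
    unfolding set_lebesgue_integral_def
    by (rule lebesgue_integral_cong_AE, use eq[OF C] in eventually_elim) (use K in \<open>auto simp:
        indicator_def\<close>)
  then show "(LINT x:chart_map (fst (patches M A ! k)) ` piece (patches M A) k|lebesgue.
        F (fst (patches M A ! k)) x * sqrt (det (g (fst (patches M A ! k)) x))) =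
      (LINT x:chart_map (fst (patches M A ! k)) ` piece (patches M A) k|lebesgue.
        F' (fst (patches M A ! k)) x * sqrt (det (g' (fst (patches M A ! k)) x)))"
    by (simp only: C_def)
qed

lemma vol_integral_diff:
  fixes A :: "('a::t2_space, 'n::finite) chart set"
  assumes M: "compact_connected_manifold M A"
    and I: "\<And>C K. C \<in> A \<Longrightarrow> compact K \<Longrightarrow> K \<subseteq> chart_img C \<Longrightarrow> set_integrable lebesgue K (\<lambda>x. F C x *
        sqrt (det (g C x)))"
      "\<And>C K. C \<in> A \<Longrightarrow> compact K \<Longrightarrow> K \<subseteq> chart_img C \<Longrightarrow> set_integrable lebesgue K (\<lambda>x. F' C x * sqrt
          (det (g C x)))"
  shows "vol_integral M A g (\<lambda>C x. F C x - F' C x) = vol_integral M A g F - vol_integral M A g F'"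
  unfolding vol_integral_def Let_def sum_subtractf[symmetric]
proof (rule sum.cong[OF refl])
  fix k assume "k \<in> {..<length (patches M A)}"
  then have k: "k < length (patches M A)" by simp
  define C where "C = fst (patches M A ! k)"
  define S where "S = chart_map C ` piece (patches M A) k"
  obtain K where C: "C \<in> A" "compact K" "K \<subseteq> chart_img C" and S: "S \<in> sets lebesgue" "S \<subseteq> K"
    by (rule patch_piece[OF M k C_def], rule that) (simp_all add: S_def)
  have "(LINT x:S|lebesgue. F C x * sqrt (det (g C x)) - F' C x * sqrt (det (g C x))) =
      (LINT x:S|lebesgue. F C x * sqrt (det (g C x))) - (LINT x:S|lebesgue. F' C x * sqrt (det (g
          C x)))"
    by (rule set_integral_diff(2)[OF I(1)[OF C, THEN set_integrable_subset, OF S] I(2)[OF C, THEN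
        set_integrable_subset, OF S]])
  then show "(LINT x:chart_map (fst (patches M A ! k)) ` piece (patches M A) k|lebesgue.
      (F (fst (patches M A ! k)) x - F' (fst (patches M A ! k)) x) * sqrt (det (g (fst (patches M
          A ! k)) x))) =
    (LINT x:chart_map (fst (patches M A ! k)) ` piece (patches M A) k|lebesgue.
      F (fst (patches M A ! k)) x * sqrt (det (g (fst (patches M A ! k)) x))) -
    (LINT x:chart_map (fst (patches M A ! k)) ` piece (patches M A) k|lebesgue.
      F' (fst (patches M A ! k)) x * sqrt (det (g (fst (patches M A ! k)) x)))"
    by (simp only: S_def C_def left_diff_distrib)
qed

lemma vol_integral_dirichlet_tendsto:
  fixes A :: "('a::t2_space, 'n::finite) chart set"
  assumes M: "compact_connected_manifold M A" and g: "riemannian_metric A g" "bounded_elliptic A g"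
    and U: "\<And>C K. C \<in> A \<Longrightarrow> compact K \<Longrightarrow> K \<subseteq> chart_img C \<Longrightarrow> L2_on lebesgue K (U C)"
    and W: "\<And>C K. C \<in> A \<Longrightarrow> compact K \<Longrightarrow> K \<subseteq> chart_img C \<Longrightarrow> L2_tendsto_on lebesgue K (\<lambda>m. Ws m C) (W C)"
  shows "(\<lambda>m. vol_integral M A g (\<lambda>C x. U C x \<bullet> (matrix_inv (g C x) *v Ws m C x)))
    \<longlonglongrightarrow> vol_integral M A g (\<lambda>C x. U C x \<bullet> (matrix_inv (g C x) *v W C x))"
  unfolding vol_integral_def Let_def
proof (rule tendsto_sum)
  fix k assume "k \<in> {..<length (patches M A)}"
  then have k: "k < length (patches M A)" by simp
  define C where "C = fst (patches M A ! k)"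
  define S where "S = chart_map C ` piece (patches M A) k"
  obtain K where C: "C \<in> A" "compact K" "K \<subseteq> chart_img C" and S: "S \<in> sets lebesgue" "S \<subseteq> K"
    by (rule patch_piece[OF M k C_def], rule that) (simp_all add: S_def)
  have "(\<lambda>m. LINT x:S|lebesgue. dirichlet_density g C (U C) (Ws m C) x)
      \<longlonglongrightarrow> (LINT x:S|lebesgue. dirichlet_density g C (U C) (W C) x)"
    by (rule dirichlet_integral_tendsto[OF manifold_atlas[OF M] g C S U[OF C] W[OF C]])
  then show "(\<lambda>m. LINT x:chart_map (fst (patches M A ! k)) ` piece (patches M A) k|lebesgue.
      U (fst (patches M A ! k)) x \<bullet> (matrix_inv (g (fst (patches M A ! k)) x) *v Ws m (fst
          (patches M A ! k)) x)
        * sqrt (det (g (fst (patches M A ! k)) x)))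
    \<longlonglongrightarrow> (LINT x:chart_map (fst (patches M A ! k)) ` piece (patches M A) k|lebesgue.
      U (fst (patches M A ! k)) x \<bullet> (matrix_inv (g (fst (patches M A ! k)) x) *v W (fst (patches M
          A ! k)) x)
        * sqrt (det (g (fst (patches M A ! k)) x)))"
    by (simp only: S_def C_def dirichlet_density_def)
qed

section \<open>The product identity and its integrated form\<close>

lemma symmetric_matrix_inner_swap:
  fixes G :: "real^'n^'n"
  assumes "transpose G = G"
  shows "a \<bullet> (G *v b) = b \<bullet> (G *v a)"
  using assms by (metis dot_lmul_matrix inner_commute vector_transpose_matrix)

text \<open>Read a = du, b = dv, c = dq: the bracketed vectors are d(qu), d(qv) and d(quv). The
  mixed terms cancel once symmetry of \<open>G\<close> exchanges a and c.\<close>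

lemma product_form_identity:
  fixes G :: "real^'n^'n" and a b c :: "real^'n" and q u v :: real
  assumes G: "transpose G = G"
  shows "q\<^sup>2 * (a \<bullet> (G *v b)) = (q *\<^sub>R a + u *\<^sub>R c) \<bullet> (G *v (q *\<^sub>R b + v *\<^sub>R c))
    - c \<bullet> (G *v (q *\<^sub>R (v *\<^sub>R a + u *\<^sub>R b) + (v * u) *\<^sub>R c))"
  by (simp add: matrix_vector_right_distrib matrix_vector_mult_scaleR inner_add_left inner_add_right
      symmetric_matrix_inner_swap[OF G, of c a] power2_eq_square algebra_simps)

text \<open>The triple product is bracketed so that a smooth factor always multiplies an
  \<open>H1\<close> function; the product rule then applies twice.\<close>

lemma pairing_product_AE:
  fixes A :: "('a::t2_space, 'n::finite) chart set"
  assumes A: "smooth_atlas M A" and g: "riemannian_metric A g" and C: "C \<in> A"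
    and q: "smooth_fun A q" and v: "smooth_fun A v" and u: "u \<in> H1 A"
  shows "AE x\<in>chart_img C in lebesgue. (in_chart C q x)\<^sup>2 * pairing g u v C x =
    pairing g (\<lambda>p. q p * u p) (\<lambda>p. q p * v p) C x - pairing g q (\<lambda>p. q p * (v p * u p)) C x"
proof -
  have ch: "is_chart M C" by (rule smooth_atlas_is_chart[OF A C])
  from riemannian_metric_AE[OF g C] wgrad_mult_AE[OF ch C q u] wgrad_mult_AE[OF ch C q
      smooth_fun_H1[OF A v]]
    wgrad_mult_AE[OF ch C q H1_mult[OF A v u]] wgrad_mult_AE[OF ch C v u] wgrad_smooth_AE[OF A C
        q] wgrad_smooth_AE[OF A C v]
  show ?thesis
  proof eventually_elim
    case (elim x)
    show ?case
    proof
      assume "x \<in> chart_img C"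
      then show "(in_chart C q x)\<^sup>2 * pairing g u v C x =
        pairing g (\<lambda>p. q p * u p) (\<lambda>p. q p * v p) C x - pairing g q (\<lambda>p. q p * (v p * u p)) C x"
        using elim product_form_identity[of "matrix_inv (g C x)" "in_chart C q x" "wgrad u C x"
            "wgrad v C x"
          "in_chart C u x" "wgrad q C x" "in_chart C v x"]
        by (simp add: pairing_eq_inner)
    qed
  qed
qed

lemma pairing_integrable:
  fixes A :: "('a::t2_space, 'n::finite) chart set"
  assumes "smooth_atlas M A" "riemannian_metric A g" "bounded_elliptic A g" "u \<in> H1 A" "w \<in> H1 A"
    and "C \<in> A" "compact K" "K \<subseteq> chart_img C"
  shows "set_integrable lebesgue K (\<lambda>x. pairing g u w C x * sqrt (det (g C x)))"
  using dirichlet_density_integrable[OF assms(1-3,6-8) H1_L2_on(2)[OF assms(4,6-8)] H1_L2_on(2)[OF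
      assms(5,6-8)]]
  by (simp add: pairing_eq_inner dirichlet_density_def[abs_def])

text \<open>Both sides are limits of one sequence, since they agree at each \<open>vs k\<close>. The
  support condition on the triple product is inherited from \<open>\<psi>\<close>, so
  \<open>v\<close> may be a test function as well as an extension of a boundary datum.\<close>

lemma weighted_pairing_eq:
  fixes A :: "('a::t2_space, 'n::finite) chart set"
  assumes M: "compact_connected_manifold M A" and g: "riemannian_metric A g" "bounded_elliptic A g"
    and q: "smooth_fun A q"
    and harm: "\<And>w f. w \<in> H1 A \<Longrightarrow> has_trace A w f \<Longrightarrow> bd_support A f \<subseteq> \<Gamma> \<Longrightarrow> vol_integral M A g (pairing
        g q w) = 0"
    and u: "u \<in> H1 A" "has_trace A u \<psi>" "bd_support A \<psi> \<subseteq> \<Gamma>"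
    and vs: "\<And>k. smooth_fun A (vs k)" "H1_tendsto A vs v"
  shows "vol_integral M A g (\<lambda>C x. (in_chart C q x)\<^sup>2 * pairing g u v C x) =
    vol_integral M A g (pairing g (\<lambda>p. q p * u p) (\<lambda>p. q p * v p))"
proof -
  have A: "smooth_atlas M A" by (rule manifold_atlas[OF M])
  have qu: "(\<lambda>p. q p * u p) \<in> H1 A" by (rule H1_mult[OF A q u(1)])
  \<comment> \<open>The weight q^2 is attached to the fixed argument, which stays square integrable
    on compact sets, so that the convergence of \<open>wgrad (vs k)\<close> applies
    directly.\<close>
  let ?U = "\<lambda>C x. in_chart C (\<lambda>p. q p * q p) x *\<^sub>R wgrad u C x"
  have step: "vol_integral M A g (\<lambda>C x. (in_chart C q x)\<^sup>2 * pairing g u (vs k) C x) =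
    vol_integral M A g (pairing g (\<lambda>p. q p * u p) (\<lambda>p. q p * vs k p))" for k
  proof -
    let ?w = "\<lambda>p. q p * (vs k p * u p)"
    have vk: "vs k \<in> H1 A" by (rule smooth_fun_H1[OF A vs(1)])
    have w: "?w \<in> H1 A" by (rule H1_mult[OF A q H1_mult[OF A vs(1) u(1)]])
    have "has_trace A ?w (\<lambda>p. q p * (vs k p * \<psi> p))"
      by (rule has_trace_mult[OF A q has_trace_mult[OF A vs(1) u(2)]])
    moreover have "bd_support A (\<lambda>p. q p * (vs k p * \<psi> p)) \<subseteq> \<Gamma>"
      by (rule order_trans[OF bd_support_mult_subset order_trans[OF bd_support_mult_subset u(3)]])
    ultimately have 0: "vol_integral M A g (pairing g q ?w) = 0" by (rule harm[OF w])
    have "vol_integral M A g (\<lambda>C x. (in_chart C q x)\<^sup>2 * pairing g u (vs k) C x) =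
      vol_integral M A g (\<lambda>C x. pairing g (\<lambda>p. q p * u p) (\<lambda>p. q p * vs k p) C x - pairing g q ?w
          C x)"
    proof (rule vol_integral_cong_AE[OF M])
      fix C assume "C \<in> A"
      from pairing_product_AE[OF A g(1) this q vs(1)[of k] u(1)]
      show "AE x\<in>chart_img C in lebesgue. (in_chart C q x)\<^sup>2 * pairing g u (vs k) C x * sqrt (det
          (g C x)) =
        (pairing g (\<lambda>p. q p * u p) (\<lambda>p. q p * vs k p) C x - pairing g q ?w C x) * sqrt (det (g C
            x))"
        by eventually_elim simp
    qed
    also have "\<dots> = vol_integral M A g (pairing g (\<lambda>p. q p * u p) (\<lambda>p. q p * vs k p)) -
        vol_integral M A g (pairing g q ?w)"
      by (rule vol_integral_diff[OF M])
        (rule pairing_integrable[OF A g qu H1_mult[OF A q vk]] pairing_integrable[OF A g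
            smooth_fun_H1[OF A q] w]; assumption)+
    finally show ?thesis by (simp only: 0 diff_zero)
  qed
  have left: "(\<lambda>k. vol_integral M A g (\<lambda>C x. ?U C x \<bullet> (matrix_inv (g C x) *v wgrad (vs k) C x)))
      \<longlonglongrightarrow> vol_integral M A g (\<lambda>C x. ?U C x \<bullet> (matrix_inv (g C x) *v wgrad v C x))"
  proof (rule vol_integral_dirichlet_tendsto[OF M g])
    fix C K assume C: "C \<in> A" and K: "compact K" "K \<subseteq> chart_img C"
    show "L2_tendsto_on lebesgue K (\<lambda>k. wgrad (vs k) C) (wgrad v C)"
      using vs(2) C K by (simp add: H1_tendsto_def)
    obtain B where B: "B \<ge> 0" "\<And>x. x \<in> K \<Longrightarrow> \<bar>in_chart C (\<lambda>p. q p * q p) x\<bar> \<le> B"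
      and qc: "continuous_on K (in_chart C (\<lambda>p. q p * q p))" "K \<in> sets borel"
      using smooth_fun_bounds[OF smooth_fun_mult[OF q q] C K] by metis
    note L = H1_L2_on(2)[OF u(1) C K]
    show "L2_on lebesgue K (?U C)"
    proof (rule L2_on_norm_bound(1)[OF _ L L, where B = B])
      show "set_borel_measurable lebesgue K (?U C)"
        using L by (intro set_borel_measurable_scaleR set_borel_measurable_lebesgue_continuous[OF
            qc(2,1)])
          (simp add: L2_on_def)
      show "AE x\<in>K in lebesgue. norm (?U C x) \<le> B * norm (wgrad u C x) + B * norm (wgrad u C x)"
      proof (rule AE_I2, rule impI)
        fix x assume "x \<in> K"
        then have "norm (?U C x) \<le> B * norm (wgrad u C x)"
          using B(2) unfolding norm_scaleR by (intro mult_right_mono) auto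
        then show "norm (?U C x) \<le> B * norm (wgrad u C x) + B * norm (wgrad u C x)"
          using mult_nonneg_nonneg[OF B(1) norm_ge_zero[of "wgrad u C x"]] by linarith
      qed
    qed
  qed
  have right: "(\<lambda>k. vol_integral M A g (\<lambda>C x. wgrad (\<lambda>p. q p * u p) C x \<bullet>
        (matrix_inv (g C x) *v wgrad (\<lambda>p. q p * vs k p) C x)))
      \<longlonglongrightarrow> vol_integral M A g (\<lambda>C x. wgrad (\<lambda>p. q p * u p) C x \<bullet>
        (matrix_inv (g C x) *v wgrad (\<lambda>p. q p * v p) C x))"
    by (rule vol_integral_dirichlet_tendsto[OF M g H1_L2_on(2)[OF qu]])
      (use H1_tendsto_mult[OF A q vs(2)] in \<open>simp_all add: H1_tendsto_def\<close>)
  have U: "?U C x \<bullet> (matrix_inv (g C x) *v wgrad w C x) = (in_chart C q x)\<^sup>2 * pairing g u w C x"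
      for C x w
    by (simp add: pairing_eq_inner power2_eq_square)
  have "(\<lambda>k. vol_integral M A g (pairing g (\<lambda>p. q p * u p) (\<lambda>p. q p * vs k p)))
      \<longlonglongrightarrow> vol_integral M A g (\<lambda>C x. (in_chart C q x)\<^sup>2 * pairing g u v C x)"
    using left unfolding U step .
  moreover have "(\<lambda>k. vol_integral M A g (pairing g (\<lambda>p. q p * u p) (\<lambda>p. q p * vs k p)))
      \<longlonglongrightarrow> vol_integral M A g (pairing g (\<lambda>p. q p * u p) (\<lambda>p. q p * v p))"
    using right unfolding pairing_eq_inner[symmetric] .
  ultimately show ?thesis by (rule LIMSEQ_unique)
qed

lemma vol_integral_conformal:
  fixes A :: "('a::t2_space, 'n::finite) chart set"
  assumes M: "compact_connected_manifold M A" and g: "riemannian_metric A g"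
    and n: "CARD('n) \<ge> 2" and c: "\<And>p. p \<in> M \<Longrightarrow> 0 < c p" and q: "\<And>p. p \<in> M \<Longrightarrow> q p = c p ^ (CARD('n) -
        2)"
  shows "vol_integral M A (conformal (\<lambda>p. c p ^ 4) g) (pairing (conformal (\<lambda>p. c p ^ 4) g) u w) =
    vol_integral M A g (\<lambda>C x. (in_chart C q x)\<^sup>2 * pairing g u w C x)"
proof (rule vol_integral_cong_AE[OF M])
  fix C assume C: "C \<in> A"
  have ch: "is_chart M C" by (rule smooth_atlas_is_chart[OF manifold_atlas[OF M] C])
  let ?g = "conformal (\<lambda>p. c p ^ 4) g"
  show "AE x\<in>chart_img C in lebesgue. pairing ?g u w C x * sqrt (det (?g C x)) =
      (in_chart C q x)\<^sup>2 * pairing g u w C x * sqrt (det (g C x))"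
    using riemannian_metric_AE[OF g C]
  proof eventually_elim
    case (elim x)
    show ?case
    proof
      assume x: "x \<in> chart_img C"
      define t where "t = c (chart_inv C x)"
      have inM: "chart_inv C x \<in> M" by (rule chart_inv_in_dom(3)[OF ch x])
      have t: "t > 0" using c[OF inM] by (simp add: t_def)
      have inv: "invertible (g C x)" using elim x by blast
      have gx: "?g C x = t ^ 4 *\<^sub>R g C x" by (simp add: conformal_def in_chart_def t_def)
      have "(t ^ 4) ^ CARD('n) = (t ^ (2 * CARD('n)))\<^sup>2"
        by (simp add: power_mult[symmetric] mult.commute)
      then have "sqrt (det (?g C x)) = t ^ (2 * CARD('n)) * sqrt (det (g C x))"
        unfolding gx det_scaleR real_sqrt_mult using t by simp
      moreover have "pairing ?g u w C x = inverse (t ^ 4) * pairing g u w C x"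
        unfolding pairing_eq_inner gx using t
        by (simp add: matrix_inv_scaleR[OF inv] scaleR_matrix_vector_assoc[symmetric])
      moreover have "inverse (t ^ 4) * t ^ (2 * CARD('n)) = (in_chart C q x)\<^sup>2"
      proof -
        have "in_chart C q x = t ^ (CARD('n) - 2)" using q[OF inM] by (simp add: in_chart_def t_def)
        \<comment> \<open>Subtraction of natural numbers is exact here because n \<ge> 2. The 4 is
          cancelled by the scaling of the inverse metric.\<close>
        moreover have "2 * CARD('n) = (CARD('n) - 2) * 2 + 4" using n by simp
        ultimately show ?thesis using t by (simp add: power_add power_mult)
      qed
      ultimately show "pairing ?g u w C x * sqrt (det (?g C x)) =
          (in_chart C q x)\<^sup>2 * pairing g u w C x * sqrt (det (g C x))"
        by (simp add: mult_ac)
    qed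
  qed
qed

section \<open>Transfer of weak solutions and of the Dirichlet-to-Neumann values\<close>

lemma smooth_approximants:
  assumes "has_trace A v f \<or> v \<in> H10 M A"
  obtains vs where "\<And>k. smooth_fun A (vs k)" "H1_tendsto A vs v"
  using assms unfolding has_trace_def H10_def Cc_interior_def by auto

lemma wgrad_cong:
  assumes "is_chart M C" "\<And>p. p \<in> M \<Longrightarrow> u p = v p"
  shows "wgrad u C = wgrad v C"
proof -
  have "weak_gradient (interior (chart_img C)) (in_chart C u) = weak_gradient (interior (chart_img
      C)) (in_chart C v)"
  proof (rule weak_gradient_cong)
    fix x assume "x \<in> interior (chart_img C)"
    then have "x \<in> chart_img C" using interior_subset by blast
    then show "in_chart C u x = in_chart C v x"
      using assms chart_inv_in_dom(3)[OF assms(1)] by (simp add: in_chart_def)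
  qed
  then show ?thesis by (simp add: wgrad_def)
qed

theorem proposition1p2:
  fixes M :: "'a::t2_space set"
    and A :: "('a, 'n::finite) chart set"
    and g :: "('a, 'n) metric"
    and \<Gamma> :: "'a set"
    and c :: "'a \<Rightarrow> real"
  assumes "CARD('n) \<ge> 2"
    and "compact_connected_manifold M A"
    and "riemannian_metric A g"
    and "bounded_elliptic A g"
    and "openin (top_of_set (mfd_boundary A)) \<Gamma>" and "\<Gamma> \<noteq> {}"
    and "smooth_fun A c" and "\<forall>p\<in>M. 0 < c p"
    and "\<forall>p\<in>\<Gamma>. c p = 1"
    and "\<forall>w\<in>H1 A. \<forall>f. has_trace A w f \<and> bd_support A f \<subseteq> \<Gamma> \<longrightarrow>
           vol_integral M A g (pairing g (\<lambda>p. c p ^ (CARD('n) - 2)) w) = 0"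
  shows "DN_map M A (conformal (\<lambda>p. c p ^ 4) g) \<Gamma> = DN_map M A g \<Gamma>"
proof -
  note M = assms(2) and g = assms(3,4)
  have A: "smooth_atlas M A" by (rule manifold_atlas[OF M])
  \<comment> \<open>The value off \<open>M\<close> is immaterial; with \<open>1\<close> the multiplications by \<open>q\<close> and \<open>r\<close> are mutually
      inverse
      on functions on the whole type.\<close>
  define q where "q p = (if p \<in> M then c p ^ (CARD('n) - 2) else 1)" for p
  define r where "r p = inverse (q p)" for p
  let ?g = "conformal (\<lambda>p. c p ^ 4) g"
  have q0: "q p \<noteq> 0" for p using assms(8)[rule_format, of p] by (cases "p \<in> M") (simp_all add:
      q_def)
  have qr: "q p * (r p * w p) = w p" "r p * (q p * w p) = w p" for p and w :: "'a \<Rightarrow> real"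
    using q0[of p] by (simp_all add: r_def)
  have q: "smooth_fun A q"
    by (rule smooth_fun_cong[OF A smooth_fun_power[OF assms(7)]]) (simp add: q_def)
  have r: "smooth_fun A r"
    unfolding r_def by (rule smooth_fun_inverse[OF A q q0])
  \<comment> \<open>\<open>q\<close> and c^(n-2) agree on \<open>M\<close>, and coordinate
    expressions see only values there.\<close>
  have harm: "vol_integral M A g (pairing g q w) = 0"
    if "w \<in> H1 A" "has_trace A w f" "bd_support A f \<subseteq> \<Gamma>" for w f
  proof -
    have "vol_integral M A g (pairing g q w) = vol_integral M A g (pairing g (\<lambda>p. c p ^ (CARD('n)
        - 2)) w)"
    proof (rule vol_integral_cong_AE[OF M])
      fix C assume "C \<in> A"
      then have "wgrad q C = wgrad (\<lambda>p. c p ^ (CARD('n) - 2)) C"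
        by (intro wgrad_cong[OF smooth_atlas_is_chart[OF A]]) (simp_all add: q_def)
      then show "AE x\<in>chart_img C in lebesgue. pairing g q w C x * sqrt (det (g C x)) =
          pairing g (\<lambda>p. c p ^ (CARD('n) - 2)) w C x * sqrt (det (g C x))"
        by (simp add: pairing_def)
    qed
    then show ?thesis using assms(10) that by simp
  qed
  have form: "vol_integral M A ?g (pairing ?g u v) = vol_integral M A g (pairing g (\<lambda>p. q p * u p)
      (\<lambda>p. q p * v p))"
    if "u \<in> H1 A" "has_trace A u \<psi>" "bd_support A \<psi> \<subseteq> \<Gamma>" and v: "has_trace A v f \<or> v \<in> H10 M A"
        for u \<psi> v f
  proof -
    obtain vs where vs: "\<And>k. smooth_fun A (vs k)" "H1_tendsto A vs v"
      using smooth_approximants[OF v] by blast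
    have "vol_integral M A ?g (pairing ?g u v) = vol_integral M A g (\<lambda>C x. (in_chart C q x)\<^sup>2 *
        pairing g u v C x)"
      using assms(8) by (intro vol_integral_conformal[OF M g(1) assms(1)]) (simp_all add: q_def)
    also have "\<dots> = vol_integral M A g (pairing g (\<lambda>p. q p * u p) (\<lambda>p. q p * v p))"
      by (rule weighted_pairing_eq[OF M g q harm that(1-3) vs])
    finally show ?thesis .
  qed
  have "mfd_boundary A \<subseteq> M"
    using smooth_atlas_is_chart[OF A] openin_imp_subset unfolding mfd_boundary_def is_chart_def by
        blast
  then have \<Gamma>q: "q p = 1" if "p \<in> \<Gamma>" for p
    using that assms(9) openin_imp_subset[OF assms(5)] by (auto simp: q_def)
  \<comment> \<open>Where h \<psi> differs from \<open>\<psi>\<close>, \<open>\<psi>\<close> is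
    nonzero and \<open>h\<close> is not 1; such points lie off \<Gamma>, hence off the support, and
    form a null set.\<close>
  have trace: "has_trace A (\<lambda>p. h p * u p) \<psi>"
    if "smooth_fun A h" "has_trace A u \<psi>" "bd_support A \<psi> \<subseteq> \<Gamma>" "\<And>p. p \<in> \<Gamma> \<Longrightarrow> h p = 1" for h u \<psi>
  proof (rule has_trace_cong[OF A has_trace_mult[OF A that(1,2)]])
    show "bd_null A {p. h p * \<psi> p \<noteq> \<psi> p}"
      by (rule bd_null_subset[OF bd_null_outside_support[OF A, of \<psi>]]) (use that(3,4) in auto)
  qed
  have \<Gamma>r: "r p = 1" if "p \<in> \<Gamma>" for p using \<Gamma>q[OF that] by (simp add: r_def)
  have to_g: "weak_solution M A g \<psi> (\<lambda>p. q p * u p)"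
    if u: "weak_solution M A ?g \<psi> u" and \<psi>: "bd_support A \<psi> \<subseteq> \<Gamma>" for u \<psi>
    unfolding weak_solution_def
  proof (intro conjI ballI)
    have u': "u \<in> H1 A" "has_trace A u \<psi>" using u by (auto simp: weak_solution_def)
    show "(\<lambda>p. q p * u p) \<in> H1 A" by (rule H1_mult[OF A q u'(1)])
    show "has_trace A (\<lambda>p. q p * u p) \<psi>" by (rule trace[OF q u'(2) \<psi> \<Gamma>q])
    fix w assume "w \<in> H10 M A"
    \<comment> \<open>Testing with \<open>w\<close> for \<open>g\<close> amounts to testing with w/q
      for \<open>c^4 g\<close>.\<close>
    then have w: "(\<lambda>p. r p * w p) \<in> H10 M A" by (rule H10_mult[OF A r])
    then have "vol_integral M A ?g (pairing ?g u (\<lambda>p. r p * w p)) = 0" using u by (simp add: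
        weak_solution_def)
    then show "vol_integral M A g (pairing g (\<lambda>p. q p * u p) w) = 0"
      using form[OF u' \<psi> disjI2[OF w]] by (simp add: qr)
  qed
  have from_g: "weak_solution M A ?g \<psi> (\<lambda>p. r p * u p)"
    if u: "weak_solution M A g \<psi> u" and \<psi>: "bd_support A \<psi> \<subseteq> \<Gamma>" for u \<psi>
  proof -
    have u': "u \<in> H1 A" "has_trace A u \<psi>" using u by (auto simp: weak_solution_def)
    have ru: "(\<lambda>p. r p * u p) \<in> H1 A" "has_trace A (\<lambda>p. r p * u p) \<psi>"
      by (rule H1_mult[OF A r u'(1)], rule trace[OF r u'(2) \<psi> \<Gamma>r])
    \<comment> \<open>Inserting \<open>r u\<close> into \<open>form\<close> gives back
      \<open>u\<close>, and the test function on the side of \<open>g\<close> becomes q w.\<close>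
    have "vol_integral M A ?g (pairing ?g (\<lambda>p. r p * u p) w) = 0" if w: "w \<in> H10 M A" for w
      using form[OF ru \<psi> disjI2[OF w]] u H10_mult[OF A q w] by (simp add: weak_solution_def qr)
    with ru show ?thesis by (simp add: weak_solution_def)
  qed
  \<comment> \<open>The correspondence sends (u, v) to (qu, qv), with inverse given by
    \<open>r\<close>. It keeps the boundary data \<open>\<psi>\<close> and \<open>\<phi>\<close>
    because \<open>q\<close> and \<open>r\<close> are 1 on \<Gamma>, which contains both
    supports.\<close>
  have "(\<exists>u v. weak_solution M A ?g \<psi> u \<and> v \<in> H1 A \<and> has_trace A v \<phi> \<and> s = vol_integral M A ?g
      (pairing ?g u v)) \<longleftrightarrow>
      (\<exists>u v. weak_solution M A g \<psi> u \<and> v \<in> H1 A \<and> has_trace A v \<phi> \<and> s = vol_integral M A g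
          (pairing g u v))"
    if \<psi>: "bd_support A \<psi> \<subseteq> \<Gamma>" and \<phi>: "bd_support A \<phi> \<subseteq> \<Gamma>" for \<psi> \<phi> s
  proof
    assume "\<exists>u v. weak_solution M A ?g \<psi> u \<and> v \<in> H1 A \<and> has_trace A v \<phi> \<and> s = vol_integral M A ?g
        (pairing ?g u v)"
    then obtain u v where u: "weak_solution M A ?g \<psi> u" and v: "v \<in> H1 A" "has_trace A v \<phi>"
      and s: "s = vol_integral M A ?g (pairing ?g u v)" by blast
    have u': "u \<in> H1 A" "has_trace A u \<psi>" using u by (auto simp: weak_solution_def)
    have "s = vol_integral M A g (pairing g (\<lambda>p. q p * u p) (\<lambda>p. q p * v p))"
      unfolding s by (rule form[OF u' \<psi> disjI1[OF v(2)]])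
    with to_g[OF u \<psi>] H1_mult[OF A q v(1)] trace[OF q v(2) \<phi> \<Gamma>q]
    show "\<exists>u v. weak_solution M A g \<psi> u \<and> v \<in> H1 A \<and> has_trace A v \<phi> \<and> s = vol_integral M A g
        (pairing g u v)"
      by blast
  next
    assume "\<exists>u v. weak_solution M A g \<psi> u \<and> v \<in> H1 A \<and> has_trace A v \<phi> \<and> s = vol_integral M A g
        (pairing g u v)"
    then obtain u v where u: "weak_solution M A g \<psi> u" and v: "v \<in> H1 A" "has_trace A v \<phi>"
      and s: "s = vol_integral M A g (pairing g u v)" by blast
    note ru = from_g[OF u \<psi>] and rv = H1_mult[OF A r v(1)] trace[OF r v(2) \<phi> \<Gamma>r]
    have ru': "(\<lambda>p. r p * u p) \<in> H1 A" "has_trace A (\<lambda>p. r p * u p) \<psi>" using ru by (auto simp: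
        weak_solution_def)
    have "s = vol_integral M A ?g (pairing ?g (\<lambda>p. r p * u p) (\<lambda>p. r p * v p))"
      using form[OF ru' \<psi> disjI1[OF rv(2)]] s by (simp add: qr)
    with ru rv
    show "\<exists>u v. weak_solution M A ?g \<psi> u \<and> v \<in> H1 A \<and> has_trace A v \<phi> \<and> s = vol_integral M A ?g
        (pairing ?g u v)"
      by blast
  qed
  then show ?thesis
    unfolding DN_map_def by (intro restrict_ext) (simp add: H12_co_def)
qed

end
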